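(* Let $d\ge 2$ and let $\mathbf{k}$ be an algebraically closed field of characteristic not dividing $(d-1)d$. Let $V$ be a finite-dimensional $\mathbf{k}$-vector space. (i) For a single homogeneous form $f$ of degree $d$ on $V$, $$\mathrm{rk}^S(f)\le (d-1)\cdot g_{\mathrm{sym}}(f).$$ (ii) If homogeneous forms $f_1,\dots,f_s$ of degree $d$ on $V$ define a complete intersection of codimension $s$ in $V$, then for $\overline f=(f_1,\dots,f_s)$, $$\mathrm{rk}^S(\overline f)\le (d-1)\cdot (g_{\mathrm{sym}}(\overline f)+s-1).$$
   Context: Schmidt rank of a homogeneous polynomial $f$: $\mathrm{rk}^S(f)$ is the minimal $r\ge 0$ such that $f=\sum_{i=1}^r g_ih_i$ with $g_i,h_i$ homogeneous polynomials on $V$ of positive degrees. For a collection $\overline f=(f_1,\dots,f_s)$, $s\ge 1$, of forms of the same degree, $\mathrm{rk}^S(\overline f)$ is the minimum of $\mathrm{rk}^S(c_1f_1+\dots+c_sf_s)$ over $(c_1,\dots,c_s)\in\mathbf{k}^s\setminus\{0\}$. $H_f(x)(\cdot,\cdot)$ denotes the Hessian form of $f$ at $x\in V$, the symmetric bilinear form on $V$ given by the second derivatives of $f$ at $x$. $Z^{\mathrm{sym}}_f=\{(v,x)\in V\times V\mid v\in\ker H_f(x)\}$ and $g_{\mathrm{sym}}(f)=\mathrm{codim}_{V\times V}Z^{\mathrm{sym}}_f$. For a collection $\overline f=(f_1,\dots,f_s)$, $Z^{\mathrm{sym}}_{\overline f}\subset V\times V$ is the locus of $(v,x)$ such that the linear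 map $V\to\mathbf{k}^s$, $v'\mapsto (H_{f_i}(x)(v',v))_{1\le i\le s}$, has rank $<s$, and $g_{\mathrm{sym}}(\overline f)=\mathrm{codim}_{V\times V}Z^{\mathrm{sym}}_{\overline f}$. The forms $f_1,\dots,f_s$ define a complete intersection of codimension $s$ if the subscheme $V(\overline f)\subset V$ defined by the ideal $(f_1,\dots,f_s)$ has codimension $s$ in $V$. *)

theory Defs
  imports
    "HOL-Library.Poly_Mapping"
    "HOL-Library.Extended_Nat"
    "HOL-Computational_Algebra.Polynomial"
    "Jordan_Normal_Form.DL_Rank"
begin

section \<open>Polynomials on affine space\<close>

text \<open>
  The vector space \<open>V\<close> of dimension \<open>n \<ge> 0\<close> is \<open>carrier_vec n\<close>. Polynomials are formal
  polynomials in the variables \<open>x\<^sub>0, x\<^sub>1, \<dots>\<close>: a monomial maps each variable to its exponent,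
  a polynomial maps each monomial to its coefficient, and multiplication is convolution.
  The polynomials on \<open>V\<close> are those in which only \<open>x\<^sub>0, \<dots>, x\<^sub>n\<^sub>-\<^sub>1\<close> occur.
\<close>

type_synonym 'k mpoly = "(nat \<Rightarrow>\<^sub>0 nat) \<Rightarrow>\<^sub>0 'k"

definition polys_on :: "nat \<Rightarrow> 'k::zero mpoly set" where
  "polys_on n = {p. \<forall>m \<in> Poly_Mapping.keys p. Poly_Mapping.keys m \<subseteq> {..<n}}"

definition mpoly_eval :: "'k::comm_semiring_1 mpoly \<Rightarrow> 'k vec \<Rightarrow> 'k" where
  "mpoly_eval p x =
    (\<Sum>m \<in> Poly_Mapping.keys p. Poly_Mapping.lookup p m *
      (\<Prod>i \<in> Poly_Mapping.keys m. (x $ i) ^ Poly_Mapping.lookup m i))"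

definition total_degree :: "(nat \<Rightarrow>\<^sub>0 nat) \<Rightarrow> nat" where
  "total_degree m = (\<Sum>i \<in> Poly_Mapping.keys m. Poly_Mapping.lookup m i)"

text \<open>The zero polynomial counts as a form of every degree.\<close>

definition is_form :: "nat \<Rightarrow> nat \<Rightarrow> 'k::zero mpoly \<Rightarrow> bool" where
  "is_form n d p \<longleftrightarrow> p \<in> polys_on n \<and> (\<forall>m \<in> Poly_Mapping.keys p. total_degree m = d)"

definition const_mpoly :: "'k::zero \<Rightarrow> 'k mpoly" where
  "const_mpoly c = Poly_Mapping.single 0 c"

text \<open>
  Where \<open>x\<^sub>i\<close> does not occur in \<open>m\<close>, the truncated subtraction of exponents does no harm,
  because the new coefficient is \<open>0\<close>.
\<close>

definition partial_deriv :: "nat \<Rightarrow> 'k::comm_semiring_1 mpoly \<Rightarrow> 'k mpoly" where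
  "partial_deriv i p =
    (\<Sum>m \<in> Poly_Mapping.keys p.
      Poly_Mapping.single (m - Poly_Mapping.single i 1)
        (of_nat (Poly_Mapping.lookup m i) * Poly_Mapping.lookup p m))"


section \<open>Schmidt rank\<close>

definition schmidt_rank :: "nat \<Rightarrow> 'k::comm_ring_1 mpoly \<Rightarrow> enat" where
  "schmidt_rank n f =
    Inf {enat r | r. \<exists>g h :: nat \<Rightarrow> 'k mpoly.
      (\<forall>i<r. \<exists>a>0. is_form n a (g i)) \<and>
      (\<forall>i<r. \<exists>b>0. is_form n b (h i)) \<and>
      f = (\<Sum>i<r. g i * h i)}"

text \<open>A collection \<open>f\<^sub>1, \<dots>, f\<^sub>s\<close> is given by \<open>f 0, \<dots>, f (s - 1)\<close>.\<close>

definition schmidt_rank_coll :: "nat \<Rightarrow> nat \<Rightarrow> (nat \<Rightarrow> 'k::comm_ring_1 mpoly) \<Rightarrow> enat" where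
  "schmidt_rank_coll n s f =
    Inf {schmidt_rank n (\<Sum>i<s. const_mpoly (c $ i) * f i) | c.
      c \<in> carrier_vec s \<and> c \<noteq> 0\<^sub>v s}"


section \<open>Codimension in the Zariski topology\<close>

definition zero_locus :: "nat \<Rightarrow> 'k::comm_semiring_1 mpoly set \<Rightarrow> 'k vec set" where
  "zero_locus N S = {x \<in> carrier_vec N. \<forall>p\<in>S. mpoly_eval p x = 0}"

definition zariski_closed :: "nat \<Rightarrow> 'k::comm_semiring_1 vec set \<Rightarrow> bool" where
  "zariski_closed N Z \<longleftrightarrow> (\<exists>S \<subseteq> polys_on N. Z = zero_locus N S)"

definition irreducible_closed :: "nat \<Rightarrow> 'k::comm_semiring_1 vec set \<Rightarrow> bool" where
  "irreducible_closed N Y \<longleftrightarrow>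
    zariski_closed N Y \<and> Y \<noteq> {} \<and>
    (\<forall>A B. zariski_closed N A \<and> zariski_closed N B \<and> Y = A \<union> B \<longrightarrow> Y = A \<or> Y = B)"

text \<open>
  The codimension of an irreducible closed set is the supremum of the lengths of chains of
  irreducible closed sets ascending from it; the codimension of a closed set is the infimum over
  the irreducible closed sets contained in it (\<open>\<infinity>\<close> for the empty set).
\<close>

definition codim_irreducible :: "nat \<Rightarrow> 'k::comm_semiring_1 vec set \<Rightarrow> enat" where
  "codim_irreducible N Y =
    Sup {enat r | r. \<exists>C :: nat \<Rightarrow> 'k vec set.
      C 0 = Y \<and> (\<forall>i\<le>r. irreducible_closed N (C i)) \<and> (\<forall>i<r. C i \<subset> C (Suc i))}"

definition codim :: "nat \<Rightarrow> 'k::comm_semiring_1 vec set \<Rightarrow> enat" where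
  "codim N Z = Inf {codim_irreducible N Y | Y. irreducible_closed N Y \<and> Y \<subseteq> Z}"

text \<open>
  Over an algebraically closed field the closed subsets of the scheme \<open>V\<close> correspond to their
  sets of rational points, so the codimension of the subscheme \<open>V(f\<^sub>1, \<dots>, f\<^sub>s)\<close> is that of the
  common zero set.
\<close>

definition complete_intersection :: "nat \<Rightarrow> nat \<Rightarrow> (nat \<Rightarrow> 'k::comm_semiring_1 mpoly) \<Rightarrow> bool" where
  "complete_intersection n s f \<longleftrightarrow> codim n (zero_locus n (f ` {..<s})) = enat s"


section \<open>The Hessian form and the loci it defines\<close>

definition hessian :: "nat \<Rightarrow> 'k::comm_semiring_1 mpoly \<Rightarrow> 'k vec \<Rightarrow> 'k mat" where
  "hessian n f x = mat n n (\<lambda>(i, j). mpoly_eval (partial_deriv i (partial_deriv j f)) x)"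

definition hessian_form ::
    "nat \<Rightarrow> 'k::comm_semiring_1 mpoly \<Rightarrow> 'k vec \<Rightarrow> 'k vec \<Rightarrow> 'k vec \<Rightarrow> 'k" where
  "hessian_form n f x v w = v \<bullet> (hessian n f x *\<^sub>v w)"

text \<open>
  A point \<open>(v, x)\<close> of \<open>V \<times> V\<close> is encoded as the concatenation \<open>v @\<^sub>v x\<close> in
  \<open>carrier_vec (n + n)\<close>.
\<close>

definition Z_sym :: "nat \<Rightarrow> 'k::comm_semiring_1 mpoly \<Rightarrow> 'k vec set" where
  "Z_sym n f =
    {v @\<^sub>v x | v x. v \<in> carrier_vec n \<and> x \<in> carrier_vec n \<and>
      (\<forall>w \<in> carrier_vec n. hessian_form n f x v w = 0)}"

definition g_sym :: "nat \<Rightarrow> 'k::comm_semiring_1 mpoly \<Rightarrow> enat" where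
  "g_sym n f = codim (n + n) (Z_sym n f)"

text \<open>
  The matrix, in the standard bases, of the linear map sending \<open>v'\<close> to the family of values at
  \<open>(v', v)\<close> of the Hessian forms of \<open>f 0, \<dots>, f (s - 1)\<close> at \<open>x\<close>.
\<close>

definition hessian_map ::
    "nat \<Rightarrow> nat \<Rightarrow> (nat \<Rightarrow> 'k::comm_semiring_1 mpoly) \<Rightarrow> 'k vec \<Rightarrow> 'k vec \<Rightarrow> 'k mat" where
  "hessian_map n s f v x = mat s n (\<lambda>(i, j). hessian_form n (f i) x (unit_vec n j) v)"

lemma hessian_map_apply:
  assumes "v' \<in> carrier_vec n"
  shows "hessian_map n s f v x *\<^sub>v v' = vec s (\<lambda>i. hessian_form n (f i) x v' v)"
proof (rule eq_vecI)
  fix i assume "i < dim_vec (vec s (\<lambda>i. hessian_form n (f i) x v' v))"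
  then have i: "i < s" by simp
  define u where "u = hessian n (f i) x *\<^sub>v v"
  have u: "u \<in> carrier_vec n" unfolding u_def hessian_def by (rule carrier_vecI) (simp only: dim_mult_mat_vec dim_row_mat)
  have 1: "hessian_form n (f i) x (unit_vec n j) v = u $ j" if "j < n" for j
    unfolding hessian_form_def u_def[symmetric] using u that by (rule scalar_prod_left_unit)
  have row: "row (hessian_map n s f v x) i = u"
    by (rule eq_vecI) (use i u 1 in \<open>auto simp: hessian_map_def row_def\<close>)
  have "(hessian_map n s f v x *\<^sub>v v') $ i = u \<bullet> v'"
    using i row by (simp add: hessian_map_def)
  also have "\<dots> = v' \<bullet> u" using u assms by (rule comm_scalar_prod)
  finally show "(hessian_map n s f v x *\<^sub>v v') $ i
      = vec s (\<lambda>i. hessian_form n (f i) x v' v) $ i"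
    using i by (simp add: hessian_form_def u_def)
qed (simp add: hessian_map_def)

definition Z_sym_coll :: "nat \<Rightarrow> nat \<Rightarrow> (nat \<Rightarrow> 'k::field mpoly) \<Rightarrow> 'k vec set" where
  "Z_sym_coll n s f =
    {v @\<^sub>v x | v x. v \<in> carrier_vec n \<and> x \<in> carrier_vec n \<and>
      vec_space.rank s (hessian_map n s f v x) < s}"

definition g_sym_coll :: "nat \<Rightarrow> nat \<Rightarrow> (nat \<Rightarrow> 'k::field mpoly) \<Rightarrow> enat" where
  "g_sym_coll n s f = codim (n + n) (Z_sym_coll n s f)"

end

theory Submission
  imports Defs
begin

text \<open>
  Both bounds follow from one statement about a pencil of forms \<open>f\<^sub>c = \<Sum>\<^sub>i c\<^sub>i f\<^sub>i\<close>; the first is the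
  case of a single form. Let \<open>Y \<subseteq> V \<times> V\<close> be irreducible and closed of codimension \<open>g\<close>, and suppose
  that over each point \<open>(v, x)\<close> of \<open>Y\<close> some non-trivial combination \<open>c\<close> of the Hessians at \<open>x\<close> kills \<open>v\<close>.
  On a dense part of \<open>Y\<close> such a \<open>c\<close> can be chosen as a vector of rational functions with one entry
  equal to \<open>1\<close> (\<open>polynomial_dependence\<close>). Recording the other \<open>s - 1\<close> entries as additional
  coordinates gives an irreducible set \<open>E\<close> of points \<open>(v, x, c)\<close> on which \<open>F v = 0\<close>, where
  \<open>F = \<Sum>\<^sub>i c\<^sub>i H\<^sub>i(x)\<close> is a matrix of polynomials in \<open>x\<close> and \<open>c\<close> only (\<open>incidence_exists\<close>).

  Let \<open>r\<close> be the rank of \<open>F\<close> over the function field of \<open>E\<close>, so that \<open>F\<close> is generically a sum of \<open>r\<close>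
  products \<open>u\<^sub>t w\<^sub>t\<^sup>T\<close> (\<open>rank_factorization\<close>). As the ground field is perfect, all but some number \<open>q\<close> of
  the coordinates \<open>x, c\<close> form a separable transcendence basis of the field that they generate
  (\<open>elim_seq_exists\<close>), and near a general point \<open>(x\<^sub>0, c\<^sub>0)\<close> the remaining \<open>q\<close> coordinates are power
  series in these (\<open>hensel\<close>). This gives a truncated arc \<open>X(y)\<close> along which every equation of \<open>E\<close>
  holds to high order: it is \<open>(x\<^sub>0 + y, c\<^sub>0)\<close> except for corrections of positive order in the \<open>q\<close>
  eliminated coordinates. Now compare the parts of degree \<open>d - 2\<close> of the matrix \<open>F(X(y))\<close>. On the
  one hand it is the Hessian of \<open>f\<^sub>c\<close> at \<open>y\<close> for \<open>c = c\<^sub>0\<close>, plus \<open>d - 2\<close> products for each correction. On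
  the other hand it is a sum of \<open>r (d - 1)\<close> products, one for each way of splitting the degree
  between \<open>u\<^sub>t\<close> and \<open>w\<^sub>t\<close>. After contraction with \<open>y\<close> on both sides Euler's identity turns the Hessian
  into \<open>d (d - 1) f\<^sub>c\<close>, and all the factors have positive degree. So the Schmidt rank of \<open>f\<^sub>c\<close> is at
  most \<open>(d - 1) r + (d - 2) q \<le> (d - 1) (r + q)\<close> (\<open>schmidt_from_incidence\<close>).

  It remains to see that \<open>r + q \<le> g + s - 1\<close>. The \<open>r\<close> pivots of \<open>F\<close> express \<open>r\<close> of the coordinates of \<open>v\<close>
  through the others, so \<open>r + q\<close> coordinates of \<open>E\<close> are eliminated one after the other by equations
  with non-zero partial derivative. The differentials of these equations are linearly
  independent at a general point, hence there are at most as many of them as there are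
  generators of the ideal of \<open>E\<close> over the function field (\<open>elim_seq_length_le\<close>). Such generators are
  the \<open>s - 1\<close> equations that define the entries of \<open>c\<close> and the equations of a full elimination
  sequence for \<open>Y\<close>. The latter has length at most \<open>g\<close> because each of its steps produces a strictly
  larger irreducible closed set, the closure of the cylinder over a coordinate projection of \<open>Y\<close>
  (\<open>elim_seq_le_codim\<close>).
\<close>

section \<open>Substitution into polynomials\<close>

definition Var :: "nat \<Rightarrow> 'k::comm_ring_1 mpoly" where
  "Var i = Poly_Mapping.single (Poly_Mapping.single i 1) 1"

definition monom_val :: "(nat \<Rightarrow> 'r::comm_ring_1) \<Rightarrow> (nat \<Rightarrow>\<^sub>0 nat) \<Rightarrow> 'r" where
  "monom_val a m = (\<Prod>i \<in> Poly_Mapping.keys m. a i ^ Poly_Mapping.lookup m i)"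

text \<open>
  The coefficients pass through the ring homomorphism \<open>h\<close>, so that one operation covers evaluation
  at points, substitution of polynomials for the variables, and restriction to lines.
\<close>

definition msubst :: "('k::comm_ring_1 \<Rightarrow> 'r::comm_ring_1) \<Rightarrow> (nat \<Rightarrow> 'r) \<Rightarrow> 'k mpoly \<Rightarrow> 'r" where
  "msubst h a p = (\<Sum>m \<in> Poly_Mapping.keys p. h (Poly_Mapping.lookup p m) * monom_val a m)"

lemma monom_val_superset:
  assumes "finite A" "Poly_Mapping.keys m \<subseteq> A"
  shows "monom_val a m = (\<Prod>i\<in>A. a i ^ Poly_Mapping.lookup m i)"
  unfolding monom_val_def
  by (rule prod.mono_neutral_left) (use assms in \<open>auto simp: in_keys_iff\<close>)

lemma monom_val_add: "monom_val a (m + m') = monom_val a m * monom_val a m'"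
proof -
  let ?A = "Poly_Mapping.keys m \<union> Poly_Mapping.keys m'"
  have "monom_val a (m + m') = (\<Prod>i\<in>?A. a i ^ Poly_Mapping.lookup (m + m') i)"
    by (rule monom_val_superset) (auto dest: subsetD[OF Poly_Mapping.keys_add])
  also have "\<dots> = (\<Prod>i\<in>?A. a i ^ Poly_Mapping.lookup m i) * (\<Prod>i\<in>?A. a i ^ Poly_Mapping.lookup m' i)"
    by (simp add: lookup_add power_add prod.distrib)
  also have "\<dots> = monom_val a m * monom_val a m'"
    by (simp add: monom_val_superset[of ?A])
  finally show ?thesis .
qed

lemma monom_val_zero [simp]: "monom_val a 0 = 1"
  by (simp add: monom_val_def)

lemma monom_val_single [simp]: "monom_val a (Poly_Mapping.single i k) = a i ^ k"
  by (auto simp: monom_val_def)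

lemma mpoly_induct [case_names zero single add]:
  assumes "P 0" "\<And>m c. P (Poly_Mapping.single m c)" "\<And>p q. P p \<Longrightarrow> P q \<Longrightarrow> P (p + q)"
  shows "P (p :: 'a \<Rightarrow>\<^sub>0 'b::comm_monoid_add)"
proof -
  have "p = (\<Sum>m\<in>Poly_Mapping.keys p. Poly_Mapping.single m (Poly_Mapping.lookup p m))"
    by (rule poly_mapping_eqI) (auto simp: lookup_sum lookup_single in_keys_iff when_def)
  moreover have "P (\<Sum>m\<in>A. Poly_Mapping.single m (Poly_Mapping.lookup p m))" if "finite A" for A
    using that by (induction) (auto intro: assms)
  ultimately show ?thesis by (metis finite_keys)
qed

text \<open>
  Identities that are additive in two polynomials, such as multiplicativity of a substitution or
  the product rule, need only be checked on monomials.
\<close>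

lemma mpoly_bilinear_eq:
  fixes F G :: "('a \<Rightarrow>\<^sub>0 'b::comm_monoid_add) \<Rightarrow> ('a \<Rightarrow>\<^sub>0 'b) \<Rightarrow> 'c::ab_group_add"
  assumes "\<And>p p' q. F (p + p') q = F p q + F p' q" "\<And>p q q'. F p (q + q') = F p q + F p q'"
    and "\<And>p p' q. G (p + p') q = G p q + G p' q" "\<And>p q q'. G p (q + q') = G p q + G p q'"
    and single: "\<And>m c m' c'. F (Poly_Mapping.single m c) (Poly_Mapping.single m' c') =
      G (Poly_Mapping.single m c) (Poly_Mapping.single m' c')"
  shows "F p q = G p q"
proof -
  have 0: "F 0 q = 0" "F p 0 = 0" "G 0 q = 0" "G p 0 = 0" for p q
    using assms(1)[of 0 0 q] assms(2)[of p 0 0] assms(3)[of 0 0 q] assms(4)[of p 0 0] by simp_all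
  show ?thesis
  proof (induction p rule: mpoly_induct)
    case (single m c)
    show ?case
    proof (induction q rule: mpoly_induct)
      case (add p q)
      then show ?case by (simp only: assms(2,4))
    qed (simp_all only: 0 assms(5))
  next
    case (add p q)
    then show ?case by (simp only: assms(1,3))
  qed (simp only: 0)
qed

lemma const_mpoly_hom: "comm_ring_hom (const_mpoly :: 'k::comm_ring_1 \<Rightarrow> _)"
  by unfold_locales (auto simp: const_mpoly_def single_add mult_single)

interpretation const: comm_ring_hom "const_mpoly :: 'k::comm_ring_1 \<Rightarrow> _"
  by (rule const_mpoly_hom)

lemma id_ring_hom: "comm_ring_hom (\<lambda>c::'k::comm_ring_1. c)"
  by unfold_locales auto

context comm_ring_hom
begin

lemma msubst_superset:
  assumes "finite A" "Poly_Mapping.keys p \<subseteq> A"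
  shows "msubst hom a p = (\<Sum>m\<in>A. hom (Poly_Mapping.lookup p m) * monom_val a m)"
  unfolding msubst_def
  by (rule sum.mono_neutral_left) (use assms in \<open>auto simp: in_keys_iff\<close>)

lemma msubst_add: "msubst hom a (p + q) = msubst hom a p + msubst hom a q"
proof -
  let ?A = "Poly_Mapping.keys p \<union> Poly_Mapping.keys q"
  have "msubst hom a (p + q) = (\<Sum>m\<in>?A. hom (Poly_Mapping.lookup (p + q) m) * monom_val a m)"
    by (rule msubst_superset) (auto dest: subsetD[OF Poly_Mapping.keys_add])
  then show ?thesis
    by (simp add: msubst_superset[of ?A] lookup_add hom_distribs distrib_right sum.distrib)
qed

lemma msubst_zero: "msubst hom a 0 = 0"
  by (simp add: msubst_def)

lemma msubst_single: "msubst hom a (Poly_Mapping.single m c) = hom c * monom_val a m"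
  by (auto simp: msubst_def)

lemma msubst_mult: "msubst hom a (p * q) = msubst hom a p * msubst hom a q"
proof (rule mpoly_bilinear_eq[where F = "\<lambda>p q. msubst hom a (p * q)"
      and G = "\<lambda>p q. msubst hom a p * msubst hom a q"])
  show "msubst hom a (Poly_Mapping.single m c * Poly_Mapping.single m' c') =
      msubst hom a (Poly_Mapping.single m c) * msubst hom a (Poly_Mapping.single m' c')"
          for m c m' c'
    by (simp add: msubst_single mult_single hom_mult monom_val_add mult.assoc mult.left_commute)
qed (simp_all add: msubst_add distrib_left distrib_right)

lemma msubst_hom: "comm_ring_hom (msubst hom a)"
proof unfold_locales
  show "msubst hom a 1 = 1"
    using msubst_single[of a 0 1] by simp
qed (simp_all add: msubst_zero msubst_add msubst_mult)

lemma msubst_const: "msubst hom a (const_mpoly c) = hom c"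
  by (simp add: const_mpoly_def msubst_single)

lemma msubst_Var: "msubst hom a (Var i) = a i"
  by (simp add: Var_def msubst_single)

lemma hom_monom_val: "hom (monom_val a m) = monom_val (\<lambda>i. hom (a i)) m"
  by (simp add: monom_val_def hom_distribs)

lemma hom_msubst:
  assumes "comm_ring_hom g"
  shows "hom (msubst g a p) = msubst (\<lambda>c. hom (g c)) (\<lambda>i. hom (a i)) p"
  by (simp add: msubst_def hom_distribs hom_monom_val)

end

lemma msubst_id: "msubst const_mpoly Var p = (p :: 'k::comm_ring_1 mpoly)"
proof (induction p rule: mpoly_induct)
  case (single m c)
  have *: "monom_val Var m = (Poly_Mapping.single m 1 :: 'k mpoly)"
  proof (induction m rule: mpoly_induct)
    case (single i k)
    show ?case by (induction k) (simp_all add: Var_def mult_single flip: single_add)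
  qed (simp_all add: monom_val_add mult_single)
  show ?case unfolding const.msubst_single * by (simp add: const_mpoly_def mult_single)
qed (simp_all add: const.msubst_zero const.msubst_add)

abbreviation ev :: "(nat \<Rightarrow> 'k::comm_ring_1) \<Rightarrow> 'k mpoly \<Rightarrow> 'k" where
  "ev \<equiv> msubst (\<lambda>c. c)"

abbreviation subst :: "(nat \<Rightarrow> 'k mpoly) \<Rightarrow> 'k::comm_ring_1 mpoly \<Rightarrow> 'k mpoly" where
  "subst \<equiv> msubst const_mpoly"

interpretation ev: comm_ring_hom "ev a :: 'k::comm_ring_1 mpoly \<Rightarrow> 'k" for a
  by (rule comm_ring_hom.msubst_hom[OF id_ring_hom])
interpretation subst: comm_ring_hom "subst a :: 'k::comm_ring_1 mpoly \<Rightarrow> 'k mpoly" for a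
  by (rule const.msubst_hom)

lemmas ev_const [simp] = comm_ring_hom.msubst_const[OF id_ring_hom]
lemmas ev_Var [simp] = comm_ring_hom.msubst_Var[OF id_ring_hom]
lemmas subst_const [simp] = const.msubst_const
lemmas subst_Var [simp] = const.msubst_Var

lemma ev_subst: "ev a (subst X p) = ev (\<lambda>i. ev a (X i)) p"
  by (simp add: ev.hom_msubst[OF const_mpoly_hom])

lemma mpoly_eval_eq_ev: "mpoly_eval p x = ev (\<lambda>i. x $ i) p"
  by (simp add: mpoly_eval_def msubst_def monom_val_def)

lemma mpoly_ring_induct [case_names const Var add mult]:
  assumes "\<And>c. P (const_mpoly c)" "\<And>i. P (Var i)"
    and add: "\<And>p q. P p \<Longrightarrow> P q \<Longrightarrow> P (p + q)" and mult: "\<And>p q. P p \<Longrightarrow> P q \<Longrightarrow> P (p * q)"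
  shows "P (p :: 'k::comm_ring_1 mpoly)"
proof -
  have 0: "P 0" using assms(1)[of 0] by simp
  have 1: "P 1" using assms(1)[of 1] by simp
  have pow: "P (q ^ k)" if "P q" for q k
    by (induction k) (auto intro: 1 that mult)
  have prd: "P (\<Prod>i\<in>A. f i)" if "\<And>i. P (f i)" for A :: "nat set" and f
    by (induction A rule: infinite_finite_induct) (auto intro: 1 that mult)
  have sm: "P (\<Sum>i\<in>A. f i)" if "\<And>i. P (f i)" for A :: "(nat \<Rightarrow>\<^sub>0 nat) set" and f
    by (induction A rule: infinite_finite_induct) (auto intro: 0 that add)
  have "P (msubst const_mpoly Var p)"
    unfolding msubst_def monom_val_def by (intro sm mult prd pow assms)
  then show ?thesis by (simp add: msubst_id)
qed

section \<open>Polynomials in a given set of variables\<close>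

definition polys_in :: "nat set \<Rightarrow> 'k::zero mpoly set" where
  "polys_in S = {p. \<forall>m \<in> Poly_Mapping.keys p. Poly_Mapping.keys m \<subseteq> S}"

lemma polys_on_eq: "polys_on n = polys_in {..<n}"
  by (simp add: polys_on_def polys_in_def)

lemma polys_in_mono: "S \<subseteq> T \<Longrightarrow> polys_in S \<subseteq> polys_in T"
  by (auto simp: polys_in_def)

lemma polys_in_UNIV: "p \<in> polys_in UNIV" by (simp add: polys_in_def)

lemma polys_in_0 [simp]: "0 \<in> polys_in S" by (simp add: polys_in_def)

lemma polys_in_const [simp]: "const_mpoly c \<in> polys_in S"
  by (simp add: polys_in_def const_mpoly_def)

lemma polys_in_1 [simp]: "(1 :: 'k::comm_ring_1 mpoly) \<in> polys_in S"
  using polys_in_const[of "1::'k" S] unfolding const.hom_one .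

lemma polys_in_Var [simp]: "i \<in> S \<Longrightarrow> Var i \<in> polys_in S"
  by (simp add: polys_in_def Var_def)

lemma polys_in_add: "p \<in> polys_in S \<Longrightarrow> q \<in> polys_in S \<Longrightarrow> p + q \<in> polys_in S"
  using Poly_Mapping.keys_add[of p q] unfolding polys_in_def by blast

lemma polys_in_mult:
  assumes "p \<in> polys_in S" "q \<in> polys_in S" shows "p * q \<in> polys_in S"
  unfolding polys_in_def
proof (intro CollectI ballI)
  fix m assume "m \<in> Poly_Mapping.keys (p * q)"
  then obtain a b where "m = a + b" "a \<in> Poly_Mapping.keys p" "b \<in> Poly_Mapping.keys q"
    using keys_mult[of p q] by auto
  then show "Poly_Mapping.keys m \<subseteq> S"
    using assms Poly_Mapping.keys_add[of a b] unfolding polys_in_def by blast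
qed

lemma polys_in_uminus: "p \<in> polys_in S \<Longrightarrow> - (p :: 'k::comm_ring_1 mpoly) \<in> polys_in S"
  by (simp add: polys_in_def)

lemma polys_in_diff:
  "p \<in> polys_in S \<Longrightarrow> q \<in> polys_in S \<Longrightarrow> (p :: 'k::comm_ring_1 mpoly) - q \<in> polys_in S"
  using polys_in_add[of p S "- q"] polys_in_uminus[of q S] by simp

lemma polys_in_sum: "(\<And>i. i \<in> A \<Longrightarrow> f i \<in> polys_in S)
    \<Longrightarrow> (sum f A :: 'k::comm_ring_1 mpoly) \<in> polys_in S"
  by (induction A rule: infinite_finite_induct) (auto intro: polys_in_add)

lemma polys_in_prod: "(\<And>i. i \<in> A \<Longrightarrow> f i \<in> polys_in S)
    \<Longrightarrow> (prod f A :: 'k::comm_ring_1 mpoly) \<in> polys_in S"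
  by (induction A rule: infinite_finite_induct) (auto intro: polys_in_mult)

lemma polys_in_power: "p \<in> polys_in S \<Longrightarrow> (p ^ k :: 'k::comm_ring_1 mpoly) \<in> polys_in S"
  by (induction k) (auto intro: polys_in_mult)

lemmas polys_in_intros = polys_in_add polys_in_mult polys_in_diff polys_in_uminus
  polys_in_sum polys_in_prod polys_in_power

lemma msubst_cong:
  assumes "p \<in> polys_in S" "\<And>i. i \<in> S \<Longrightarrow> a i = b i"
  shows "msubst h a p = msubst h b p"
  unfolding msubst_def monom_val_def
proof (intro sum.cong prod.cong arg_cong2[where f="(*)"] refl)
  fix m i assume "m \<in> Poly_Mapping.keys p" "i \<in> Poly_Mapping.keys m"
  then have "i \<in> S" using assms(1) unfolding polys_in_def by blast
  then show "a i ^ Poly_Mapping.lookup m i = b i ^ Poly_Mapping.lookup m i" by (simp add: assms(2))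
qed

lemma subst_in:
  assumes "p \<in> polys_in S" "\<And>i. i \<in> S \<Longrightarrow> X i \<in> polys_in T"
  shows "subst X p \<in> polys_in T"
  unfolding msubst_def monom_val_def
  by (intro polys_in_intros polys_in_const) (use assms in \<open>auto simp: polys_in_def[of S]\<close>)

section \<open>Partial derivatives\<close>

lemma partial_deriv_superset:
  assumes "finite A" "Poly_Mapping.keys p \<subseteq> A"
  shows "partial_deriv i p = (\<Sum>m\<in>A. Poly_Mapping.single (m - Poly_Mapping.single i 1)
        (of_nat (Poly_Mapping.lookup m i) * Poly_Mapping.lookup p m))"
  unfolding partial_deriv_def
  by (rule sum.mono_neutral_left) (use assms in \<open>auto simp: in_keys_iff\<close>)

lemma partial_deriv_add: "partial_deriv i (p + q) = partial_deriv i p + partial_deriv i q"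
proof -
  let ?A = "Poly_Mapping.keys p \<union> Poly_Mapping.keys q"
  have "partial_deriv i (p + q) = (\<Sum>m\<in>?A. Poly_Mapping.single (m - Poly_Mapping.single i 1)
        (of_nat (Poly_Mapping.lookup m i) * Poly_Mapping.lookup (p + q) m))"
    by (rule partial_deriv_superset) (auto dest: subsetD[OF Poly_Mapping.keys_add])
  then show ?thesis
    by (simp add: partial_deriv_superset[of ?A] lookup_add distrib_left single_add sum.distrib)
qed

lemma partial_deriv_single:
  "partial_deriv i (Poly_Mapping.single m c) =
    Poly_Mapping.single (m - Poly_Mapping.single i 1) (of_nat (Poly_Mapping.lookup m i) * c)"
  by (auto simp: partial_deriv_def)

lemma partial_deriv_0 [simp]: "partial_deriv i 0 = 0" by (simp add: partial_deriv_def)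

lemma partial_deriv_const [simp]: "partial_deriv i (const_mpoly c) = 0"
  by (simp add: const_mpoly_def partial_deriv_single)

lemma single_minus_one_add:
  assumes "Poly_Mapping.lookup m i \<noteq> 0"
  shows "m - Poly_Mapping.single i 1 + m' = m + m' - Poly_Mapping.single i (1::nat)"
  by (rule poly_mapping_eqI) (use assms in \<open>auto simp: lookup_add lookup_minus lookup_single
      when_def\<close>)

lemma partial_deriv_mult:
  "partial_deriv i (p * q) = partial_deriv i p * q
      + p * partial_deriv i (q :: 'k::comm_ring_1 mpoly)"
proof (rule mpoly_bilinear_eq[where F = "\<lambda>p q. partial_deriv i (p * q)"
      and G = "\<lambda>p q. partial_deriv i p * q + p * partial_deriv i q"])
  fix m m' and c c' :: 'k
  define u where "u = Poly_Mapping.single i (1::nat)"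
  have 1: "Poly_Mapping.single (m - u + m') (of_nat (Poly_Mapping.lookup m i) * c * c') =
      Poly_Mapping.single (m + m' - u) (of_nat (Poly_Mapping.lookup m i) * c * c')"
    by (cases "Poly_Mapping.lookup m i = 0") (use single_minus_one_add[of m i m'] in \<open>auto simp:
        u_def\<close>)
  have 2: "Poly_Mapping.single (m + (m' - u)) (c * (of_nat (Poly_Mapping.lookup m' i) * c')) =
      Poly_Mapping.single (m + m' - u) (c * (of_nat (Poly_Mapping.lookup m' i) * c'))"
    using single_minus_one_add[of m' i m]
    by (cases "Poly_Mapping.lookup m' i = 0") (auto simp: u_def add.commute)
  have "of_nat (Poly_Mapping.lookup (m + m') i) * (c * c') =
      of_nat (Poly_Mapping.lookup m i) * c * c' + c * (of_nat (Poly_Mapping.lookup m' i) * c')"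
    by (simp add: lookup_add distrib_right distrib_left mult.left_commute mult.assoc)
  then show "partial_deriv i (Poly_Mapping.single m c * Poly_Mapping.single m' c') =
      partial_deriv i (Poly_Mapping.single m c) * Poly_Mapping.single m' c' +
      Poly_Mapping.single m c * partial_deriv i (Poly_Mapping.single m' c')"
    unfolding mult_single partial_deriv_single u_def[symmetric] 1 2 by (simp only: single_add)
qed (simp_all add: partial_deriv_add distrib_left distrib_right add_ac)

lemma partial_deriv_Var: "partial_deriv i (Var j) = (if i = j then 1 else 0)"
  by (simp add: Var_def partial_deriv_single lookup_single)

lemma partial_deriv_sum: "partial_deriv i (sum f A) = (\<Sum>j\<in>A. partial_deriv i (f j))"
  by (induction A rule: infinite_finite_induct) (auto simp: partial_deriv_add)

lemma partial_deriv_uminus: "partial_deriv i (- p) = - partial_deriv i (p :: 'k::comm_ring_1 mpoly)"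
  using partial_deriv_add[of i p "- p"] by (simp add: eq_neg_iff_add_eq_0 add.commute)

lemma partial_deriv_diff:
  "partial_deriv i (p - q) = partial_deriv i p - partial_deriv i (q :: 'k::comm_ring_1 mpoly)"
  using partial_deriv_add[of i p "- q"] by (simp add: partial_deriv_uminus)

lemma partial_deriv_in:
  assumes "(p :: 'k::comm_ring_1 mpoly) \<in> polys_in S" shows "partial_deriv i p \<in> polys_in S"
  unfolding partial_deriv_def
proof (rule polys_in_sum)
  fix m assume m: "m \<in> Poly_Mapping.keys p"
  have "Poly_Mapping.keys (m - Poly_Mapping.single i 1) \<subseteq> Poly_Mapping.keys m"
    by (auto simp: in_keys_iff lookup_minus)
  then show "Poly_Mapping.single (m - Poly_Mapping.single i 1)
      (of_nat (Poly_Mapping.lookup m i) * Poly_Mapping.lookup p m) \<in> polys_in S"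
    using m assms by (auto simp: polys_in_def)
qed

lemma partial_deriv_indep:
  assumes "p \<in> polys_in S" "i \<notin> S" shows "partial_deriv i p = 0"
  unfolding partial_deriv_def
proof (rule sum.neutral, rule ballI)
  fix m assume "m \<in> Poly_Mapping.keys p"
  then have "Poly_Mapping.lookup m i = 0" using assms unfolding polys_in_def
      using in_keys_iff[of i m] by blast
  then show "Poly_Mapping.single (m - Poly_Mapping.single i 1)
      (of_nat (Poly_Mapping.lookup m i) * Poly_Mapping.lookup p m) = 0" by simp
qed

lemma partial_deriv_commute:
  "partial_deriv i (partial_deriv j p) = partial_deriv j
      (partial_deriv i (p::'k::comm_ring_1 mpoly))"
proof (induction p rule: mpoly_induct)
  case (single m c)
  show ?case
    by (cases "i = j") (simp_all add: partial_deriv_single lookup_minus lookup_single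
      diff_diff_eq ac_simps)
qed (simp_all add: partial_deriv_add)

section \<open>Taylor expansion to first order\<close>

context comm_ring_hom
begin

text \<open>
  The remainder \<open>R\<close> stays anonymous: below, \<open>\<delta>\<^sup>2\<close> is negligible either for its order of vanishing or
  because only the coefficient of a first power is read off.
\<close>

lemma msubst_taylor:
  "\<exists>R. msubst hom (X(l := X l + \<delta>)) P =
    msubst hom X P + \<delta> * msubst hom X (partial_deriv l P) + \<delta>\<^sup>2 * R"
proof (induction P rule: mpoly_ring_induct)
  case (const c)
  then show ?case by (intro exI[of _ 0]) (simp add: msubst_const msubst_zero)
next
  case (Var i)
  have 1: "msubst hom X 1 = 1" using msubst_const[of X 1] by simp
  show ?case
    by (intro exI[of _ 0]) (simp add: msubst_Var msubst_zero partial_deriv_Var 1)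
next
  case (add p q)
  then obtain R R' where E:
    "msubst hom (X(l := X l + \<delta>)) p = msubst hom X p + \<delta> * msubst hom X (partial_deriv l p)
        + \<delta>\<^sup>2 * R"
    "msubst hom (X(l := X l + \<delta>)) q = msubst hom X q + \<delta> * msubst hom X (partial_deriv l q)
        + \<delta>\<^sup>2 * R'"
    by blast
  show ?case
    unfolding msubst_add partial_deriv_add E
    by (intro exI[of _ "R + R'"]) (simp only: distrib_left distrib_right ac_simps)
next
  case (mult p q)
  define a a' b b' where "a = msubst hom X p" and "a' = msubst hom X (partial_deriv l p)"
    and "b = msubst hom X q" and "b' = msubst hom X (partial_deriv l q)"
  from mult obtain R R' where E:
    "msubst hom (X(l := X l + \<delta>)) p = a + \<delta> * a' + \<delta>\<^sup>2 * R"
    "msubst hom (X(l := X l + \<delta>)) q = b + \<delta> * b' + \<delta>\<^sup>2 * R'"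
    unfolding a_def a'_def b_def b'_def by blast
  show ?case
    unfolding partial_deriv_mult msubst_add msubst_mult E
      a_def[symmetric] a'_def[symmetric] b_def[symmetric] b'_def[symmetric]
    by (intro exI[of _ "a * R' + a' * b' + \<delta> * a' * R' + R * b + \<delta> * R * b' + \<delta>\<^sup>2 * R * R'"])
      (simp add: algebra_simps power2_eq_square)
qed

text \<open>
  Moving one coordinate at a time, each move contributes a multiple of its increment. This
  isolates the effect of each eliminated coordinate of an arc.
\<close>

lemma msubst_change:
  assumes "finite A" "\<And>j. j \<notin> A \<Longrightarrow> z j = 0"
  shows "\<exists>Q. msubst hom (\<lambda>j. X j + z j) P = msubst hom X P + (\<Sum>l\<in>A. z l * Q l)"
  using assms
proof (induction A arbitrary: z rule: finite_induct)
  case empty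
  then show ?case by simp
next
  case (insert l A)
  define z' where "z' = z(l := 0)"
  obtain Q where Q: "msubst hom (\<lambda>j. X j + z' j) P = msubst hom X P + (\<Sum>l\<in>A. z' l * Q l)"
  proof -
    have "z' j = 0" if "j \<notin> A" for j
      using insert.prems[of j] that by (auto simp: z'_def)
    then show ?thesis using insert.IH[of z'] that by blast
  qed
  define X' where "X' = (\<lambda>j. X j + z' j)"
  obtain R where R: "msubst hom (X'(l := X' l + z l)) P =
      msubst hom X' P + z l * msubst hom X' (partial_deriv l P) + (z l)\<^sup>2 * R"
    using msubst_taylor by blast
  have X': "X'(l := X' l + z l) = (\<lambda>j. X j + z j)" by (auto simp: X'_def z'_def)
  let ?Q = "Q(l := msubst hom X' (partial_deriv l P) + z l * R)"
  have "(\<Sum>l\<in>A. z' l * Q l) = (\<Sum>j\<in>A. z j * ?Q j)"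
    by (rule sum.cong) (use insert.hyps in \<open>auto simp: z'_def\<close>)
  then have "msubst hom (\<lambda>j. X j + z j) P = msubst hom X P + (\<Sum>j\<in>insert l A. z j * ?Q j)"
    using R Q insert.hyps unfolding X' X'_def[symmetric]
    by (simp add: algebra_simps power2_eq_square)
  then show ?case by blast
qed

end

section \<open>Homogeneous components and order of vanishing\<close>

definition homog :: "nat \<Rightarrow> 'k::zero mpoly \<Rightarrow> bool" where
  "homog d p \<longleftrightarrow> (\<forall>m \<in> Poly_Mapping.keys p. total_degree m = d)"

lemma homog_0 [simp]: "homog d 0" by (simp add: homog_def)

lemma homog_add: "homog d p \<Longrightarrow> homog d q \<Longrightarrow> homog d (p + q)"
  using Poly_Mapping.keys_add[of p q] unfolding homog_def by blast

lemma homog_sum: "(\<And>i. i \<in> A \<Longrightarrow> homog d (f i)) \<Longrightarrow> homog d (sum f A :: 'k::comm_monoid_add mpoly)"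
  by (induction A rule: infinite_finite_induct) (auto intro: homog_add)

lemma homog_single: "total_degree m = d \<Longrightarrow> homog d (Poly_Mapping.single m c)"
  by (simp add: homog_def)

lemma total_degree_superset:
  "finite A \<Longrightarrow> Poly_Mapping.keys m \<subseteq> A \<Longrightarrow> total_degree m = (\<Sum>i\<in>A. Poly_Mapping.lookup m i)"
  unfolding total_degree_def by (rule sum.mono_neutral_left) (auto simp: in_keys_iff)

lemma total_degree_add: "total_degree (m + m') = total_degree m + total_degree m'"
proof -
  let ?A = "Poly_Mapping.keys m \<union> Poly_Mapping.keys m'"
  have "total_degree (m + m') = (\<Sum>i\<in>?A. Poly_Mapping.lookup (m + m') i)"
    by (rule total_degree_superset) (auto dest: subsetD[OF Poly_Mapping.keys_add])
  then show ?thesis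
    by (simp add: total_degree_superset[of ?A] lookup_add sum.distrib)
qed

lemma total_degree_0 [simp]: "total_degree 0 = 0" by (simp add: total_degree_def)

lemma total_degree_single [simp]: "total_degree (Poly_Mapping.single i k) = k"
  by (simp add: total_degree_def)

lemma homog_mult: "homog a p \<Longrightarrow> homog b q \<Longrightarrow> homog (a + b) (p * q)"
  unfolding homog_def using keys_mult[of p q] by (fastforce simp: total_degree_add)

lemma homog_Var: "homog 1 (Var i)"
  by (simp add: Var_def homog_single)

lemma homog_const: "homog 0 (const_mpoly c)"
  by (simp add: const_mpoly_def homog_single)

lemma homog_partial_deriv:
  assumes "homog d (p :: 'k::comm_ring_1 mpoly)"
  shows "homog (d - 1) (partial_deriv i p)"
  unfolding partial_deriv_def
proof (rule homog_sum)
  fix m assume m: "m \<in> Poly_Mapping.keys p"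
  show "homog (d - 1) (Poly_Mapping.single (m - Poly_Mapping.single i 1)
      (of_nat (Poly_Mapping.lookup m i) * Poly_Mapping.lookup p m))"
  proof (cases "Poly_Mapping.lookup m i = 0")
    case False
    then have "m - Poly_Mapping.single i 1 + Poly_Mapping.single i 1 = m"
      using single_minus_one_add[OF False, of "Poly_Mapping.single i 1"] by simp
    then have "total_degree (m - Poly_Mapping.single i 1) + 1 = total_degree m"
      by (metis total_degree_add total_degree_single)
    then show ?thesis using m assms by (intro homog_single) (auto simp: homog_def)
  qed simp
qed

lemma euler_identity:
  fixes p :: "'k::comm_ring_1 mpoly"
  assumes "p \<in> polys_in {..<n}" "homog d p"
  shows "(\<Sum>i<n. Var i * partial_deriv i p) = of_nat d * p"
proof -
  have "(\<Sum>i<n. Var i * partial_deriv i p) =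
      (\<Sum>m\<in>Poly_Mapping.keys p. \<Sum>i<n. Var i * Poly_Mapping.single (m - Poly_Mapping.single i 1)
        (of_nat (Poly_Mapping.lookup m i) * Poly_Mapping.lookup p m))"
    unfolding partial_deriv_def sum_distrib_left by (rule sum.swap)
  also have "\<dots> = (\<Sum>m\<in>Poly_Mapping.keys p. Poly_Mapping.single m
      (of_nat d * Poly_Mapping.lookup p m))"
  proof (rule sum.cong[OF refl])
    fix m assume m: "m \<in> Poly_Mapping.keys p"
    have "Var i * Poly_Mapping.single (m - Poly_Mapping.single i 1)
        (of_nat (Poly_Mapping.lookup m i) * Poly_Mapping.lookup p m) =
        Poly_Mapping.single m (of_nat (Poly_Mapping.lookup m i) * Poly_Mapping.lookup p m)" for i
      using single_minus_one_add[of m i "Poly_Mapping.single i 1"]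
      by (cases "Poly_Mapping.lookup m i = 0") (simp_all add: Var_def mult_single add.commute)
    then have "(\<Sum>i<n. Var i * Poly_Mapping.single (m - Poly_Mapping.single i 1)
        (of_nat (Poly_Mapping.lookup m i) * Poly_Mapping.lookup p m)) =
      (\<Sum>i<n. Poly_Mapping.single m (of_nat (Poly_Mapping.lookup m i) * Poly_Mapping.lookup p m))"
      by simp
    also have "\<dots> = Poly_Mapping.single m (\<Sum>i<n. of_nat (Poly_Mapping.lookup m i)
        * Poly_Mapping.lookup p m)"
      by (induction n) (simp_all add: single_add)
    also have "(\<Sum>i<n. of_nat (Poly_Mapping.lookup m i) * Poly_Mapping.lookup p m) =
        of_nat d * Poly_Mapping.lookup p m"
    proof -
      have "d = (\<Sum>i<n. Poly_Mapping.lookup m i)"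
        using total_degree_superset[of "{..<n}" m] m assms by (auto simp: homog_def polys_in_def)
      then show ?thesis by (simp add: sum_distrib_right)
    qed
    finally show "(\<Sum>i<n. Var i * Poly_Mapping.single (m - Poly_Mapping.single i 1)
        (of_nat (Poly_Mapping.lookup m i) * Poly_Mapping.lookup p m)) =
        Poly_Mapping.single m (of_nat d * Poly_Mapping.lookup p m)" .
  qed
  also have "\<dots> = const_mpoly (of_nat d) * (\<Sum>m\<in>Poly_Mapping.keys p. Poly_Mapping.single m
      (Poly_Mapping.lookup p m))"
    unfolding sum_distrib_left const_mpoly_def mult_single by simp
  also have "(\<Sum>m\<in>Poly_Mapping.keys p. Poly_Mapping.single m (Poly_Mapping.lookup p m)) = p"
    by (rule poly_mapping_eqI) (auto simp: lookup_sum lookup_single in_keys_iff when_def)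
  finally show ?thesis by (simp add: const.hom_of_nat)
qed

lemma poly_const_hom: "comm_ring_hom (\<lambda>c::'k::comm_ring_1. [:const_mpoly c:])"
  by unfold_locales (simp_all add: const.hom_add const.hom_mult flip: one_pCons)

text \<open>
  Replacing every variable \<open>x\<^sub>i\<close> by \<open>t x\<^sub>i\<close> makes the homogeneous components the coefficients of a
  polynomial in \<open>t\<close>, so the components of a product come from multiplication of univariate
  polynomials.
\<close>

definition grade :: "'k::comm_ring_1 mpoly \<Rightarrow> 'k mpoly poly" where
  "grade p = msubst (\<lambda>c. [:const_mpoly c:]) (\<lambda>i. monom (Var i) 1) p"

lemma grade_hom: "comm_ring_hom (grade :: 'k::comm_ring_1 mpoly \<Rightarrow> _)"
  unfolding grade_def by (rule comm_ring_hom.msubst_hom[OF poly_const_hom])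

interpretation grade: comm_ring_hom grade by (rule grade_hom)

definition homog_comp :: "nat \<Rightarrow> 'k::comm_ring_1 mpoly \<Rightarrow> 'k mpoly" where
  "homog_comp k p = coeff (grade p) k"

lemma homog_comp_add: "homog_comp k (p + q) = homog_comp k p + homog_comp k q"
  by (simp add: homog_comp_def grade.hom_add)
lemma homog_comp_diff: "homog_comp k (p - q) = homog_comp k p - homog_comp k q"
  by (simp add: homog_comp_def grade.hom_minus)
lemma homog_comp_0 [simp]: "homog_comp k 0 = 0"
  by (simp add: homog_comp_def)
lemma homog_comp_sum: "homog_comp k (sum f A) = (\<Sum>i\<in>A. homog_comp k (f i))"
  by (induction A rule: infinite_finite_induct) (simp_all add: homog_comp_add)
lemma homog_comp_mult: "homog_comp k (p * q) = (\<Sum>i\<le>k. homog_comp i p * homog_comp (k - i) q)"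
  by (simp add: homog_comp_def grade.hom_mult coeff_mult)

lemma grade_const: "grade (const_mpoly c) = [:const_mpoly c:]"
  by (simp add: grade_def comm_ring_hom.msubst_const[OF poly_const_hom])
lemma grade_Var: "grade (Var i) = monom (Var i) 1"
  by (simp add: grade_def comm_ring_hom.msubst_Var[OF poly_const_hom])

lemma homog_comp_const: "homog_comp k (const_mpoly c) = (if k = 0 then const_mpoly c else 0)"
  by (simp add: homog_comp_def grade_const coeff_pCons split: nat.split)

lemma homog_homog_comp: "homog k (homog_comp k p)"
proof (induction p arbitrary: k rule: mpoly_ring_induct)
  case (const c)
  then show ?case by (auto simp: homog_comp_const homog_const)
next
  case (Var i)
  then show ?case using homog_Var[of i] by (auto simp: homog_comp_def grade_Var)
next
  case (add p q)
  then show ?case by (simp add: homog_comp_add homog_add)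
next
  case (mult p q)
  show ?case unfolding homog_comp_mult
  proof (rule homog_sum)
    fix i assume "i \<in> {..k}"
    then show "homog k (homog_comp i p * homog_comp (k - i) q)"
      using homog_mult[OF mult(1)[of i] mult(2)[of "k - i"]] by simp
  qed
qed

lemma homog_comp_zero_eq: "homog_comp 0 p = const_mpoly (ev (\<lambda>_. 0) p)"
proof (induction p rule: mpoly_ring_induct)
  case (mult p q)
  then show ?case by (simp add: homog_comp_mult ev.hom_mult const.hom_mult)
qed (simp_all add: homog_comp_const homog_comp_def grade_const grade_Var
    homog_comp_add[unfolded homog_comp_def] ev.hom_add const.hom_add)

text \<open>
  Truncated power series are represented by polynomials modulo those of order at least \<open>D\<close> at the
  origin.
\<close>

definition order_ge :: "nat \<Rightarrow> 'k::comm_ring_1 mpoly \<Rightarrow> bool" where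
  "order_ge D p \<longleftrightarrow> (\<forall>k<D. homog_comp k p = 0)"

lemma order_ge_add: "order_ge D p \<Longrightarrow> order_ge D q \<Longrightarrow> order_ge D (p + q)"
  by (simp add: order_ge_def homog_comp_add)
lemma order_ge_0 [simp]: "order_ge D 0" by (simp add: order_ge_def)
lemma order_ge_sum: "(\<And>i. i \<in> A \<Longrightarrow> order_ge D (f i)) \<Longrightarrow> order_ge D (sum f A)"
  by (simp add: order_ge_def homog_comp_sum)
lemma order_ge_mult: assumes "order_ge a p" "order_ge b q" shows "order_ge (a + b) (p * q)"
  unfolding order_ge_def
proof (intro allI impI)
  fix k assume k: "k < a + b"
  have "homog_comp i p * homog_comp (k - i) q = 0" if "i \<le> k" for i
    using assms k that unfolding order_ge_def by (cases "i < a") auto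
  then show "homog_comp k (p * q) = 0" unfolding homog_comp_mult by simp
qed
lemma order_ge_zero [simp]: "order_ge 0 p" by (simp add: order_ge_def)
lemma order_ge_mult_left: "order_ge D q \<Longrightarrow> order_ge D (p * q)"
  using order_ge_mult[of 0 p D q] by simp
lemma order_ge_mult_right: "order_ge D p \<Longrightarrow> order_ge D (p * q)"
  using order_ge_mult[of D p 0 q] by simp
lemma order_ge_mono: "order_ge D p \<Longrightarrow> D' \<le> D \<Longrightarrow> order_ge D' p"
  by (auto simp: order_ge_def)
lemma order_ge_power: "order_ge 1 p \<Longrightarrow> order_ge k (p ^ k)"
  by (induction k) (use order_ge_mult[of 1 p] in auto)
lemma order_ge_1_iff: "order_ge 1 p \<longleftrightarrow> ev (\<lambda>_. 0) p = 0"
proof -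
  have "const_mpoly c = 0 \<longleftrightarrow> c = 0" for c :: 'a
    unfolding const_mpoly_def by (metis lookup_single_eq lookup_zero single_zero)
  then show ?thesis by (simp add: order_ge_def homog_comp_zero_eq)
qed

text \<open>
  The inverse is a truncated geometric series.
\<close>

lemma order_ge_unit:
  fixes h :: "'k::field mpoly"
  assumes "ev (\<lambda>_. 0) h \<noteq> 0"
  shows "\<exists>u. order_ge D (1 - u * h)"
proof -
  define c where "c = ev (\<lambda>_. 0) h"
  define w where "w = 1 - const_mpoly (1 / c) * h"
  have "ev (\<lambda>_. 0) w = 0"
    using assms by (simp add: w_def ev.hom_minus ev.hom_mult c_def)
  then have "order_ge D (w ^ D)" by (intro order_ge_power)
      (simp add: order_ge_1_iff[unfolded One_nat_def])
  moreover have "1 - w ^ D = (\<Sum>i<D. w ^ i) * const_mpoly (1 / c) * h"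
    using one_diff_power_eq[of w D] by (simp add: w_def mult_ac)
  ultimately show ?thesis
    by (intro exI[of _ "(\<Sum>i<D. w ^ i) * const_mpoly (1 / c)"])
        (metis diff_diff_eq2 add_diff_cancel_left' diff_add_cancel)
qed

lemma order_ge_cancel:
  fixes h :: "'k::field mpoly"
  assumes "ev (\<lambda>_. 0) h \<noteq> 0" "order_ge D (h * p)"
  shows "order_ge D p"
proof -
  obtain u where u: "order_ge D (1 - u * h)" using order_ge_unit[OF assms(1)] by blast
  have "p = p * (1 - u * h) + u * (h * p)" by (simp add: algebra_simps)
  then show ?thesis
    using order_ge_add[OF order_ge_mult_left[OF u, of p] order_ge_mult_left[OF assms(2), of u]]
        by simp
qed

text \<open>
  A translation changes a form only in lower degrees.
\<close>

lemma homog_comp_translate: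
  fixes p :: "'k::comm_ring_1 mpoly"
  assumes "homog d p"
  shows "homog_comp d (subst (\<lambda>i. const_mpoly (a i) + Var i) p) = p"
proof -
  let ?X = "\<lambda>i. const_mpoly (a i) + Var i"
  have top: "homog_comp (j + k) (p * q) = homog_comp j p * homog_comp k q"
    if "\<And>i. i > j \<Longrightarrow> homog_comp i p = 0" "\<And>i. i > k \<Longrightarrow> homog_comp i q = 0"
        for j k and p q :: "'k mpoly"
  proof -
    have "homog_comp i p * homog_comp (j + k - i) q = 0" if "i \<in> {..j + k} - {j}" for i
      using \<open>\<And>i. i > j \<Longrightarrow> _\<close>[of i] \<open>\<And>i. i > k \<Longrightarrow> _\<close>[of "j + k - i"] that by (cases "i > j") auto
    then have "(\<Sum>i\<le>j + k. homog_comp i p * homog_comp (j + k - i) q)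
        = (\<Sum>i\<in>{j}. homog_comp i p * homog_comp (j + k - i) q)"
      by (intro sum.mono_neutral_right) auto
    then show ?thesis by (simp add: homog_comp_mult)
  qed
  have bound: "homog_comp i (p * q) = 0"
    if "\<And>i. i > j \<Longrightarrow> homog_comp i p = 0" "\<And>i. i > k \<Longrightarrow> homog_comp i q = 0" "i > j + k"
        for i j k and p q :: "'k mpoly"
  proof -
    have "homog_comp i' p * homog_comp (i - i') q = 0" if "i' \<le> i" for i'
      using \<open>\<And>i. i > j \<Longrightarrow> _\<close>[of i'] \<open>\<And>i. i > k \<Longrightarrow> _\<close>[of "i - i'"] \<open>i > j + k\<close> that by (cases "i' > j") auto
    then show ?thesis by (simp add: homog_comp_mult)
  qed
  have 1: "homog_comp k 1 = (if k = 0 then 1 else 0 :: 'k mpoly)" for k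
    using homog_comp_const[of k "1::'k"] by simp
  have X: "homog_comp i (?X j) = (if i = 0 then const_mpoly (a j) else
      if i = 1 then Var j else 0)" for i j
    by (simp add: homog_comp_add homog_comp_const) (simp add: homog_comp_def grade_Var)
  have monom: "(\<forall>i > total_degree m. homog_comp i (monom_val ?X m) = 0) \<and>
      homog_comp (total_degree m) (monom_val ?X m) = monom_val Var m" for m
  proof (induction m rule: mpoly_induct)
    case (single j k)
    show ?case
    proof (induction k)
      case (Suc k)
      then show ?case
        using top[of 1 "?X j" k "?X j ^ k"] bound[of 1 "?X j" k "?X j ^ k"]
        by (simp add: X)
    qed (simp add: 1)
  next
    case (add m m')
    then show ?case
      using top[of "total_degree m" "monom_val ?X m" "total_degree m'" "monom_val ?X m'"]
        bound[of "total_degree m" "monom_val ?X m" "total_degree m'" "monom_val ?X m'"]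
      by (auto simp: monom_val_add total_degree_add)
  qed (simp add: 1)
  have "homog_comp d (subst ?X p) = (\<Sum>m\<in>Poly_Mapping.keys p. homog_comp d
      (const_mpoly (Poly_Mapping.lookup p m) * monom_val ?X m))"
    by (simp add: msubst_def homog_comp_sum)
  also have "\<dots> = (\<Sum>m\<in>Poly_Mapping.keys p. const_mpoly (Poly_Mapping.lookup p m) * monom_val Var m)"
  proof (rule sum.cong[OF refl])
    fix m assume "m \<in> Poly_Mapping.keys p"
    then have "total_degree m = d" using assms by (simp add: homog_def)
    then show "homog_comp d (const_mpoly (Poly_Mapping.lookup p m) * monom_val ?X m) =
        const_mpoly (Poly_Mapping.lookup p m) * monom_val Var m"
      using top[of 0 "const_mpoly (Poly_Mapping.lookup p m)" "total_degree m" "monom_val ?X m"]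
          monom[of m]
      by (simp add: homog_comp_const)
  qed
  also have "\<dots> = p" using msubst_id[of p] by (simp add: msubst_def)
  finally show ?thesis .
qed

section \<open>Ideals of irreducible sets of points\<close>

lemma nonzero_solution:
  fixes A :: "'i \<Rightarrow> 'b \<Rightarrow> 'k::field"
  assumes "finite B" "finite I" "card B < card I"
  shows "\<exists>c. (\<exists>i\<in>I. c i \<noteq> 0) \<and> (\<forall>b\<in>B. (\<Sum>i\<in>I. c i * A i b) = 0)"
  using assms
proof (induction B arbitrary: I A rule: finite_induct)
  case empty
  then have "I \<noteq> {}" by auto
  then show ?case by (intro exI[of _ "\<lambda>_. 1"]) auto
next
  case (insert b B)
  show ?case
  proof (cases "\<forall>i\<in>I. A i b = 0")
    case True
    have "card B < card I" using insert by simp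
    then obtain c where "\<exists>i\<in>I. c i \<noteq> 0" "\<forall>b\<in>B. (\<Sum>i\<in>I. c i * A i b) = 0"
      using insert.IH[OF insert.prems(1)] by blast
    then show ?thesis using True by (intro exI[of _ c]) auto
  next
    case False
    then obtain i0 where i0: "i0 \<in> I" "A i0 b \<noteq> 0" by blast
    let ?I = "I - {i0}"
    have "card B < card ?I" using insert i0 by simp
    then obtain c where c: "\<exists>i\<in>?I. c i \<noteq> 0"
        "\<forall>b'\<in>B. (\<Sum>i\<in>?I. c i * (A i b' - A i b / A i0 b * A i0 b')) = 0"
      using insert.IH[of ?I "\<lambda>i b'. A i b' - A i b / A i0 b * A i0 b'"] insert.prems by auto
    define c' where "c' = c(i0 := - (\<Sum>i\<in>?I. c i * A i b) / A i0 b)"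
    have s: "(\<Sum>i\<in>I. c' i * A i b') = c' i0 * A i0 b' + (\<Sum>i\<in>?I. c i * A i b')" for b'
      using insert.prems i0 by (subst sum.remove[of _ i0]) (auto simp: c'_def intro!: sum.cong)
    have "(\<Sum>i\<in>?I. c i * (A i b' - A i b / A i0 b * A i0 b')) =
        (\<Sum>i\<in>?I. c i * A i b' - c i * A i b * (A i0 b' / A i0 b))" for b'
      by (intro sum.cong) (simp_all add: algebra_simps)
    then have "(\<Sum>i\<in>I. c' i * A i b') = (\<Sum>i\<in>?I. c i * (A i b' - A i b / A i0 b * A i0 b'))" for b'
      unfolding s by (simp add: c'_def sum_subtractf sum_distrib_right sum_divide_distrib)
    moreover have "(\<Sum>i\<in>I. c' i * A i b) = 0"
      unfolding s using i0 by (simp add: c'_def)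
    ultimately have "\<forall>b'\<in>insert b B. (\<Sum>i\<in>I. c' i * A i b') = 0" using c(2) by auto
    moreover have "\<exists>i\<in>I. c' i \<noteq> 0" using c(1) by (auto simp: c'_def)
    ultimately show ?thesis by blast
  qed
qed

definition vanishing :: "(nat \<Rightarrow> 'k::comm_ring_1) set \<Rightarrow> 'k mpoly set" where
  "vanishing E = {p. \<forall>a\<in>E. ev a p = 0}"

lemma vanishingD: "p \<in> vanishing E \<Longrightarrow> a \<in> E \<Longrightarrow> ev a p = 0" by (simp add: vanishing_def)
lemma vanishing_0 [simp]: "0 \<in> vanishing E" by (simp add: vanishing_def)
lemma vanishing_add: "p \<in> vanishing E \<Longrightarrow> q \<in> vanishing E \<Longrightarrow> p + q \<in> vanishing E"
  by (simp add: vanishing_def ev.hom_add)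
lemma vanishing_diff: "p \<in> vanishing E \<Longrightarrow> q \<in> vanishing E \<Longrightarrow> p - q \<in> vanishing E"
  by (simp add: vanishing_def ev.hom_minus)
lemma vanishing_mult_left: "q \<in> vanishing E \<Longrightarrow> p * q \<in> vanishing E"
  by (simp add: vanishing_def ev.hom_mult)
lemma vanishing_mult_right: "p \<in> vanishing E \<Longrightarrow> p * q \<in> vanishing E"
  by (simp add: vanishing_def ev.hom_mult)
lemma vanishing_sum: "(\<And>i. i \<in> A \<Longrightarrow> f i \<in> vanishing E) \<Longrightarrow> sum f A \<in> vanishing E"
  by (induction A rule: infinite_finite_induct) (auto intro: vanishing_add)

text \<open>
  Irreducibility enters only through primality of the vanishing ideal. Arbitrary sets of points
  are allowed, so that dense subsets, cylinders and graphs of rational maps can be used without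
  taking closures.
\<close>

locale irreducible_points =
  fixes E :: "(nat \<Rightarrow> 'k::field) set"
  assumes nonempty: "E \<noteq> {}"
    and prime: "p * q \<in> vanishing E \<Longrightarrow> p \<in> vanishing E \<or> q \<in> vanishing E"
begin

lemma one_notin_vanishing: "1 \<notin> vanishing E"
  using nonempty by (auto simp: vanishing_def)

lemma notin_vanishing_mult: "p \<notin> vanishing E \<Longrightarrow> q \<notin> vanishing E \<Longrightarrow> p * q \<notin> vanishing E"
  using prime by blast

lemma notin_vanishing_power: "p \<notin> vanishing E \<Longrightarrow> p ^ k \<notin> vanishing E"
  by (induction k) (auto simp: one_notin_vanishing notin_vanishing_mult)

lemma notin_vanishing_prod:
  "(\<And>i. i \<in> A \<Longrightarrow> f i \<notin> vanishing E) \<Longrightarrow> prod f A \<notin> vanishing E"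
  by (induction A rule: infinite_finite_induct)
      (auto simp: one_notin_vanishing notin_vanishing_mult)

lemma common_point:
  assumes "finite Ps" "\<And>p. p \<in> Ps \<Longrightarrow> p \<notin> vanishing E"
  shows "\<exists>a\<in>E. \<forall>p\<in>Ps. ev a p \<noteq> 0"
proof -
  have "(\<Prod>p\<in>Ps. p) \<notin> vanishing E" using assms by (intro notin_vanishing_prod) auto
  then obtain a where "a \<in> E" "ev a (\<Prod>p\<in>Ps. p) \<noteq> 0" by (auto simp: vanishing_def)
  then show ?thesis using assms(1) by (auto simp: ev.hom_prod intro!: bexI[of _ a])
qed

end

section \<open>Polynomials in one distinguished variable\<close>

definition polys_over :: "nat set \<Rightarrow> 'k::comm_ring_1 mpoly poly set" where
  "polys_over S = {G. \<forall>a. coeff G a \<in> polys_in S}"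

lemma polys_over_add: "p \<in> polys_over S \<Longrightarrow> q \<in> polys_over S \<Longrightarrow> p + q \<in> polys_over S"
  by (simp add: polys_over_def polys_in_add)
lemma polys_over_diff: "p \<in> polys_over S \<Longrightarrow> q \<in> polys_over S \<Longrightarrow> p - q \<in> polys_over S"
  by (simp add: polys_over_def polys_in_diff)
lemma polys_over_mult: "p \<in> polys_over S \<Longrightarrow> q \<in> polys_over S \<Longrightarrow> p * q \<in> polys_over S"
  by (auto simp: polys_over_def coeff_mult intro!: polys_in_sum polys_in_mult)
lemma polys_over_pCons: "c \<in> polys_in S \<Longrightarrow> p \<in> polys_over S \<Longrightarrow> pCons c p \<in> polys_over S"
  by (auto simp: polys_over_def coeff_pCons split: nat.split)
lemma polys_over_0 [simp]: "0 \<in> polys_over S" by (simp add: polys_over_def)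
lemma polys_over_1 [simp]: "1 \<in> polys_over S"
  by (simp add: one_pCons polys_over_pCons)
lemma polys_over_monom: "c \<in> polys_in S \<Longrightarrow> monom c k \<in> polys_over S"
  by (simp add: polys_over_def)
lemma polys_over_smult: "c \<in> polys_in S \<Longrightarrow> p \<in> polys_over S \<Longrightarrow> Polynomial.smult c p \<in> polys_over S"
  by (simp add: polys_over_def polys_in_mult)
lemma polys_over_sum: "(\<And>i. i \<in> A \<Longrightarrow> f i \<in> polys_over S) \<Longrightarrow> sum f A \<in> polys_over S"
  by (induction A rule: infinite_finite_induct) (auto intro: polys_over_add)
lemma polys_over_prod: "(\<And>i. i \<in> A \<Longrightarrow> f i \<in> polys_over S) \<Longrightarrow> prod f A \<in> polys_over S"
  by (induction A rule: infinite_finite_induct) (auto intro: polys_over_mult)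
lemma polys_over_power: "p \<in> polys_over S \<Longrightarrow> p ^ k \<in> polys_over S"
  by (induction k) (auto intro: polys_over_mult)

lemma polys_over_exists:
  assumes "P \<in> polys_in (insert l S)"
  shows "\<exists>G\<in>polys_over S. poly G (Var l) = P"
proof -
  let ?X = "\<lambda>i. if i = l then [:0, 1:] else [:Var i:]"
  define G where "G = msubst (\<lambda>c. [:const_mpoly c:]) ?X P"
  have "G \<in> polys_over S"
    unfolding G_def msubst_def monom_val_def
  proof (intro polys_over_sum polys_over_mult polys_over_prod polys_over_power polys_over_pCons
      polys_over_0 polys_in_const)
    fix m i assume "m \<in> Poly_Mapping.keys P" "i \<in> Poly_Mapping.keys m"
    then have "i \<in> insert l S" using assms by (auto simp: polys_in_def)
    then show "?X i \<in> polys_over S" by (auto intro!: polys_over_pCons)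
  qed
  moreover have "poly G (Var l) = P"
  proof -
    have hom: "comm_ring_hom (\<lambda>p. poly p (Var l :: 'a mpoly))" by unfold_locales auto
    have "(\<lambda>i. poly (?X i) (Var l)) = (Var :: nat \<Rightarrow> 'a mpoly)" by auto
    then show ?thesis
      using comm_ring_hom.hom_msubst[OF hom poly_const_hom, of ?X P] msubst_id[of P]
      by (simp add: G_def)
  qed
  ultimately show ?thesis by blast
qed

lemma poly_Var_in:
  assumes "G \<in> polys_over S" shows "poly G (Var l) \<in> polys_in (insert l S)"
  unfolding poly_altdef
  using assms polys_in_mono[of S "insert l S"]
  by (auto simp: polys_over_def intro!: polys_in_intros)

text \<open>
  Division by \<open>G\<close> after clearing powers of its leading coefficient never introduces variables
  outside \<open>S\<close> into the coefficients, so that induction on \<open>S\<close> can be applied to the remainder.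
\<close>

lemma pseudo_division:
  assumes "G \<in> polys_over S" "P \<in> polys_over S"
  shows "\<exists>M Q R. Q \<in> polys_over S \<and> R \<in> polys_over S \<and>
    Polynomial.smult (lead_coeff G ^ M) P = Q * G + R \<and> (\<forall>a\<ge>degree G. coeff R a = 0)"
proof -
  have "\<exists>M Q R. Q \<in> polys_over S \<and> R \<in> polys_over S \<and>
      Polynomial.smult (lead_coeff G ^ M) P = Q * G + R \<and> (\<forall>a\<ge>degree G. coeff R a = 0)"
    if "P \<in> polys_over S" "\<And>a. a \<ge> m \<Longrightarrow> coeff P a = 0" for m P
    using that
  proof (induction m arbitrary: P)
    case 0
    then have "P = 0" by (simp add: poly_eq_iff)
    then show ?case by (intro exI[of _ 0]) auto
  next
    case (Suc m)
    show ?case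
    proof (cases "Suc m \<le> degree G")
      case True
      then have "Polynomial.smult (lead_coeff G ^ 0) P = 0 * G + P" "\<forall>a\<ge>degree G. coeff P a = 0"
        using Suc.prems(2) by auto
      then show ?thesis using Suc.prems(1) polys_over_0 by blast
    next
      case False
      let ?T = "monom (coeff P m) (m - degree G)"
      define P' where "P' = Polynomial.smult (lead_coeff G) P - ?T * G"
      have in': "lead_coeff G \<in> polys_in S" "?T \<in> polys_over S"
        using assms(1) Suc.prems(1) by (auto simp: polys_over_def intro:
            polys_over_monom[unfolded polys_over_def])
      then have P': "P' \<in> polys_over S"
        unfolding P'_def using assms Suc.prems(1)
            by (intro polys_over_diff polys_over_smult polys_over_mult)
      have "coeff P' a = 0" if "a \<ge> m" for a
      proof (cases "a = m")
        case True
        then show ?thesis using False by (simp add: P'_def coeff_monom_mult)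
      next
        case neq: False
        then show ?thesis using that False Suc.prems(2)[of a]
          by (simp add: P'_def coeff_monom_mult coeff_eq_0)
      qed
      from Suc.IH[OF P' this] obtain M Q R where IH: "Q \<in> polys_over S" "R \<in> polys_over S"
        "Polynomial.smult (lead_coeff G ^ M) P' = Q * G + R" "\<forall>a\<ge>degree G. coeff R a = 0" by blast
      have "Polynomial.smult (lead_coeff G ^ Suc M) P
          = Polynomial.smult (lead_coeff G ^ M) P' + Polynomial.smult (lead_coeff G ^ M) ?T * G"
        by (simp add: P'_def smult_diff_right mult.commute)
      also have "\<dots> = (Q + Polynomial.smult (lead_coeff G ^ M) ?T) * G + R"
        unfolding IH(3) by (simp add: algebra_simps)
      finally show ?thesis using IH in' polys_over_add polys_over_smult polys_in_power by metis
    qed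
  qed
  from this[of P "Suc (degree P)"] show ?thesis using assms(2) by (simp add: coeff_eq_0)
qed

section \<open>Generic generators and elimination sequences\<close>

definition ideal_span :: "'k::comm_ring_1 mpoly set \<Rightarrow> 'k mpoly set" where
  "ideal_span B = {p. \<exists>A. p = (\<Sum>b\<in>B. A b * b)}"

lemma ideal_span_0 [simp]: "0 \<in> ideal_span B"
  unfolding ideal_span_def by (auto intro!: exI[of _ "\<lambda>_. 0"])
lemma ideal_span_add: "p \<in> ideal_span B \<Longrightarrow> q \<in> ideal_span B \<Longrightarrow> p + q \<in> ideal_span B"
proof -
  assume "p \<in> ideal_span B" "q \<in> ideal_span B"
  then obtain A A' where "p = (\<Sum>b\<in>B. A b * b)" "q = (\<Sum>b\<in>B. A' b * b)" by (auto simp: ideal_span_def)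
  then have "p + q = (\<Sum>b\<in>B. (A b + A' b) * b)" by (simp add: distrib_right sum.distrib)
  then show "p + q \<in> ideal_span B"
    unfolding ideal_span_def mem_Collect_eq by (rule exI[of _ "\<lambda>b. A b + A' b"])
qed
lemma ideal_span_mult: "p \<in> ideal_span B \<Longrightarrow> q * p \<in> ideal_span B"
proof -
  assume "p \<in> ideal_span B"
  then obtain A where "p = (\<Sum>b\<in>B. A b * b)" by (auto simp: ideal_span_def)
  then have "q * p = (\<Sum>b\<in>B. (q * A b) * b)" by (simp add: sum_distrib_left mult.assoc)
  then show "q * p \<in> ideal_span B"
    unfolding ideal_span_def mem_Collect_eq by (rule exI[of _ "\<lambda>b. q * A b"])
qed
lemma ideal_span_sum: "(\<And>i. i \<in> A \<Longrightarrow> f i \<in> ideal_span B) \<Longrightarrow> sum f A \<in> ideal_span B"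
  by (induction A rule: infinite_finite_induct) (auto intro: ideal_span_add)
lemma ideal_span_mono:
  assumes "finite B'" "B \<subseteq> B'" shows "ideal_span B \<subseteq> ideal_span B'"
proof
  fix p assume "p \<in> ideal_span B"
  then obtain A where "p = (\<Sum>b\<in>B. A b * b)" by (auto simp: ideal_span_def)
  also have "\<dots> = (\<Sum>b\<in>B'. (if b \<in> B then A b else 0) * b)"
    using assms by (intro sum.mono_neutral_cong_left) auto
  finally show "p \<in> ideal_span B'"
    unfolding ideal_span_def by (intro CollectI exI[of _ "\<lambda>b. if b \<in> B then A b else 0"])
qed
lemma ideal_span_base: "finite B \<Longrightarrow> b \<in> B \<Longrightarrow> b \<in> ideal_span B"
  unfolding ideal_span_def
  by (rule CollectI, rule exI[of _ "\<lambda>x. if x = b then 1 else 0"])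
    (simp add: if_distrib[of "\<lambda>x. x * _"] cong: if_cong)

text \<open>
  After localisation at the function field of \<open>E\<close>, the equations of \<open>E\<close> in the variables \<open>S\<close> lie in
  the ideal generated by \<open>B\<close>.
\<close>

definition generically_generated :: "(nat \<Rightarrow> 'k::comm_ring_1) set \<Rightarrow> nat set \<Rightarrow> 'k mpoly set \<Rightarrow> bool"
    where
  "generically_generated E S B \<longleftrightarrow>
    (\<forall>P \<in> vanishing E \<inter> polys_in S. \<exists>h. h \<notin> vanishing E \<and> h * P \<in> ideal_span B)"

text \<open>
  An entry \<open>(l, P)\<close> expresses that the coordinate \<open>x\<^sub>l\<close> is separably algebraic on \<open>E\<close> over the other
  coordinates that are left, so that these generically determine it up to finitely many choices,
  and its differential is a combination of theirs.
\<close>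

primrec elim_seq :: "(nat \<Rightarrow> 'k::comm_ring_1) set \<Rightarrow> nat set \<Rightarrow> (nat \<times> 'k mpoly) list \<Rightarrow> bool" where
  "elim_seq E S [] \<longleftrightarrow> True"
| "elim_seq E S (x # L) \<longleftrightarrow> fst x \<in> S \<and> snd x \<in> vanishing E \<and> snd x \<in> polys_in S \<and>
    partial_deriv (fst x) (snd x) \<notin> vanishing E \<and> elim_seq E (S - {fst x}) L"

lemma elim_seq_mono: "elim_seq E S L \<Longrightarrow> S \<subseteq> T \<Longrightarrow> elim_seq E T L"
proof (induction L arbitrary: S T)
  case (Cons x L)
  have "elim_seq E (T - {fst x}) L" using Cons.IH[of "S - {fst x}" "T - {fst x}"] Cons.prems by auto
  then show ?case using Cons.prems polys_in_mono[of S T] by auto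
qed simp

lemma elim_seq_mem:
  assumes "elim_seq E S L" "x \<in> set L"
  shows "fst x \<in> S" "snd x \<in> vanishing E" "snd x \<in> polys_in S" "partial_deriv (fst x) (snd x)
      \<notin> vanishing E"
proof -
  have "fst x \<in> S \<and> snd x \<in> vanishing E \<and> snd x \<in> polys_in S
      \<and> partial_deriv (fst x) (snd x) \<notin> vanishing E"
    using assms
  proof (induction L arbitrary: S)
    case (Cons y L)
    show ?case
    proof (cases "x = y")
      case False
      then show ?thesis using Cons polys_in_mono[of "S - {fst y}" S] by auto
    qed (use Cons.prems in auto)
  qed simp
  then show "fst x \<in> S" "snd x \<in> vanishing E" "snd x \<in> polys_in S" "partial_deriv (fst x) (snd x)
      \<notin> vanishing E"
    by auto
qed

lemma elim_seq_cong:
  assumes "\<And>p. p \<in> polys_in T \<Longrightarrow> p \<in> vanishing E \<longleftrightarrow> p \<in> vanishing E'" "S \<subseteq> T"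
  shows "elim_seq E S L \<longleftrightarrow> elim_seq E' S L"
  using assms(2)
proof (induction L arbitrary: S)
  case (Cons x L)
  have "elim_seq E (S - {fst x}) L \<longleftrightarrow> elim_seq E' (S - {fst x}) L"
    using Cons.IH[of "S - {fst x}"] Cons.prems by blast
  moreover have "snd x \<in> polys_in S \<Longrightarrow> snd x \<in> polys_in T
      \<and> partial_deriv (fst x) (snd x) \<in> polys_in T"
    using polys_in_mono[OF Cons.prems] partial_deriv_in by blast
  ultimately show ?case using assms(1) by auto
qed simp

text \<open>
  The Jacobian matrix of an elimination sequence is triangular.
\<close>

lemma elim_seq_nth_indep:
  assumes "elim_seq E S L" "i < j" "j < length L"
  shows "partial_deriv (fst (L ! i)) (snd (L ! j)) = 0"
  using assms
proof (induction L arbitrary: S i j)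
  case (Cons x L)
  obtain j' where j: "j = Suc j'" using Cons.prems by (cases j) auto
  show ?case
  proof (cases i)
    case 0
    have "snd (L ! j') \<in> polys_in (S - {fst x})"
      using Cons.prems j elim_seq_mem(3)[of E "S - {fst x}" L "L ! j'"] by auto
    from partial_deriv_indep[OF this, of "fst x"] show ?thesis using 0 j by simp
  next
    case (Suc i')
    then show ?thesis using Cons j by auto
  qed
qed simp

context irreducible_points
begin

text \<open>
  Here \<open>G\<close> plays the role of the minimal polynomial of \<open>x\<^sub>l\<close> over the function field in the variables
  \<open>S\<close>: pseudo-division by \<open>G\<close> leaves a remainder whose coefficients are equations of \<open>E\<close> in \<open>S\<close>.
\<close>

lemma generically_generated_insert:
  assumes "l \<notin> S" "finite B" "generically_generated E S B"
    and G: "G \<in> polys_over S" "poly G (Var l) \<in> vanishing E" "lead_coeff G \<notin> vanishing E"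
    and minimal: "\<And>R. R \<in> polys_over S \<Longrightarrow> poly R (Var l) \<in> vanishing E \<Longrightarrow>
      \<forall>a\<ge>degree G. coeff R a = 0 \<Longrightarrow> \<forall>a. coeff R a \<in> vanishing E"
  shows "generically_generated E (insert l S) (insert (poly G (Var l)) B)"
  unfolding generically_generated_def
proof
  let ?B = "insert (poly G (Var l)) B"
  fix P assume "P \<in> vanishing E \<inter> polys_in (insert l S)"
  then have P: "P \<in> vanishing E" "P \<in> polys_in (insert l S)" by auto
  obtain P' where P': "P' \<in> polys_over S" "poly P' (Var l) = P"
    using polys_over_exists[OF P(2)] by blast
  obtain M Q R where R: "Q \<in> polys_over S" "R \<in> polys_over S"
      "Polynomial.smult (lead_coeff G ^ M) P' = Q * G + R" "\<forall>a\<ge>degree G. coeff R a = 0"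
    using pseudo_division[OF G(1) P'(1)] by blast
  have eq: "lead_coeff G ^ M * P = poly Q (Var l) * poly G (Var l) + poly R (Var l)"
    using arg_cong[OF R(3), of "\<lambda>p. poly p (Var l)"] P'(2) by simp
  have "poly R (Var l) = lead_coeff G ^ M * P - poly Q (Var l) * poly G (Var l)"
    using eq by simp
  then have "poly R (Var l) \<in> vanishing E"
    using P(1) G(2) by (auto intro!: vanishing_diff vanishing_mult_left)
  then have "\<forall>a. coeff R a \<in> vanishing E" using minimal R by blast
  then have "\<forall>a. \<exists>h. h \<notin> vanishing E \<and> h * coeff R a \<in> ideal_span B"
    using assms(3) R(2) unfolding generically_generated_def polys_over_def by blast
  then obtain h where h: "\<And>a. h a \<notin> vanishing E" "\<And>a. h a * coeff R a \<in> ideal_span B" by metis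
  define H where "H = (\<Prod>a\<le>degree R. h a)"
  have H: "H \<notin> vanishing E" unfolding H_def by (intro notin_vanishing_prod h)
  have HR: "H * coeff R a \<in> ideal_span B" if "a \<le> degree R" for a
  proof -
    have "H = (\<Prod>i\<in>{..degree R} - {a}. h i) * h a"
      unfolding H_def using that by (subst prod.remove[of _ a]) (auto simp: mult.commute)
    then show ?thesis using ideal_span_mult[OF h(2)[of a]] by (simp add: mult.assoc)
  qed
  have mono: "ideal_span B \<subseteq> ideal_span ?B" using assms(2) by (intro ideal_span_mono) auto
  have "H * poly R (Var l) = (\<Sum>a\<le>degree R. Var l ^ a * (H * coeff R a))"
    by (simp add: poly_altdef sum_distrib_left mult_ac)
  also have "\<dots> \<in> ideal_span ?B"
    by (rule ideal_span_sum, rule ideal_span_mult, rule subsetD[OF mono], rule HR) simp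
  finally have "H * poly R (Var l) \<in> ideal_span ?B" .
  moreover have "H * poly Q (Var l) * poly G (Var l) \<in> ideal_span ?B"
    using assms(2) by (intro ideal_span_mult ideal_span_base) auto
  ultimately have "H * poly Q (Var l) * poly G (Var l) + H * poly R (Var l) \<in> ideal_span ?B"
    by (intro ideal_span_add)
  moreover have "H * lead_coeff G ^ M * P = H * poly Q (Var l) * poly G (Var l)
      + H * poly R (Var l)"
    using eq by (simp add: mult.assoc distrib_left)
  ultimately have "H * lead_coeff G ^ M * P \<in> ideal_span ?B" by simp
  moreover have "H * lead_coeff G ^ M \<notin> vanishing E"
      by (intro notin_vanishing_mult notin_vanishing_power H G(3))
  ultimately show "\<exists>h. h \<notin> vanishing E \<and> h * P \<in> ideal_span ?B" by blast
qed

lemma deriv_in_vanishing: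
  assumes "G \<in> polys_over S" "l \<notin> S" "\<And>a. coeff G a \<in> vanishing E"
  shows "partial_deriv l (poly G (Var l)) \<in> vanishing E"
proof -
  have "partial_deriv l (coeff G a) = 0" for a
    using assms by (intro partial_deriv_indep[of _ S]) (auto simp: polys_over_def)
  then have "partial_deriv l (poly G (Var l)) =
      (\<Sum>a\<le>degree G. coeff G a * partial_deriv l (Var l ^ a))"
    by (simp add: poly_altdef partial_deriv_sum partial_deriv_mult)
  also have "\<dots> \<in> vanishing E" by (intro vanishing_sum vanishing_mult_right assms)
  finally show ?thesis .
qed

lemma truncate_leading_terms:
  assumes "G \<in> polys_over S" "poly G (Var l) \<in> vanishing E" "coeff G a \<notin> vanishing E"
  shows "\<exists>G'\<in>polys_over S. poly G' (Var l) \<in> vanishing E \<and> lead_coeff G' \<notin> vanishing E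
      \<and> degree G' \<le> degree G"
  using assms
proof (induction "degree G" arbitrary: G rule: less_induct)
  case less
  show ?case
  proof (cases "lead_coeff G \<in> vanishing E")
    case True
    define G' where "G' = G - monom (lead_coeff G) (degree G)"
    have a: "a < degree G"
      using True less.prems(3) by (metis coeff_eq_0 linorder_neqE_nat vanishing_0)
    have 0: "coeff G' i = 0" if "i \<ge> degree G" for i
      using that by (auto simp: G'_def coeff_eq_0)
    have "degree G' \<le> degree G - 1"
      by (rule degree_le) (use 0 in auto)
    then have deg: "degree G' < degree G" using a by simp
    have "G' \<in> polys_over S"
      unfolding G'_def using less.prems(1) by (intro polys_over_diff polys_over_monom)
          (auto simp: polys_over_def)
    moreover have "poly G' (Var l) \<in> vanishing E"
      unfolding G'_def using less.prems True by
          (auto simp: poly_monom intro!: vanishing_diff vanishing_mult_right)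
    moreover have "coeff G' a \<notin> vanishing E" using a less.prems by (simp add: G'_def)
    ultimately show ?thesis using less.hyps[OF deg] deg by fastforce
  qed (use less.prems in blast)
qed

end

section \<open>Formal arcs\<close>

text \<open>
  Newton's iteration with the slope \<open>c\<close> at the origin kept fixed. Each round gains one order.
\<close>

lemma hensel_step:
  fixes X :: "nat \<Rightarrow> 'k::field mpoly"
  assumes "ev (\<lambda>_. 0) (subst X G) = 0" "ev (\<lambda>_. 0) (subst X (partial_deriv l G)) \<noteq> 0"
  shows "\<exists>Y. ev (\<lambda>_. 0) Y = ev (\<lambda>_. 0) (X l) \<and> order_ge (Suc D) (subst (X(l := Y)) G)"
proof (induction D)
  case 0
  show ?case using assms(1) by (intro exI[of _ "X l"])
      (simp add: order_ge_1_iff[unfolded One_nat_def])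
next
  case (Suc D)
  then obtain Y where Y: "ev (\<lambda>_. 0) Y = ev (\<lambda>_. 0) (X l)"
      "order_ge (Suc D) (subst (X(l := Y)) G)" by blast
  define c where "c = ev (\<lambda>_. 0) (subst X (partial_deriv l G))"
  define g where "g = subst (X(l := Y)) G"
  define \<delta> where "\<delta> = - const_mpoly (1 / c) * g"
  define dG where "dG = subst (X(l := Y)) (partial_deriv l G)"
  have "(\<lambda>i. ev (\<lambda>_. 0) ((X(l := Y)) i)) = (\<lambda>i. ev (\<lambda>_. 0) (X i))"
    using Y(1) by auto
  then have "ev (\<lambda>_. 0) dG = c" by (simp add: dG_def c_def ev_subst)
  then have "order_ge 1 (1 - const_mpoly (1 / c) * dG)"
    using assms(2) by (simp add: order_ge_1_iff[unfolded One_nat_def] ev.hom_minus ev.hom_mult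
        c_def)
  then have 1: "order_ge (Suc (Suc D)) (g * (1 - const_mpoly (1 / c) * dG))"
    using order_ge_mult[OF Y(2), folded g_def] by fastforce
  have \<delta>: "order_ge (Suc D) \<delta>" unfolding \<delta>_def by (intro order_ge_mult_left Y(2)[folded g_def])
  have "order_ge (Suc D + Suc D) (\<delta> * \<delta>)" using \<delta> by (intro order_ge_mult)
  then have 2: "order_ge (Suc (Suc D)) (\<delta>\<^sup>2)" by (auto simp: power2_eq_square elim: order_ge_mono)
  obtain R where "subst ((X(l := Y))(l := (X(l := Y)) l + \<delta>)) G = g + \<delta> * dG + \<delta>\<^sup>2 * R"
    using const.msubst_taylor[of "X(l := Y)" l \<delta> G] unfolding g_def dG_def by blast
  then have "subst (X(l := Y + \<delta>)) G = g * (1 - const_mpoly (1 / c) * dG) + \<delta>\<^sup>2 * R"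
    by (simp add: \<delta>_def algebra_simps)
  moreover have "order_ge (Suc (Suc D)) (g * (1 - const_mpoly (1 / c) * dG) + \<delta>\<^sup>2 * R)"
    by (intro order_ge_add 1 order_ge_mult_right 2)
  moreover have "ev (\<lambda>_. 0) (Y + \<delta>) = ev (\<lambda>_. 0) (X l)"
    using \<delta> Y(1) order_ge_mono[OF \<delta>, of 1] by (simp add: ev.hom_add
        order_ge_1_iff[unfolded One_nat_def])
  ultimately show ?case by metis
qed

text \<open>
  The equations are solved from the last entry backwards: the equation of an entry involves its
  own coordinate and those that are already known, and changing that coordinate does not disturb
  the equations of the later entries.
\<close>

lemma hensel:
  fixes X0 :: "nat \<Rightarrow> 'k::field mpoly"
  assumes "elim_seq E S L" "y \<in> E" "\<And>x. x \<in> set L \<Longrightarrow> ev y (partial_deriv (fst x) (snd x)) \<noteq> 0"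
    and "\<And>j. ev (\<lambda>_. 0) (X0 j) = y j"
  shows "\<exists>X. (\<forall>j. j \<notin> fst ` set L \<longrightarrow> X j = X0 j) \<and> (\<forall>j. ev (\<lambda>_. 0) (X j) = y j) \<and>
    (\<forall>x\<in>set L. order_ge D (subst X (snd x)))"
  using assms
proof (induction L arbitrary: S)
  case Nil
  then show ?case by auto
next
  case (Cons x L)
  obtain X where X: "\<forall>j. j \<notin> fst ` set L \<longrightarrow> X j = X0 j" "\<forall>j. ev (\<lambda>_. 0) (X j) = y j"
      "\<forall>x\<in>set L. order_ge D (subst X (snd x))"
    using Cons.IH[of "S - {fst x}"] Cons.prems by auto
  have e: "ev (\<lambda>_. 0) (subst X p) = ev y p" for p using X(2) by (simp add: ev_subst)
  obtain Y where Y: "ev (\<lambda>_. 0) Y = ev (\<lambda>_. 0) (X (fst x))"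
      "order_ge (Suc D) (subst (X(fst x := Y)) (snd x))"
    using hensel_step[of X "snd x" "fst x" D] Cons.prems vanishingD[of "snd x" E y]
        by (auto simp: e)
  have "subst (X(fst x := Y)) (snd z) = subst X (snd z)" if "z \<in> set L" for z
    using elim_seq_mem(3)[of E "S - {fst x}" L z] that Cons.prems(1)
    by (intro msubst_cong[of _ "S - {fst x}"]) auto
  then have "\<forall>z\<in>set (x # L). order_ge D (subst (X(fst x := Y)) (snd z))"
    using X(3) order_ge_mono[OF Y(2), of D] by (simp del: fun_upd_apply)
  moreover have "\<forall>j. j \<notin> fst ` set (x # L) \<longrightarrow> (X(fst x := Y)) j = X0 j"
    using X(1) by simp
  moreover have "\<forall>j. ev (\<lambda>_. 0) ((X(fst x := Y)) j) = y j"
    using X(2) Y(1) by simp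
  ultimately show ?case by blast
qed

section \<open>Separable elimination over a perfect field\<close>

lemma lookup_partial_deriv:
  "Poly_Mapping.lookup (partial_deriv l P) m =
    of_nat (Suc (Poly_Mapping.lookup m l)) * Poly_Mapping.lookup P (m + Poly_Mapping.single l 1)"
proof (induction P rule: mpoly_induct)
  case (single m' c)
  show ?case
  proof (cases "Poly_Mapping.lookup m' l = 0")
    case True
    then have "m' \<noteq> m + Poly_Mapping.single l 1"
      by (metis add_is_0 lookup_add lookup_single_eq zero_neq_one)
    then show ?thesis using True by (simp add: partial_deriv_single lookup_single when_def)
  next
    case False
    have "m' - Poly_Mapping.single l 1 + Poly_Mapping.single l 1 = m'"
      using single_minus_one_add[OF False, of "Poly_Mapping.single l 1"] by simp
    then have "m' - Poly_Mapping.single l 1 = m \<longleftrightarrow> m' = m + Poly_Mapping.single l 1" by auto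
    then show ?thesis by (auto simp: partial_deriv_single lookup_single when_def lookup_add)
  qed
qed (simp_all add: partial_deriv_add lookup_add distrib_left)

lemma deriv_zero_char_dvd:
  fixes P :: "'k::field mpoly"
  assumes "partial_deriv l P = 0" "m \<in> Poly_Mapping.keys P"
  shows "CHAR('k) dvd Poly_Mapping.lookup m l"
proof (cases "Poly_Mapping.lookup m l = 0")
  case False
  define m' where "m' = m - Poly_Mapping.single l 1"
  have m: "m' + Poly_Mapping.single l 1 = m"
    using single_minus_one_add[OF False, of "Poly_Mapping.single l 1"] by (simp add: m'_def)
  have "Suc (Poly_Mapping.lookup m' l) = Poly_Mapping.lookup m l"
    using False by (simp add: m'_def lookup_minus)
  then have "of_nat (Poly_Mapping.lookup m l) * Poly_Mapping.lookup P m = 0"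
    using lookup_partial_deriv[of l P m'] assms(1) m by simp
  then show ?thesis using assms(2) by (simp add: in_keys_iff of_nat_eq_0_iff_char_dvd)
qed simp

text \<open>
  Over a perfect field a polynomial all of whose derivatives vanish is a \<open>p\<close>-th power. Only the
  values of the root \<open>Q\<close> at points matter, so Frobenius is applied in the field and not to
  polynomials.
\<close>

lemma char_root:
  fixes P :: "'k::alg_closed_field mpoly"
  assumes "P \<in> polys_in S" "P \<noteq> 0" "\<And>l. partial_deriv l P = 0" "\<And>m. m \<in> Poly_Mapping.keys P
      \<Longrightarrow> total_degree m \<le> D"
    and "D > 0" "CHAR('k) > 0"
  shows "\<exists>Q\<in>polys_in S. Q \<noteq> 0 \<and> (\<forall>m\<in>Poly_Mapping.keys Q. total_degree m < D) \<and>
    (\<forall>a. ev a P = 0 \<longrightarrow> ev a Q = 0)"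
proof -
  define q where "q = CHAR('k)"
  have q: "q > 1" using prime_CHAR_semidom[OF assms(6)] unfolding q_def by (rule prime_gt_1_nat)
  define r where "r = (\<lambda>c::'k. SOME x. x ^ q = c)"
  have r: "r c ^ q = c" for c
    unfolding r_def by (rule someI_ex) (use nth_root_exists[of q c] q in auto)
  define s where "s = (\<lambda>m. Poly_Mapping.map (\<lambda>x::nat. x div q) (m :: nat \<Rightarrow>\<^sub>0 nat))"
  have s: "Poly_Mapping.lookup (s m) i = Poly_Mapping.lookup m i div q" for m i
    by (simp add: s_def Poly_Mapping.map.rep_eq when_def)
  have dvd: "q * Poly_Mapping.lookup (s m) i = Poly_Mapping.lookup m i"
      if "m \<in> Poly_Mapping.keys P" for m i
    using deriv_zero_char_dvd[OF assms(3) that, of i] by (simp add: s q_def)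
  have inj: "inj_on s (Poly_Mapping.keys P)"
  proof (rule inj_onI, rule poly_mapping_eqI)
    fix m m' i assume "m \<in> Poly_Mapping.keys P" "m' \<in> Poly_Mapping.keys P" "s m = s m'"
    then show "Poly_Mapping.lookup m i = Poly_Mapping.lookup m' i"
      using dvd[of m i] dvd[of m' i] by simp
  qed
  have keys_s: "Poly_Mapping.keys (s m) \<subseteq> Poly_Mapping.keys m" for m
  proof
    fix i assume "i \<in> Poly_Mapping.keys (s m)"
    then have "Poly_Mapping.lookup (s m) i \<noteq> 0" by (rule in_keys_iff[THEN iffD1])
    then have "Poly_Mapping.lookup m i \<noteq> 0" unfolding s by (metis div_0)
    then show "i \<in> Poly_Mapping.keys m" by (rule in_keys_iff[THEN iffD2])
  qed
  define Q where "Q = (\<Sum>m\<in>Poly_Mapping.keys P. Poly_Mapping.single (s m)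
      (r (Poly_Mapping.lookup P m)))"
  have keys_Q: "Poly_Mapping.keys Q \<subseteq> s ` Poly_Mapping.keys P"
    unfolding Q_def by (rule order_trans[OF keys_sum]) auto
  have "Q \<in> polys_in S"
    using keys_Q keys_s assms(1) unfolding polys_in_def by fast
  moreover have "Q \<noteq> 0"
  proof -
    obtain m where m: "m \<in> Poly_Mapping.keys P" using assms(2)
        by (metis all_not_in_conv keys_eq_empty)
    have "Poly_Mapping.lookup Q (s m) = (\<Sum>m'\<in>Poly_Mapping.keys P. r
        (Poly_Mapping.lookup P m') when m' = m)"
      unfolding Q_def lookup_sum lookup_single
      by (intro sum.cong) (use inj m in \<open>auto simp: inj_on_def when_def\<close>)
    also have "\<dots> = r (Poly_Mapping.lookup P m)"
      using m by (simp add: when_def)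
    finally have "Poly_Mapping.lookup Q (s m) ^ q \<noteq> 0" using m by (simp add: r in_keys_iff)
    then show ?thesis using q by auto
  qed
  moreover have "total_degree m' < D" if m': "m' \<in> Poly_Mapping.keys Q" for m'
  proof -
    obtain m where m: "m \<in> Poly_Mapping.keys P" "m' = s m" using keys_Q m' by blast
    have "q * total_degree m' = q * (\<Sum>i\<in>Poly_Mapping.keys m. Poly_Mapping.lookup (s m) i)"
      using total_degree_superset[of "Poly_Mapping.keys m" "s m"] keys_s[of m] m by simp
    also have "\<dots> = total_degree m" using dvd[OF m(1)]
        by (simp add: sum_distrib_left total_degree_def)
    finally have le: "q * total_degree m' \<le> D" using assms(4)[OF m(1)] by simp
    show ?thesis
    proof (cases "total_degree m' = 0")
      case False
      then have "total_degree m' < q * total_degree m'" using q by simp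
      then show ?thesis using le by linarith
    qed (use assms(5) in simp)
  qed
  moreover have "ev a Q = 0" if "ev a P = 0" for a
  proof -
    have "ev a Q ^ q = (\<Sum>m\<in>Poly_Mapping.keys P. r (Poly_Mapping.lookup P m) * monom_val a (s m)) ^
        q"
      by (simp add: Q_def ev.hom_sum comm_ring_hom.msubst_single[OF id_ring_hom])
    also have "\<dots> = (\<Sum>m\<in>Poly_Mapping.keys P. (r (Poly_Mapping.lookup P m) * monom_val a (s m)) ^ q)"
      unfolding q_def by (rule freshmans_dream_sum) (use prime_CHAR_semidom[OF assms(6)] in auto)
    also have "\<dots> = (\<Sum>m\<in>Poly_Mapping.keys P. Poly_Mapping.lookup P m * monom_val a m)"
    proof (rule sum.cong[OF refl])
      fix m assume m: "m \<in> Poly_Mapping.keys P"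
      have "monom_val a (s m) ^ q = (\<Prod>i\<in>Poly_Mapping.keys m.
          (a i ^ Poly_Mapping.lookup (s m) i) ^ q)"
        using monom_val_superset[of "Poly_Mapping.keys m" "s m" a] keys_s[of m]
            by (simp add: prod_power_distrib)
      also have "\<dots> = monom_val a m"
        unfolding monom_val_def using dvd[OF m]
            by (intro prod.cong) (simp_all add: mult.commute flip: power_mult)
      finally show "(r (Poly_Mapping.lookup P m) * monom_val a (s m)) ^ q
          = Poly_Mapping.lookup P m * monom_val a m"
        by (simp add: power_mult_distrib r)
    qed
    also have "\<dots> = 0" using that by (simp add: msubst_def)
    finally show ?thesis by simp
  qed
  ultimately show ?thesis by blast
qed

text \<open>
  In an equation of least total degree some derivative is not an equation: otherwise all the
  derivatives would be zero by minimality, and the \<open>p\<close>-th root would be an equation of smaller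
  degree.
\<close>

lemma separable_variable:
  fixes E :: "(nat \<Rightarrow> 'k::alg_closed_field) set"
  assumes "irreducible_points E" "P0 \<in> vanishing E" "P0 \<in> polys_in S" "P0 \<noteq> 0"
  shows "\<exists>l\<in>S. \<exists>P\<in>vanishing E \<inter> polys_in S. partial_deriv l P \<notin> vanishing E"
proof (rule ccontr)
  interpret irreducible_points E by fact
  assume "\<not> ?thesis"
  then have all: "partial_deriv l P \<in> vanishing E" if "P \<in> vanishing E" "P \<in> polys_in S" for l P
    using that partial_deriv_indep[of P S l] by (cases "l \<in> S") auto
  \<comment> \<open>the possible bounds for the total degree of a non-zero equation\<close>
  define good where "good = (\<lambda>D. \<exists>P\<in>vanishing E \<inter> polys_in S. P \<noteq> 0
      \<and> (\<forall>m\<in>Poly_Mapping.keys P. total_degree m \<le> D))"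
  have "good (Max (total_degree ` Poly_Mapping.keys P0))"
    unfolding good_def using assms by (intro bexI[of _ P0]) auto
  then have good: "good (LEAST D. good D)" by (rule LeastI)
  define D where "D = (LEAST D. good D)"
  have goodD: "good D" using good unfolding D_def .
  have least: "\<not> good D'" if "D' < D" for D' using that unfolding D_def by (rule not_less_Least)
  obtain P where P: "P \<in> vanishing E" "P \<in> polys_in S" "P \<noteq> 0" "\<And>m. m \<in> Poly_Mapping.keys P
      \<Longrightarrow> total_degree m \<le> D"
    using goodD unfolding good_def by blast
  have D: "D > 0"
  proof (rule ccontr)
    assume "\<not> D > 0"
    then have "m = 0" if "m \<in> Poly_Mapping.keys P" for m
      using P(4)[OF that] by (auto simp: total_degree_def poly_mapping_eq_iff in_keys_iff
          fun_eq_iff)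
    then have keys: "Poly_Mapping.keys P \<subseteq> {0}" by blast
    then have "P = const_mpoly (Poly_Mapping.lookup P 0)"
      by (intro poly_mapping_eqI) (auto simp: const_mpoly_def lookup_single when_def in_keys_iff)
    moreover have "Poly_Mapping.lookup P 0 \<noteq> 0"
      using keys P(3) by (metis calculation const_mpoly_def single_zero)
    moreover obtain a where "a \<in> E" using nonempty by blast
    ultimately show False using vanishingD[OF P(1) \<open>a \<in> E\<close>] by (metis ev_const)
  qed
  have d0: "partial_deriv l P = 0" for l
  proof (rule ccontr)
    assume ne: "partial_deriv l P \<noteq> 0"
    have "total_degree m \<le> D - 1" if "m \<in> Poly_Mapping.keys (partial_deriv l P)" for m
    proof -
      have "m + Poly_Mapping.single l 1 \<in> Poly_Mapping.keys P"
        using that by (auto simp: in_keys_iff lookup_partial_deriv)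
      then show ?thesis using P(4)[of "m + Poly_Mapping.single l 1"] by (simp add: total_degree_add)
    qed
    then have "good (D - 1)"
      unfolding good_def using ne all[OF P(1,2)] partial_deriv_in[OF P(2)] by blast
    then show False using least[of "D - 1"] D by simp
  qed
  show False
  proof (cases "CHAR('k) > 0")
    case True
    obtain Q where Q: "Q \<in> polys_in S" "Q \<noteq> 0" "\<forall>m\<in>Poly_Mapping.keys Q. total_degree m < D"
        "\<forall>a. ev a P = 0 \<longrightarrow> ev a Q = 0"
      using char_root[OF P(2,3) d0 P(4) D True] by blast
    have "Q \<in> vanishing E" using Q(4) P(1) by (auto simp: vanishing_def)
    then have "good (D - 1)" unfolding good_def using Q by (intro bexI[of _ Q]) auto
    then show False using least[of "D - 1"] D by simp
  next
    case False
    have "m = 0" if "m \<in> Poly_Mapping.keys P" for m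
      using deriv_zero_char_dvd[OF d0 that] False by (auto simp: poly_mapping_eq_iff fun_eq_iff)
    then have "\<forall>m\<in>Poly_Mapping.keys P. total_degree m \<le> 0" by (metis order_refl total_degree_0)
    then have "good 0" unfolding good_def using P(1-3) by blast
    then show False using least D by blast
  qed
qed

text \<open>
  Induction on the number of variables. A separable coordinate is eliminated by an equation of
  least degree in it among those with non-vanishing leading coefficient; this equation inherits
  a non-vanishing derivative from any separable one, by pseudo-division.
\<close>

lemma elim_seq_exists:
  fixes E :: "(nat \<Rightarrow> 'k::alg_closed_field) set"
  assumes "irreducible_points E" "finite S"
  shows "\<exists>L. elim_seq E S L \<and> generically_generated E S (snd ` set L)"
  using assms(2)
proof (induction "card S" arbitrary: S rule: less_induct)
  case less
  interpret irreducible_points E by fact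
  show ?case
  proof (cases "vanishing E \<inter> polys_in S \<subseteq> {0}")
    case True
    then have "elim_seq E S [] \<and> generically_generated E S (snd ` set [])"
      unfolding generically_generated_def using one_notin_vanishing by (auto intro!: exI[of _ 1])
    then show ?thesis by blast
  next
    case False
    then obtain l P0 where l: "l \<in> S" "P0 \<in> vanishing E" "P0 \<in> polys_in S" "partial_deriv l P0
        \<notin> vanishing E"
      using separable_variable[OF assms(1), of _ S] by blast
    define T where "T = S - {l}"
    have S: "S = insert l T" "l \<notin> T" "finite T" "card T < card S"
      using l(1) less.prems card_Diff1_less[OF less.prems l(1)] by (auto simp: T_def)
    obtain L where L: "elim_seq E T L" "generically_generated E T (snd ` set L)"
      using less.hyps[OF S(4) S(3)] by blast
    obtain G0 where G0: "G0 \<in> polys_over T" "poly G0 (Var l) = P0"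
      using polys_over_exists l(3) S(1) by blast
    obtain a where "coeff G0 a \<notin> vanishing E"
      using deriv_in_vanishing[OF G0(1) S(2)] l(4) G0(2) by auto
    define cand where "cand = (\<lambda>G. G \<in> polys_over T \<and> poly G (Var l) \<in> vanishing E
        \<and> lead_coeff G \<notin> vanishing E)"
    have "\<exists>G. cand G"
      using truncate_leading_terms[OF G0(1) _ \<open>coeff G0 a \<notin> vanishing E\<close>] G0(2) l(2)
          unfolding cand_def by blast
    then obtain G where "cand G" and least: "\<And>G'. cand G' \<Longrightarrow> degree G \<le> degree G'"
      using ex_has_least_nat[of cand _ degree] by metis
    then have G: "G \<in> polys_over T" "poly G (Var l) \<in> vanishing E" "lead_coeff G \<notin> vanishing E"
      by (auto simp: cand_def)
    have minimal: "\<forall>a. coeff R a \<in> vanishing E"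
      if R: "R \<in> polys_over T" "poly R (Var l) \<in> vanishing E" "\<forall>a\<ge>degree G. coeff R a = 0" for R
    proof (rule ccontr)
      assume "\<not> ?thesis"
      then obtain a where "coeff R a \<notin> vanishing E" by blast
      then obtain G' where "cand G'" "degree G' \<le> degree R" "R \<noteq> 0"
        using truncate_leading_terms[OF R(1,2)] unfolding cand_def by force
      then show False using least[of G'] R(3) by (metis leading_coeff_0_iff order_trans)
    qed
    obtain M Q R where R: "Q \<in> polys_over T" "R \<in> polys_over T"
        "Polynomial.smult (lead_coeff G ^ M) G0 = Q * G + R" "\<forall>a\<ge>degree G. coeff R a = 0"
      using pseudo_division[OF G(1) G0(1)] by blast
    have eq: "poly R (Var l) = lead_coeff G ^ M * P0 - poly Q (Var l) * poly G (Var l)"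
      using arg_cong[OF R(3), of "\<lambda>p. poly p (Var l)"] G0(2) by simp
    have "poly R (Var l) \<in> vanishing E"
      unfolding eq using l(2) G(2) by (intro vanishing_diff vanishing_mult_left)
    then have "partial_deriv l (poly R (Var l)) \<in> vanishing E"
      using minimal R(2,4) deriv_in_vanishing[OF R(2) S(2)] by blast
    moreover have "partial_deriv l (lead_coeff G ^ M) = 0"
      using G(1) S(2) by (intro partial_deriv_indep[of _ T] polys_in_power)
          (auto simp: polys_over_def)
    ultimately have v: "lead_coeff G ^ M * partial_deriv l P0 -
        (partial_deriv l (poly Q (Var l)) * poly G (Var l)
            + poly Q (Var l) * partial_deriv l (poly G (Var l))) \<in> vanishing E"
      unfolding eq by (simp add: partial_deriv_diff partial_deriv_mult)
    have "partial_deriv l (poly G (Var l)) \<notin> vanishing E"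
    proof
      assume "partial_deriv l (poly G (Var l)) \<in> vanishing E"
      then have "partial_deriv l (poly Q (Var l)) * poly G (Var l)
          + poly Q (Var l) * partial_deriv l (poly G (Var l)) \<in> vanishing E"
        using G(2) by (intro vanishing_add vanishing_mult_left)
      from vanishing_add[OF v this] have "lead_coeff G ^ M * partial_deriv l P0 \<in> vanishing E"
          by simp
      then show False using notin_vanishing_mult[OF notin_vanishing_power[OF G(3)] l(4)] by blast
    qed
    moreover have "poly G (Var l) \<in> polys_in S" using poly_Var_in[OF G(1), of l] S(1) by simp
    ultimately have "elim_seq E S ((l, poly G (Var l)) # L)"
      using l(1) G(2) L(1) unfolding T_def by simp
    moreover have "generically_generated E (insert l T) (insert (poly G (Var l)) (snd ` set L))"
      by (rule generically_generated_insert[OF S(2) _ L(2) G minimal]) simp_all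
    then have "generically_generated E S (snd ` set ((l, poly G (Var l)) # L))"
      unfolding S(1)[symmetric] by simp
    ultimately show ?thesis by blast
  qed
qed

section \<open>Length of elimination sequences, and matrices over the function field\<close>

context irreducible_points
begin

text \<open>
  The differentials of the equations of an elimination sequence are linearly independent at a
  general point of \<open>E\<close>, because of the triangular shape, and they are combinations of the
  differentials of the generators \<open>B\<close>.
\<close>

lemma elim_seq_length_le:
  assumes "elim_seq E S L" "generically_generated E S B" "finite B" "B \<subseteq> vanishing E"
  shows "length L \<le> card B"
proof (rule ccontr)
  assume "\<not> ?thesis"
  then have lt: "card B < card {..<length L}" by simp
  have mem: "snd (L ! i) \<in> vanishing E" "snd (L ! i) \<in> polys_in S"
      "partial_deriv (fst (L ! i)) (snd (L ! i)) \<notin> vanishing E" if "i < length L" for i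
    using elim_seq_mem[OF assms(1), of "L ! i"] that by auto
  have "\<exists>z. i < length L \<longrightarrow> fst z \<notin> vanishing E \<and> fst z * snd (L ! i) = (\<Sum>b\<in>B. snd z b * b)" for i
  proof (cases "i < length L")
    case i: True
    obtain h where h: "h \<notin> vanishing E" "h * snd (L ! i) \<in> ideal_span B"
      using assms(2) mem(1,2)[OF i] unfolding generically_generated_def by blast
    from h(2) obtain A where "h * snd (L ! i) = (\<Sum>b\<in>B. A b * b)"
      unfolding ideal_span_def by blast
    then show ?thesis using h(1) by (intro exI[of _ "(h, A)"]) simp
  qed simp
  then have "\<exists>z. \<forall>i. i < length L \<longrightarrow>
      fst (z i) \<notin> vanishing E \<and> fst (z i) * snd (L ! i) = (\<Sum>b\<in>B. snd (z i) b * b)"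
    by (intro choice allI)
  then obtain z where z: "\<And>i. i < length L \<Longrightarrow>
      fst (z i) \<notin> vanishing E \<and> fst (z i) * snd (L ! i) = (\<Sum>b\<in>B. snd (z i) b * b)" by blast
  define h A where "h = (\<lambda>i. fst (z i))" and "A = (\<lambda>i. snd (z i))"
  have h: "h i \<notin> vanishing E" "h i * snd (L ! i) = (\<Sum>b\<in>B. A i b * b)" if "i < length L" for i
    using z[OF that] by (simp_all add: h_def A_def)
  let ?Ps = "(\<lambda>i. h i * partial_deriv (fst (L ! i)) (snd (L ! i))) ` {..<length L}"
  have notin: "p \<notin> vanishing E" if "p \<in> ?Ps" for p
    using that notin_vanishing_mult[OF h(1) mem(3)] by blast
  have fin: "finite ?Ps" by simp
  obtain y where y: "y \<in> E" "\<And>p. p \<in> ?Ps \<Longrightarrow> ev y p \<noteq> 0"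
    using common_point[OF fin notin] by blast
  have deriv: "ev y (h i) * ev y (partial_deriv x (snd (L ! i))) =
      (\<Sum>b\<in>B. ev y (A i b) * ev y (partial_deriv x b))" if "i < length L" for i x
  proof -
    have "ev y (partial_deriv x (h i * snd (L ! i))) = ev y (partial_deriv x (\<Sum>b\<in>B. A i b * b))"
      using h(2)[OF that] by simp
    moreover have "ev y b = 0" if "b \<in> B" for b using assms(4) vanishingD y(1) that by blast
    ultimately show ?thesis
      using vanishingD[OF mem(1)[OF that] y(1)]
      by (simp add: partial_deriv_mult partial_deriv_sum ev.hom_add ev.hom_mult ev.hom_sum)
  qed
  obtain c where c: "\<exists>i\<in>{..<length L}. c i \<noteq> 0"
      "\<forall>b\<in>B. (\<Sum>i<length L. c i * ev y (A i b)) = 0"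
    using nonzero_solution[OF assms(3) _ lt, of "\<lambda>i b. ev y (A i b)"] by auto
  \<comment> \<open>in the direction of the first coordinate with non-zero weight the relation has a single term\<close>
  define i where "i = (LEAST i. i < length L \<and> c i \<noteq> 0)"
  have i: "i < length L" "c i \<noteq> 0"
    using LeastI_ex[of "\<lambda>i. i < length L \<and> c i \<noteq> 0"] c(1) unfolding i_def by auto
  have least: "c j = 0" if "j < i" for j
    using not_less_Least[of j "\<lambda>i. i < length L \<and> c i \<noteq> 0"] that i(1) unfolding i_def by auto
  let ?l = "fst (L ! i)"
  have "0 = (\<Sum>b\<in>B. (\<Sum>j<length L. c j * ev y (A j b)) * ev y (partial_deriv ?l b))"
    using c(2) by simp
  also have "\<dots> = (\<Sum>j<length L. c j * (\<Sum>b\<in>B. ev y (A j b) * ev y (partial_deriv ?l b)))"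
    by (simp add: sum_distrib_left sum_distrib_right mult.assoc) (rule sum.swap)
  also have "\<dots> = (\<Sum>j<length L. c j * (ev y (h j) * ev y (partial_deriv ?l (snd (L ! j)))))"
    by (intro sum.cong) (simp_all add: deriv)
  also have "\<dots> = (\<Sum>j\<in>{i}. c j * (ev y (h j) * ev y (partial_deriv ?l (snd (L ! j)))))"
  proof (rule sum.mono_neutral_right)
    show "\<forall>j\<in>{..<length L} - {i}. c j * (ev y (h j) * ev y (partial_deriv ?l (snd (L ! j)))) = 0"
    proof
      fix j assume "j \<in> {..<length L} - {i}"
      then consider "j < i" | "i < j" "j < length L" by fastforce
      then show "c j * (ev y (h j) * ev y (partial_deriv ?l (snd (L ! j)))) = 0"
        by cases (simp_all add: least elim_seq_nth_indep[OF assms(1)])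
    qed
  qed (use i in auto)
  finally have "c i * ev y (h i * partial_deriv ?l (snd (L ! i))) = 0" by (simp add: ev.hom_mult)
  then show False using i y(2) by auto
qed

text \<open>
  Gaussian elimination over the function field, with denominators collected in \<open>h\<close>. Subtracting
  the multiple of a pivot row clears the pivot column, and \<open>F v = 0\<close> persists; the pivot row
  itself is an equation that eliminates the pivot coordinate of \<open>v\<close>. Hence there are \<open>r\<close>
  eliminations for rank \<open>r\<close>, and they can be put in front of any elimination of the coordinates on
  which \<open>F\<close> depends.
\<close>

lemma rank_factorization:
  fixes F :: "'i \<Rightarrow> nat \<Rightarrow> 'k mpoly"
  assumes "finite Q" "Q \<inter> S = {}"
    and "\<And>i j. i \<in> I \<Longrightarrow> j \<in> Q \<Longrightarrow> F i j \<in> polys_in S"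
    and "\<And>i. i \<in> I \<Longrightarrow> (\<Sum>j\<in>Q. F i j * Var j) \<in> vanishing E"
  shows "\<exists>r h a b Res. h \<notin> vanishing E \<and>
    (\<forall>i\<in>I. \<forall>j\<in>Q. h * F i j = (\<Sum>e<r. a e i * b e j) + Res i j \<and> Res i j \<in> vanishing E \<inter> polys_in S) \<and>
    (\<forall>L. elim_seq E S L \<longrightarrow> (\<exists>L'. length L' = r + length L \<and> elim_seq E (S \<union> Q) L'))"
  using assms
proof (induction "card Q" arbitrary: Q F rule: less_induct)
  case less
  show ?case
  proof (cases "\<forall>i\<in>I. \<forall>j\<in>Q. F i j \<in> vanishing E")
    case True
    have "(1 :: 'k mpoly) \<notin> vanishing E \<and>
      (\<forall>i\<in>I. \<forall>j\<in>Q. 1 * F i j = (\<Sum>e<0. (0 :: 'k mpoly) * 0) + F i j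
          \<and> F i j \<in> vanishing E \<inter> polys_in S) \<and>
      (\<forall>L. elim_seq E S L \<longrightarrow> (\<exists>L'. length L' = 0 + length L \<and> elim_seq E (S \<union> Q) L'))"
      using True less.prems(3) one_notin_vanishing elim_seq_mono[of E S _ "S \<union> Q"] by auto
    then show ?thesis by (intro exI) assumption
  next
    case False
    then obtain p q where pq: "p \<in> I" "q \<in> Q" "F p q \<notin> vanishing E" by blast
    \<comment> \<open>column \<open>q\<close> of \<open>F'\<close> is zero as a polynomial, so the induction does not involve \<open>v\<^sub>q\<close> any more\<close>
    define F' where "F' = (\<lambda>i j. F p q * F i j - F i q * F p j)"
    let ?Q = "Q - {q}"
    have "card ?Q < card Q" using less.prems(1) pq(2) by (rule card_Diff1_less)
    moreover have "finite ?Q" "?Q \<inter> S = {}" using less.prems by auto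
    moreover have "F' i j \<in> polys_in S" if "i \<in> I" "j \<in> ?Q" for i j
      unfolding F'_def using that pq less.prems(3) by (intro polys_in_diff polys_in_mult) auto
    moreover have "(\<Sum>j\<in>?Q. F' i j * Var j) \<in> vanishing E" if "i \<in> I" for i
    proof -
      have "(\<Sum>j\<in>?Q. F' i j * Var j) = (\<Sum>j\<in>Q. F' i j * Var j)"
        using less.prems(1) pq(2) by (simp add: sum.remove[of Q q] F'_def)
      also have "\<dots> = F p q * (\<Sum>j\<in>Q. F i j * Var j) - F i q * (\<Sum>j\<in>Q. F p j * Var j)"
        by (simp add: F'_def left_diff_distrib sum_subtractf sum_distrib_left mult.assoc)
      also have "\<dots> \<in> vanishing E" using less.prems(4) that pq(1)
          by (intro vanishing_diff vanishing_mult_left)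
      finally show ?thesis .
    qed
    ultimately obtain r h a b Res where IH: "h \<notin> vanishing E"
      "\<And>i j. i \<in> I \<Longrightarrow> j \<in> ?Q \<Longrightarrow> h * F' i j = (\<Sum>e<r. a e i * b e j) + Res i j"
      "\<And>i j. i \<in> I \<Longrightarrow> j \<in> ?Q \<Longrightarrow> Res i j \<in> vanishing E \<inter> polys_in S"
      "\<And>L. elim_seq E S L \<Longrightarrow> \<exists>L'. length L' = r + length L \<and> elim_seq E (S \<union> ?Q) L'"
      using less.hyps[of ?Q F'] by blast
    define a' where "a' = (\<lambda>e i. if e < r then a e i else h * F i q)"
    define b' where "b' = (\<lambda>e j. if e < r then (if j = q then 0 else b e j) else F p j)"
    define Res' where "Res' = (\<lambda>i j. if j = q then 0 else Res i j)"
    have "h * F p q * F i j = (\<Sum>e<Suc r. a' e i * b' e j) + Res' i j" if "i \<in> I" "j \<in> Q" for i j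
    proof -
      have "h * F' i j = (\<Sum>e<r. a' e i * b' e j) + Res' i j"
      proof (cases "j = q")
        case True
        then show ?thesis by (simp add: a'_def b'_def Res'_def F'_def mult.commute)
      next
        case False
        then show ?thesis using IH(2)[of i j] that by (simp add: a'_def b'_def Res'_def)
      qed
      then show ?thesis by (simp add: F'_def a'_def b'_def algebra_simps)
    qed
    moreover have "Res' i j \<in> vanishing E \<inter> polys_in S" if "i \<in> I" "j \<in> Q" for i j
      using IH(3)[of i j] that by (auto simp: Res'_def)
    moreover have "h * F p q \<notin> vanishing E" using IH(1) pq(3) by (rule notin_vanishing_mult)
    moreover have "\<exists>L'. length L' = Suc r + length L \<and> elim_seq E (S \<union> Q) L'"
        if L: "elim_seq E S L" for L
    proof -
      obtain L' where L': "length L' = r + length L" "elim_seq E (S \<union> ?Q) L'" using IH(4)[OF L]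
          by blast
      let ?P = "\<Sum>j\<in>Q. F p j * Var j"
      have q: "q \<notin> S" using pq(2) less.prems(2) by blast
      have "partial_deriv q ?P = (\<Sum>j\<in>Q. F p j * (if j = q then 1 else 0))"
        using less.prems(3) pq(1) q
        by (auto simp: partial_deriv_sum partial_deriv_mult partial_deriv_Var
            partial_deriv_indep[of _ S] intro!: sum.cong)
      also have "\<dots> = F p q" using less.prems(1) pq(2) by (simp add: if_distrib cong: if_cong)
      finally have "partial_deriv q ?P \<notin> vanishing E" using pq(3) by simp
      moreover have "?P \<in> polys_in (S \<union> Q)"
        using less.prems(3)[OF pq(1)] polys_in_mono[of S "S \<union> Q"]
            by (intro polys_in_sum polys_in_mult) auto
      moreover have "S \<union> Q - {q} = S \<union> ?Q" using q by auto
      ultimately have "elim_seq E (S \<union> Q) ((q, ?P) # L')"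
        using less.prems(4)[OF pq(1)] pq(2) L'(2) by simp
      then show ?thesis using L'(1) by (intro exI[of _ "(q, ?P) # L'"]) simp
    qed
    ultimately show ?thesis by blast
  qed
qed

text \<open>
  Eliminating a row by means of a pivot keeps the other rows dependent only where the pivot does
  not vanish. This is why the hypothesis on the points of \<open>E\<close> exempts a locus \<open>h = 0\<close>, which grows
  in the induction.
\<close>

lemma polynomial_dependence:
  fixes B :: "'i \<Rightarrow> 'j \<Rightarrow> 'k mpoly"
  assumes "finite A" "h \<notin> vanishing E"
    and "\<And>i j. i \<in> A \<Longrightarrow> j \<in> J \<Longrightarrow> B i j \<in> polys_in S"
    and "\<And>y. y \<in> E \<Longrightarrow> ev y h \<noteq> 0 \<Longrightarrow>
      \<exists>c. (\<exists>i\<in>A. c i \<noteq> 0) \<and> (\<forall>j\<in>J. (\<Sum>i\<in>A. c i * ev y (B i j)) = 0)"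
  shows "\<exists>C. (\<forall>i\<in>A. C i \<in> polys_in S) \<and> (\<exists>i\<in>A. C i \<notin> vanishing E) \<and>
    (\<forall>j\<in>J. (\<Sum>i\<in>A. C i * B i j) \<in> vanishing E)"
  using assms
proof (induction "card A" arbitrary: A B h rule: less_induct)
  case less
  show ?case
  proof (cases "\<forall>i\<in>A. \<forall>j\<in>J. B i j \<in> vanishing E")
    case True
    obtain y where "y \<in> E" "ev y h \<noteq> 0" using less.prems(2) by (auto simp: vanishing_def)
    then have "A \<noteq> {}" using less.prems(4) by blast
    then show ?thesis using True one_notin_vanishing
        by (intro exI[of _ "\<lambda>_. 1"]) (auto intro: vanishing_sum)
  next
    case False
    then obtain p q where pq: "p \<in> A" "q \<in> J" "B p q \<notin> vanishing E" by blast
    let ?A = "A - {p}"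
    define B' where "B' = (\<lambda>i j. B p q * B i j - B i q * B p j)"
    have "card ?A < card A" using less.prems(1) pq(1) by (rule card_Diff1_less)
    moreover have "finite ?A" using less.prems by auto
    moreover have "h * B p q \<notin> vanishing E" using less.prems(2) pq(3) by (rule notin_vanishing_mult)
    moreover have "B' i j \<in> polys_in S" if "i \<in> ?A" "j \<in> J" for i j
      unfolding B'_def using that pq less.prems(3) by (intro polys_in_diff polys_in_mult) auto
    moreover have "\<exists>c. (\<exists>i\<in>?A. c i \<noteq> 0) \<and> (\<forall>j\<in>J. (\<Sum>i\<in>?A. c i * ev y (B' i j)) = 0)"
      if y: "y \<in> E" "ev y (h * B p q) \<noteq> 0" for y
    proof -
      have nz: "ev y h \<noteq> 0" "ev y (B p q) \<noteq> 0" using y(2) by (auto simp: ev.hom_mult)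
      obtain c where c: "\<exists>i\<in>A. c i \<noteq> 0" "\<forall>j\<in>J. (\<Sum>i\<in>A. c i * ev y (B i j)) = 0"
        using less.prems(4)[OF y(1) nz(1)] by blast
      have c': "(\<Sum>i\<in>?A. c i * ev y (B i j)) = - (c p * ev y (B p j))" if "j \<in> J" for j
        using c(2) that less.prems(1) pq(1) by
            (simp add: sum.remove[of A p] eq_neg_iff_add_eq_0 add.commute)
      have "(\<Sum>i\<in>?A. c i * ev y (B' i j)) = 0" if "j \<in> J" for j
      proof -
        have "(\<Sum>i\<in>?A. c i * ev y (B' i j)) =
            ev y (B p q) * (\<Sum>i\<in>?A. c i * ev y (B i j)) - (\<Sum>i\<in>?A. c i * ev y (B i q)) * ev y (B p j)"
          by (simp add: B'_def ev.hom_minus ev.hom_mult right_diff_distrib sum_subtractf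
            sum_distrib_left sum_distrib_right mult_ac)
        then show ?thesis using c'[OF that] c'[OF pq(2)] by (simp add: mult_ac)
      qed
      moreover have "\<exists>i\<in>?A. c i \<noteq> 0"
      proof (rule ccontr)
        assume z: "\<not> ?thesis"
        then have "c p * ev y (B p q) = 0" using c'[OF pq(2)] by simp
        then show False using z c(1) nz(2) by auto
      qed
      ultimately show ?thesis by blast
    qed
    ultimately obtain C where C: "\<forall>i\<in>?A. C i \<in> polys_in S" "\<exists>i\<in>?A. C i \<notin> vanishing E"
        "\<forall>j\<in>J. (\<Sum>i\<in>?A. C i * B' i j) \<in> vanishing E"
      using less.hyps[of ?A "h * B p q" B'] by blast
    define C' where "C' = (\<lambda>i. if i = p then - (\<Sum>i\<in>?A. C i * B i q) else B p q * C i)"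
    have "C' i \<in> polys_in S" if "i \<in> A" for i
      unfolding C'_def using C(1) less.prems(3) pq that
      by (auto intro!: polys_in_uminus polys_in_sum polys_in_mult)
    moreover have "\<exists>i\<in>A. C' i \<notin> vanishing E"
    proof -
      obtain i where "i \<in> ?A" "C i \<notin> vanishing E" using C(2) by blast
      then show ?thesis using notin_vanishing_mult[OF pq(3)]
          by (intro bexI[of _ i]) (auto simp: C'_def)
    qed
    moreover have "(\<Sum>i\<in>A. C' i * B i j) \<in> vanishing E" if "j \<in> J" for j
    proof -
      have "(\<Sum>i\<in>A. C' i * B i j) = C' p * B p j + (\<Sum>i\<in>?A. C' i * B i j)"
        using less.prems(1) pq(1) by (simp add: sum.remove[of A p])
      also have "(\<Sum>i\<in>?A. C' i * B i j) = (\<Sum>i\<in>?A. B p q * C i * B i j)"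
        by (intro sum.cong) (auto simp: C'_def)
      also have "C' p * B p j + \<dots> = (\<Sum>i\<in>?A. C i * B' i j)"
        by (simp add: C'_def B'_def right_diff_distrib sum_subtractf sum_distrib_left
            sum_distrib_right mult_ac)
      finally show ?thesis using C(3) that by simp
    qed
    ultimately show ?thesis by blast
  qed
qed

end

section \<open>Elimination sequences and codimension\<close>

text \<open>
  Over a finite field, adding \<open>1\<close> to the product of all the linear factors gives a polynomial
  without roots.
\<close>

lemma infinite_alg_closed: "infinite (UNIV :: 'k::alg_closed_field set)"
proof
  assume fin: "finite (UNIV :: 'k set)"
  define p where "p = (\<Prod>a\<in>(UNIV::'k set). [:- a, 1:]) + 1"
  have 1: "poly p x = 1" for x
  proof -
    have "(\<Prod>a\<in>(UNIV::'k set). x - a) = 0" by (rule prod_zero[OF fin]) auto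
    then show ?thesis by (simp add: p_def poly_prod)
  qed
  have "degree (\<Prod>a\<in>(UNIV::'k set). [:- a, 1:]) = card (UNIV :: 'k set)"
    by (subst degree_prod_eq_sum_degree) auto
  moreover have "card (UNIV :: 'k set) > 0" using fin by (simp add: card_gt_0_iff)
  ultimately have "degree p > 0" unfolding p_def by (subst degree_add_eq_left) auto
  then show False using alg_closed_imp_poly_has_root[of p] 1 by auto
qed

text \<open>
  This is the preimage of the projection of \<open>E\<close> to the coordinates \<open>S\<close>.
\<close>

definition cylinder :: "nat set \<Rightarrow> (nat \<Rightarrow> 'k) set \<Rightarrow> (nat \<Rightarrow> 'k) set" where
  "cylinder S E = {b. \<exists>a\<in>E. \<forall>i\<in>S. b i = a i}"

definition closure_in :: "nat \<Rightarrow> (nat \<Rightarrow> 'k::comm_ring_1) set \<Rightarrow> 'k vec set" where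
  "closure_in N E = zero_locus N (vanishing E \<inter> polys_on N)"

lemma univariate_const_hom: "comm_ring_hom (\<lambda>c::'k::comm_ring_1. [:c:])"
  by unfold_locales (simp_all flip: one_pCons)

lemma univariate_eval_hom: "comm_ring_hom (\<lambda>p::'k::comm_ring_1 poly. poly p u)"
  by unfold_locales simp_all

lemma poly_msubst:
  "poly (msubst (\<lambda>c. [:c:]) X p) u = ev (\<lambda>i. poly (X i) u) (p :: 'k::comm_ring_1 mpoly)"
  using comm_ring_hom.hom_msubst[OF univariate_eval_hom univariate_const_hom, of X p u] by simp

text \<open>
  If \<open>p\<close> and \<open>q\<close> are both non-zero somewhere on the cylinder, then primality for \<open>E\<close> provides one base
  point \<open>a\<close> over which both are non-zero; along the line that joins the two free parts each of
  them has finitely many zeros only.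
\<close>

lemma irreducible_cylinder:
  fixes E :: "(nat \<Rightarrow> 'k::alg_closed_field) set"
  assumes "irreducible_points E"
  shows "irreducible_points (cylinder S E)"
proof
  interpret irreducible_points E by fact
  show "cylinder S E \<noteq> {}" using nonempty by (auto simp: cylinder_def)
  fix p q :: "'k mpoly"
  assume pq: "p * q \<in> vanishing (cylinder S E)"
  show "p \<in> vanishing (cylinder S E) \<or> q \<in> vanishing (cylinder S E)"
  proof (rule ccontr)
    assume "\<not> ?thesis"
    then obtain b1 b2 where "b1 \<in> cylinder S E" "b2 \<in> cylinder S E" and b: "ev b1 p \<noteq> 0" "ev b2 q
        \<noteq> 0"
      by (auto simp: vanishing_def)
    then obtain a1 a2 where a: "a1 \<in> E" "a2 \<in> E" "\<forall>i\<in>S. b1 i = a1 i" "\<forall>i\<in>S. b2 i = a2 i"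
      by (auto simp: cylinder_def)
    define mix :: "(nat \<Rightarrow> 'k) \<Rightarrow> (nat \<Rightarrow> 'k) \<Rightarrow> nat \<Rightarrow> 'k" where
      "mix = (\<lambda>t a i. if i \<in> S then a i else t i)"
    define freeze where "freeze = (\<lambda>t (p::'k mpoly). subst
        (\<lambda>i. if i \<in> S then Var i else const_mpoly (t i)) p)"
    have freeze: "ev a (freeze t p) = ev (mix t a) p" for a t p
      unfolding freeze_def ev_subst mix_def by (rule arg_cong[where f = "\<lambda>X. ev X p"]) auto
    have "mix b1 a1 = b1" "mix b2 a2 = b2" using a by (auto simp: mix_def)
    then have "freeze b1 p \<notin> vanishing E" "freeze b2 q \<notin> vanishing E"
      using a(1,2) b freeze[of a1 b1 p] freeze[of a2 b2 q] by (auto dest: vanishingD)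
    then have "freeze b1 p * freeze b2 q \<notin> vanishing E" by (rule notin_vanishing_mult)
    then obtain a where a: "a \<in> E" "ev (mix b1 a) p \<noteq> 0" "ev (mix b2 a) q \<noteq> 0"
      by (auto simp: vanishing_def ev.hom_mult freeze)
    \<comment> \<open>the line from \<open>b1\<close> to \<open>b2\<close> in the free coordinates, over the base point \<open>a\<close>\<close>
    define Z where "Z = (\<lambda>i. if i \<in> S then [:a i:] else [:b1 i, b2 i - b1 i:])"
    have Z: "(\<lambda>i. poly (Z i) 0) = mix b1 a" "(\<lambda>i. poly (Z i) 1) = mix b2 a"
      by (auto simp: Z_def mix_def)
    define P where "P = (\<lambda>p::'k mpoly. msubst (\<lambda>c. [:c:]) Z p)"
    have "P p \<noteq> 0" "P q \<noteq> 0"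
      using poly_msubst[of Z p 0] poly_msubst[of Z q 1] a unfolding Z P_def by auto
    then have "P p * P q \<noteq> 0" by simp
    then have "finite {u. poly (P p * P q) u = 0}" by (rule poly_roots_finite)
    then obtain u where u: "poly (P p * P q) u \<noteq> 0"
      using infinite_alg_closed[where 'k='k] by (metis (mono_tags) ex_new_if_finite mem_Collect_eq)
    have "(\<lambda>i. poly (Z i) u) \<in> cylinder S E"
      using a(1) by (auto simp: cylinder_def Z_def)
    from vanishingD[OF pq this] show False using u by (simp add: P_def poly_msubst ev.hom_mult)
  qed
qed

lemma mpoly_eval_vec:
  assumes "p \<in> polys_on N" shows "mpoly_eval p (vec N b) = ev b p"
  unfolding mpoly_eval_eq_ev
  by (rule msubst_cong[OF assms[unfolded polys_on_eq]]) simp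

lemma vec_in_closure: "b \<in> E \<Longrightarrow> vec N b \<in> closure_in N E"
  by (auto simp: closure_in_def zero_locus_def mpoly_eval_vec dest: vanishingD)

lemma irreducible_closure:
  assumes "irreducible_points E" shows "irreducible_closed N (closure_in N E)"
  unfolding irreducible_closed_def
proof (intro conjI allI impI)
  interpret irreducible_points E by fact
  show "zariski_closed N (closure_in N E)"
    unfolding zariski_closed_def closure_in_def by blast
  show "closure_in N E \<noteq> {}" using nonempty vec_in_closure by blast
  fix A B assume AB: "zariski_closed N A \<and> zariski_closed N B \<and> closure_in N E = A \<union> B"
  then obtain SA SB where S: "SA \<subseteq> polys_on N" "A = zero_locus N SA" "SB \<subseteq> polys_on N" "B
      = zero_locus N SB"
    unfolding zariski_closed_def by blast
  have sep: "\<exists>p\<in>T. p \<notin> vanishing E" if T: "closure_in N E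
      \<noteq> zero_locus N T" "zero_locus N T \<subseteq> closure_in N E" "T \<subseteq> polys_on N" for T
  proof -
    obtain x where x: "x \<in> closure_in N E" "x \<notin> zero_locus N T" using T by blast
    then obtain p where "p \<in> T" "mpoly_eval p x \<noteq> 0"
      by (auto simp: closure_in_def zero_locus_def)
    then show ?thesis using x(1) T(3) by (auto simp: closure_in_def zero_locus_def)
  qed
  show "closure_in N E = A \<or> closure_in N E = B"
  proof (rule ccontr)
    assume "\<not> ?thesis"
    then obtain p q where pq: "p \<in> SA" "q \<in> SB" "p \<notin> vanishing E" "q \<notin> vanishing E"
      using sep[of SA] sep[of SB] AB S by blast
    then obtain b where b: "b \<in> E" "ev b p \<noteq> 0" "ev b q \<noteq> 0"
      using notin_vanishing_mult[of p q] by (auto simp: vanishing_def ev.hom_mult)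
    have "vec N b \<in> A \<union> B" using vec_in_closure[OF b(1)] AB by blast
    moreover have "mpoly_eval p (vec N b) = ev b p" "mpoly_eval q (vec N b) = ev b q"
      using mpoly_eval_vec pq(1,2) S(1,3) by blast+
    ultimately show False using b(2,3) pq(1,2) S(2,4) by (auto simp: zero_locus_def)
  qed
qed

text \<open>
  If freeing the coordinate \<open>x\<^sub>l\<close> did not enlarge the closure, then \<open>P\<close> would vanish on every line in
  direction \<open>l\<close> through a point of \<open>E\<close>, and so would its derivative along that line.
\<close>

lemma cylinder_closure_strict:
  fixes E :: "(nat \<Rightarrow> 'k::alg_closed_field) set"
  assumes "l \<in> S" "S \<subseteq> {..<N}" "P \<in> vanishing E" "P \<in> polys_in S" "partial_deriv l P \<notin> vanishing E"
  shows "closure_in N (cylinder S E) \<subset> closure_in N (cylinder (S - {l}) E)"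
proof
  show "closure_in N (cylinder S E) \<subseteq> closure_in N (cylinder (S - {l}) E)"
  proof -
    have "cylinder S E \<subseteq> cylinder (S - {l}) E" by (auto simp: cylinder_def)
    then have "vanishing (cylinder (S - {l}) E) \<subseteq> vanishing (cylinder S E)"
        by (auto simp: vanishing_def)
    then show ?thesis by (auto simp: closure_in_def zero_locus_def)
  qed
  show "closure_in N (cylinder S E) \<noteq> closure_in N (cylinder (S - {l}) E)"
  proof
    assume eq: "closure_in N (cylinder S E) = closure_in N (cylinder (S - {l}) E)"
    have "ev b P = 0" if b: "b \<in> cylinder S E" for b
    proof -
      obtain a where a: "a \<in> E" "\<forall>i\<in>S. b i = a i" using b by (auto simp: cylinder_def)
      then have "ev b P = ev a P" by (intro msubst_cong[OF assms(4)]) auto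
      then show ?thesis using vanishingD[OF assms(3) a(1)] by simp
    qed
    then have P: "P \<in> vanishing (cylinder S E)" "P \<in> polys_on N"
      using polys_in_mono[OF assms(2)] assms(4) by (auto simp: vanishing_def polys_on_eq)
    have zero: "ev b P = 0" if "b \<in> cylinder (S - {l}) E" for b
    proof -
      have "vec N b \<in> closure_in N (cylinder S E)" using vec_in_closure[OF that] eq by simp
      then have "mpoly_eval P (vec N b) = 0" using P by (auto simp: closure_in_def zero_locus_def)
      then show ?thesis by (simp add: mpoly_eval_vec[OF P(2)])
    qed
    have "ev a (partial_deriv l P) = 0" if a: "a \<in> E" for a
    proof -
      let ?X = "\<lambda>i. [:a i:]"
      define Z where "Z = ?X(l := ?X l + [:0, 1:])"
      have "poly (msubst (\<lambda>c. [:c:]) Z P) u = 0" for u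
        unfolding poly_msubst by (rule zero) (use a in \<open>auto simp: cylinder_def Z_def\<close>)
      then have "msubst (\<lambda>c. [:c:]) Z P = 0"
        using poly_roots_finite[of "msubst (\<lambda>c. [:c:]) Z P"] infinite_alg_closed[where 'k='k]
            by auto
      moreover obtain R where "msubst (\<lambda>c. [:c:]) Z P = msubst (\<lambda>c. [:c:]) ?X P +
          [:0, 1:] * msubst (\<lambda>c. [:c:]) ?X (partial_deriv l P) + [:0, 1:]\<^sup>2 * R"
        unfolding Z_def using comm_ring_hom.msubst_taylor[OF univariate_const_hom] by blast
      moreover have "msubst (\<lambda>c. [:c:]) ?X p = [:ev a p:]" for p
        using comm_ring_hom.hom_msubst[OF univariate_const_hom id_ring_hom, of a p] by simp
      ultimately have "0 = [:ev a P:] + [:0, 1:] * [:ev a (partial_deriv l P):] + [:0, 1:]\<^sup>2 * R"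
          by simp
      then have "coeff 0 1 = coeff ([:ev a P:] + [:0, 1:] * [:ev a (partial_deriv l P):]
          + [:0, 1:]\<^sup>2 * R) 1"
        by (rule arg_cong)
      then show ?thesis by (simp add: power2_eq_square)
    qed
    then show False using assms(5) by (simp add: vanishing_def)
  qed
qed

lemma elim_seq_chain:
  fixes E :: "(nat \<Rightarrow> 'k::alg_closed_field) set"
  assumes "irreducible_points E" "elim_seq E S L" "S \<subseteq> {..<N}"
  shows "\<exists>C. C 0 = closure_in N (cylinder S E) \<and> (\<forall>i\<le>length L. irreducible_closed N (C i)) \<and>
    (\<forall>i<length L. C i \<subset> C (Suc i))"
  using assms(2,3)
proof (induction L arbitrary: S)
  case Nil
  then show ?case
    using irreducible_closure[OF irreducible_cylinder[OF assms(1)]]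
    by (intro exI[of _ "\<lambda>_. closure_in N (cylinder S E)"]) auto
next
  case (Cons x L)
  obtain C where C: "C 0 = closure_in N (cylinder (S - {fst x}) E)"
      "\<forall>i\<le>length L. irreducible_closed N (C i)"
      "\<forall>i<length L. C i \<subset> C (Suc i)"
  proof -
    have "elim_seq E (S - {fst x}) L" "S - {fst x} \<subseteq> {..<N}" using Cons.prems by auto
    from Cons.IH[OF this] show ?thesis using that by blast
  qed
  define C' where "C' = (\<lambda>i. case i of 0 \<Rightarrow> closure_in N (cylinder S E) | Suc i \<Rightarrow> C i)"
  have "closure_in N (cylinder S E) \<subset> C 0"
    unfolding C(1) using Cons.prems by (intro cylinder_closure_strict[of _ _ _ "snd x"]) auto
  then have "\<forall>i<length (x # L). C' i \<subset> C' (Suc i)"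
    using C(3) by (auto simp: C'_def split: nat.split)
  moreover have "\<forall>i\<le>length (x # L). irreducible_closed N (C' i)"
    using C(2) irreducible_closure[OF irreducible_cylinder[OF assms(1)]]
    by (auto simp: C'_def split: nat.split)
  ultimately show ?case by (intro exI[of _ C']) (simp add: C'_def)
qed

text \<open>
  Coordinates from \<open>N\<close> on are set to \<open>0\<close>, so that a polynomial in further variables restricts on
  these points to a polynomial on affine space.
\<close>

definition points :: "nat \<Rightarrow> 'k::zero vec set \<Rightarrow> (nat \<Rightarrow> 'k) set" where
  "points N Y = (\<lambda>y i. if i < N then y $ i else 0) ` Y"

lemma mpoly_eval_points:
  "p \<in> polys_on N \<Longrightarrow> ev (\<lambda>i. if i < N then y $ i else 0) p = mpoly_eval p y"
  unfolding mpoly_eval_eq_ev polys_on_eq by (rule msubst_cong) auto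

lemma irreducible_points_of_closed:
  fixes Y :: "'k::field vec set"
  assumes "irreducible_closed N Y"
  shows "irreducible_points (points N Y)"
proof
  show "points N Y \<noteq> {}" using assms by (auto simp: irreducible_closed_def points_def)
  obtain S where S: "S \<subseteq> polys_on N" "Y = zero_locus N S"
    using assms unfolding irreducible_closed_def zariski_closed_def by blast
  fix p q :: "'k mpoly" assume pq: "p * q \<in> vanishing (points N Y)"
  \<comment> \<open>primality for all polynomials is reduced to polynomials on affine space\<close>
  define res where "res = (\<lambda>p :: 'k mpoly. subst (\<lambda>i. if i < N then Var i else 0) p)"
  have in': "res p \<in> polys_on N" for p
    unfolding res_def polys_on_eq by (rule subst_in[OF polys_in_UNIV]) auto
  have res: "mpoly_eval (res p) y = ev (\<lambda>i. if i < N then y $ i else 0) p" for p y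
    unfolding mpoly_eval_eq_ev res_def ev_subst by (rule arg_cong[where f = "\<lambda>X. ev X p"]) auto
  have closed: "zariski_closed N (zero_locus N (insert (res p) S))" for p
    unfolding zariski_closed_def using S(1) in' by blast
  have "Y = zero_locus N (insert (res p) S) \<union> zero_locus N (insert (res q) S)"
    using pq S(2) by (auto simp: zero_locus_def res vanishing_def points_def ev.hom_mult)
  then have "Y = zero_locus N (insert (res p) S) \<or> Y = zero_locus N (insert (res q) S)"
    using assms closed unfolding irreducible_closed_def by blast
  moreover have "r \<in> vanishing (points N Y)" if "Y = zero_locus N (insert (res r) S)" for r
  proof -
    have "mpoly_eval (res r) y = 0" if "y \<in> Y" for y
      using that \<open>Y = zero_locus N (insert (res r) S)\<close> by (auto simp: zero_locus_def)
    then show ?thesis by (auto simp: vanishing_def points_def res)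
  qed
  ultimately show "p \<in> vanishing (points N Y) \<or> q \<in> vanishing (points N Y)" by blast
qed

lemma closure_points:
  assumes "zariski_closed N Y"
  shows "closure_in N (cylinder {..<N} (points N Y)) = Y"
proof -
  obtain S where S: "S \<subseteq> polys_on N" "Y = zero_locus N S"
    using assms unfolding zariski_closed_def by blast
  have ev: "ev b p = mpoly_eval p y" if "p \<in> polys_on N" "\<forall>i<N. b i = y $ i" for b p y
    unfolding mpoly_eval_eq_ev using that(2)
    by (intro msubst_cong[OF that(1)[unfolded polys_on_eq]]) auto
  have "p \<in> vanishing (cylinder {..<N} (points N Y))" if "p \<in> S" for p
    unfolding vanishing_def
  proof (intro CollectI ballI)
    fix b assume "b \<in> cylinder {..<N} (points N Y)"
    then obtain y where "y \<in> Y" "\<forall>i<N. b i = y $ i" by (auto simp: cylinder_def points_def)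
    then show "ev b p = 0" using ev[of p b y] that S by (auto simp: zero_locus_def)
  qed
  then have "closure_in N (cylinder {..<N} (points N Y)) \<subseteq> Y"
    using S by (auto simp: closure_in_def zero_locus_def)
  moreover have "y \<in> closure_in N (cylinder {..<N} (points N Y))" if y: "y \<in> Y" for y
  proof -
    have "(\<lambda>i. if i < N then y $ i else 0) \<in> cylinder {..<N} (points N Y)"
      using y by (auto simp: cylinder_def points_def)
    moreover have "y \<in> carrier_vec N" using y S by (auto simp: zero_locus_def)
    ultimately show ?thesis
      using mpoly_eval_points[of _ N y] by (auto simp: closure_in_def zero_locus_def dest:
          vanishingD)
  qed
  ultimately show ?thesis by blast
qed

lemma elim_seq_le_codim:
  fixes Y :: "'k::alg_closed_field vec set"
  assumes "irreducible_closed N Y" "elim_seq (points N Y) {..<N} L"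
  shows "enat (length L) \<le> codim_irreducible N Y"
proof -
  have "closure_in N (cylinder {..<N} (points N Y)) = Y"
    using assms(1) by (intro closure_points) (simp add: irreducible_closed_def)
  then show ?thesis
    using elim_seq_chain[OF irreducible_points_of_closed[OF assms(1)] assms(2) order_refl]
    unfolding codim_irreducible_def by (intro Sup_upper) auto
qed

section \<open>Schmidt decompositions\<close>

lemma subst_subst: "subst X (subst Z p) = subst (\<lambda>i. subst X (Z i)) p"
  by (simp add: subst.hom_msubst[OF const_mpoly_hom])

lemma homog_comp_const_mult: "homog_comp k (const_mpoly c * p) = const_mpoly c * homog_comp k p"
  by (simp add: homog_comp_def grade.hom_mult grade_const)

text \<open>
  The factors may involve any variables; those outside a given range can be set to \<open>0\<close> afterwards.
\<close>

definition schmidt_decomp :: "nat \<Rightarrow> 'k::comm_ring_1 mpoly \<Rightarrow> bool" where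
  "schmidt_decomp r F \<longleftrightarrow> (\<exists>g h. (\<forall>i<r. \<exists>a>0. homog a (g i)) \<and> (\<forall>i<r. \<exists>b>0. homog b (h i)) \<and>
    F = (\<Sum>i<r. g i * h i))"

lemma schmidt_decomp_0: "schmidt_decomp 0 0" by (simp add: schmidt_decomp_def)

lemma schmidt_decomp_mult:
  assumes "homog a g" "homog b h" "a > 0" "b > 0" shows "schmidt_decomp 1 (g * h)"
  unfolding schmidt_decomp_def
  by (rule exI[of _ "\<lambda>_. g"], rule exI[of _ "\<lambda>_. h"]) (use assms in auto)

lemma schmidt_decomp_add:
  assumes "schmidt_decomp r F" "schmidt_decomp r' F'" shows "schmidt_decomp (r + r') (F + F')"
proof -
  obtain g h where 1: "\<forall>i<r. \<exists>a>0. homog a (g i)" "\<forall>i<r. \<exists>b>0. homog b (h i)" "F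
      = (\<Sum>i<r. g i * h i)"
    using assms(1) unfolding schmidt_decomp_def by blast
  obtain g' h' where 2: "\<forall>i<r'. \<exists>a>0. homog a (g' i)" "\<forall>i<r'. \<exists>b>0. homog b (h' i)" "F'
      = (\<Sum>i<r'. g' i * h' i)"
    using assms(2) unfolding schmidt_decomp_def by blast
  define G where "G = (\<lambda>i. if i < r then g i else g' (i - r))"
  define H where "H = (\<lambda>i. if i < r then h i else h' (i - r))"
  have "(\<Sum>i<r + r'. G i * H i) = F + F'"
  proof -
    have "(\<Sum>i<r + r'. G i * H i) = (\<Sum>i<r. G i * H i) + (\<Sum>i<r'. G (r + i) * H (r + i))"
      by (induction r') (simp_all add: add.assoc)
    then show ?thesis by (simp add: G_def H_def 1 2)
  qed
  moreover have "\<forall>i<r + r'. \<exists>a>0. homog a (G i)" "\<forall>i<r + r'. \<exists>a>0. homog a (H i)"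
    using 1 2 by (auto simp: G_def H_def)
  ultimately show ?thesis unfolding schmidt_decomp_def by metis
qed

lemma schmidt_decomp_sum:
  assumes "finite A" "\<And>i. i \<in> A \<Longrightarrow> schmidt_decomp r (F i)" shows
      "schmidt_decomp (card A * r) (sum F A)"
  using assms by (induction A rule: finite_induct) (auto intro: schmidt_decomp_add schmidt_decomp_0)

lemma schmidt_decomp_mono:
  assumes "schmidt_decomp r F" "r \<le> r'" shows "schmidt_decomp r' F"
proof -
  have "schmidt_decomp 1 (0 * 0 :: 'a mpoly)" by (rule schmidt_decomp_mult[of 1 _ 1]) auto
  then have "schmidt_decomp (card {..<r' - r} * 1) (\<Sum>i<r' - r. 0 * 0 :: 'a mpoly)"
    by (intro schmidt_decomp_sum) auto
  then show ?thesis using schmidt_decomp_add[OF assms(1), of "r' - r" 0] assms(2) by simp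
qed

lemma schmidt_decomp_const_mult:
  assumes "schmidt_decomp r F" shows "schmidt_decomp r (const_mpoly c * F)"
proof -
  obtain g h where 1: "\<forall>i<r. \<exists>a>0. homog a (g i)" "\<forall>i<r. \<exists>b>0. homog b (h i)" "F
      = (\<Sum>i<r. g i * h i)"
    using assms(1) unfolding schmidt_decomp_def by blast
  have "\<forall>i<r. \<exists>a>0. homog a (const_mpoly c * g i)"
    using 1(1) homog_mult[OF homog_const] by (metis add_0)
  moreover have "const_mpoly c * F = (\<Sum>i<r. (const_mpoly c * g i) * h i)"
    by (simp add: 1(3) sum_distrib_left mult.assoc)
  ultimately show ?thesis using 1(2) unfolding schmidt_decomp_def
    by (intro exI[of _ "\<lambda>i. const_mpoly c * g i"] exI[of _ h]) simp
qed

lemma schmidt_decomp_diff: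
  assumes "schmidt_decomp r F" "schmidt_decomp r' F'" shows "schmidt_decomp (r + r') (F - F')"
proof -
  have "const_mpoly (- 1) * F' = - F'" by (simp add: const.hom_uminus)
  then show ?thesis using schmidt_decomp_add[OF assms(1)
      schmidt_decomp_const_mult[OF assms(2), of "- 1"]] by simp
qed

lemma schmidt_rank_le:
  assumes "schmidt_decomp r F" "F \<in> polys_on n" shows "schmidt_rank n F \<le> enat r"
proof -
  obtain g h where 1: "\<forall>i<r. \<exists>a>0. homog a (g i)" "\<forall>i<r. \<exists>b>0. homog b (h i)" "F
      = (\<Sum>i<r. g i * h i)"
    using assms(1) unfolding schmidt_decomp_def by blast
  define X :: "nat \<Rightarrow> 'a mpoly" where "X = (\<lambda>i. if i < n then Var i else 0)"
  have form: "is_form n a (subst X p)" if "homog a p" for a p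
    unfolding is_form_def
  proof
    show "subst X p \<in> polys_on n" unfolding polys_on_eq
      by (rule subst_in[OF polys_in_UNIV]) (simp add: X_def)
    have mon: "homog (total_degree m) (monom_val X m)" for m
    proof (induction m rule: mpoly_induct)
      case zero
      then show ?case using homog_const[of "1::'a"] by simp
    next
      case (single i k)
      have "homog k (X i ^ k)"
      proof (induction k)
        case 0
        then show ?case using homog_const[of "1::'a"] by simp
      next
        case (Suc k)
        have "homog 1 (X i)" unfolding X_def by (simp del: One_nat_def add: homog_Var)
        from homog_mult[OF this Suc] show ?case by simp
      qed
      then show ?case by simp
    next
      case (add m m')
      then show ?case by (simp add: monom_val_add total_degree_add homog_mult)
    qed
    have "homog a (subst X p)"
      unfolding msubst_def
    proof (rule homog_sum)
      fix m assume "m \<in> Poly_Mapping.keys p"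
      then have "total_degree m = a" using that by (simp add: homog_def)
      then show "homog a (const_mpoly (Poly_Mapping.lookup p m) * monom_val X m)"
        using homog_mult[OF homog_const mon[of m]] by simp
    qed
    then show "\<forall>m\<in>Poly_Mapping.keys (subst X p). total_degree m = a" by (simp add: homog_def)
  qed
  have "F = subst X F"
    using msubst_cong[of F "{..<n}" X Var const_mpoly] assms(2)
        by (simp add: polys_on_eq X_def msubst_id)
  also have "\<dots> = (\<Sum>i<r. subst X (g i) * subst X (h i))"
    by (simp add: 1(3) subst.hom_sum subst.hom_mult)
  finally have "F = (\<Sum>i<r. subst X (g i) * subst X (h i))" .
  moreover have "\<forall>i<r. \<exists>a>0. is_form n a (subst X (g i))" "\<forall>i<r. \<exists>b>0. is_form n b (subst X (h i))"
    using 1(1,2) form by blast+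
  ultimately show ?thesis unfolding schmidt_rank_def
    by (intro Inf_lower CollectI exI[of _ r] exI[of _ "\<lambda>i. subst X (g i)"]
        exI[of _ "\<lambda>i. subst X (h i)"] conjI) auto
qed

section \<open>The incidence set of a pencil of Hessians\<close>

text \<open>
  Clearing denominators, which are powers of \<open>D\<close>, pulls an equation of the image back to a
  polynomial on \<open>E\<close>, where primality applies.
\<close>

lemma irreducible_graph:
  fixes E :: "(nat \<Rightarrow> 'k::field) set"
  assumes "irreducible_points E" "D \<notin> vanishing E"
    and rat: "\<And>j. \<exists>q M. \<forall>a\<in>E. ev a D \<noteq> 0 \<longrightarrow> ev a q = ev a D ^ M * \<pi> a j"
  shows "irreducible_points (\<pi> ` {a \<in> E. ev a D \<noteq> 0})"
proof
  interpret irreducible_points E by fact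
  let ?E = "\<pi> ` {a \<in> E. ev a D \<noteq> 0}"
  show "?E \<noteq> {}" using assms(2) by (auto simp: vanishing_def)
  have clear: "\<exists>q M. \<forall>a\<in>E. ev a D \<noteq> 0 \<longrightarrow> ev a q = ev a D ^ M * ev (\<pi> a) p" for p
  proof (induction p rule: mpoly_ring_induct)
    case (const c)
    show ?case by (intro exI[of _ "const_mpoly c"] exI[of _ 0]) simp
  next
    case (Var i)
    then show ?case using rat[of i] by simp
  next
    case (add p q)
    then obtain p' M q' M' where
      "\<forall>a\<in>E. ev a D \<noteq> 0 \<longrightarrow> ev a p' = ev a D ^ M * ev (\<pi> a) p"
      "\<forall>a\<in>E. ev a D \<noteq> 0 \<longrightarrow> ev a q' = ev a D ^ M' * ev (\<pi> a) q" by blast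
    then show ?case
      by (intro exI[of _ "D ^ M' * p' + D ^ M * q'"] exI[of _ "M + M'"])
        (simp add: ev.hom_add ev.hom_mult ev.hom_power power_add distrib_left mult_ac)
  next
    case (mult p q)
    then obtain p' M q' M' where
      "\<forall>a\<in>E. ev a D \<noteq> 0 \<longrightarrow> ev a p' = ev a D ^ M * ev (\<pi> a) p"
      "\<forall>a\<in>E. ev a D \<noteq> 0 \<longrightarrow> ev a q' = ev a D ^ M' * ev (\<pi> a) q" by blast
    then show ?case
      by (intro exI[of _ "p' * q'"] exI[of _ "M + M'"])
        (simp add: ev.hom_mult power_add mult_ac)
  qed
  fix p q assume pq: "p * q \<in> vanishing ?E"
  obtain p' M where p': "\<forall>a\<in>E. ev a D \<noteq> 0 \<longrightarrow> ev a p' = ev a D ^ M * ev (\<pi> a) p" using clear by blast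
  obtain q' M' where q': "\<forall>a\<in>E. ev a D \<noteq> 0 \<longrightarrow> ev a q' = ev a D ^ M' * ev (\<pi> a) q" using clear
      by blast
  have "D * (p' * q') \<in> vanishing E"
    unfolding vanishing_def
  proof (intro CollectI ballI)
    fix a assume a: "a \<in> E"
    show "ev a (D * (p' * q')) = 0"
    proof (cases "ev a D = 0")
      case False
      then have "ev (\<pi> a) (p * q) = 0" using pq a by (auto simp: vanishing_def)
      then show ?thesis using p' q' a False by (auto simp: ev.hom_mult)
    qed (simp add: ev.hom_mult)
  qed
  then have "p' \<in> vanishing E \<or> q' \<in> vanishing E" using prime assms(2) by blast
  then show "p \<in> vanishing ?E \<or> q \<in> vanishing ?E"
    using p' q' by (auto simp: vanishing_def)
qed

lemma double_euler:
  fixes f :: "'k::comm_ring_1 mpoly"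
  assumes "is_form n d f"
  shows "(\<Sum>a<n. \<Sum>b<n. Var a * Var b * partial_deriv a (partial_deriv b f))
      = of_nat ((d - 1) * d) * f"
proof -
  have f: "f \<in> polys_in {..<n}" "homog d f" using assms
      by (auto simp: is_form_def polys_on_eq homog_def)
  have "(\<Sum>a<n. \<Sum>b<n. Var a * Var b * partial_deriv a (partial_deriv b f)) =
      (\<Sum>b<n. Var b * (\<Sum>a<n. Var a * partial_deriv a (partial_deriv b f)))"
    by (subst sum.swap) (simp add: sum_distrib_left mult_ac)
  also have "\<dots> = (\<Sum>b<n. Var b * (of_nat (d - 1) * partial_deriv b f))"
    using euler_identity[OF partial_deriv_in[OF f(1)] homog_partial_deriv[OF f(2)]] by simp
  also have "\<dots> = of_nat (d - 1) * (\<Sum>b<n. Var b * partial_deriv b f)"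
    by (simp add: sum_distrib_left mult_ac)
  also have "\<dots> = of_nat ((d - 1) * d) * f"
    using euler_identity[OF f] by (simp add: mult.assoc)
  finally show ?thesis .
qed

definition shift_vars :: "nat \<Rightarrow> 'k::comm_ring_1 mpoly \<Rightarrow> 'k mpoly" where
  "shift_vars n p = subst (\<lambda>k. Var (n + k)) p"

text \<open>
  The variables are numbered as \<open>v\<close> from \<open>0\<close>, \<open>x\<close> from \<open>n\<close> and \<open>c\<close> from \<open>n + n\<close>; the coefficient of the form
  number \<open>i0\<close> is normalised to \<open>1\<close>.
\<close>

definition pencil_hessian ::
    "nat \<Rightarrow> nat \<Rightarrow> nat \<Rightarrow> (nat \<Rightarrow> 'k::comm_ring_1 mpoly) \<Rightarrow> nat \<Rightarrow> nat \<Rightarrow> 'k mpoly" where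
  "pencil_hessian n s i0 f a b =
    (\<Sum>i<s. (if i = i0 then 1 else Var (n + n + i))
        * shift_vars n (partial_deriv a (partial_deriv b (f i))))"

abbreviation coef_vars :: "nat \<Rightarrow> nat \<Rightarrow> nat \<Rightarrow> nat set" where
  "coef_vars n s i0 \<equiv> (\<lambda>i. n + n + i) ` ({..<s} - {i0})"

lemma shift_vars_in: "p \<in> polys_in {..<n} \<Longrightarrow> shift_vars n p \<in> polys_in {n..<n + n}"
  unfolding shift_vars_def by (erule subst_in) simp

lemma ev_shift_vars: "ev a (shift_vars n p) = ev (\<lambda>k. a (n + k)) p"
  by (simp add: shift_vars_def ev_subst)

lemma pencil_hessian_in:
  assumes "\<And>i. i < s \<Longrightarrow> f i \<in> polys_in {..<n}"
  shows "pencil_hessian n s i0 f a b \<in> polys_in ({n..<n + n} \<union> coef_vars n s i0)"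
  unfolding pencil_hessian_def
proof (intro polys_in_sum polys_in_mult)
  fix i assume i: "i \<in> {..<s}"
  show "(if i = i0 then 1 else Var (n + n + i)) \<in> polys_in ({n..<n + n} \<union> coef_vars n s i0)"
    using i by auto
  have "shift_vars n (partial_deriv a (partial_deriv b (f i))) \<in> polys_in {n..<n + n}"
    using i by (intro shift_vars_in partial_deriv_in assms) simp
  then show "shift_vars n (partial_deriv a (partial_deriv b (f i)))
      \<in> polys_in ({n..<n + n} \<union> coef_vars n s i0)"
    using polys_in_mono[of "{n..<n + n}" "{n..<n + n} \<union> coef_vars n s i0"] by auto
qed

text \<open>
  The arc without corrections keeps \<open>c\<close> constant and translates \<open>x\<close>. Passing to the part of top
  degree undoes the translation, which leaves the Hessian of a single member of the pencil.
\<close>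

lemma homog_comp_translate_pencil:
  fixes f :: "nat \<Rightarrow> 'k::comm_ring_1 mpoly"
  assumes "\<And>i. i < s \<Longrightarrow> is_form n d (f i)"
  defines "X0 \<equiv> \<lambda>y j. const_mpoly (y j) + (if n \<le> j \<and> j < n + n then Var (j - n) else 0)"
  shows "homog_comp (d - 2) (subst (X0 y) (pencil_hessian n s i0 f a b)) =
    (\<Sum>i<s. const_mpoly (if i = i0 then 1 else y (n + n + i))
        * partial_deriv a (partial_deriv b (f i)))"
proof -
  have "homog_comp (d - 2) (subst (X0 y) ((if i = i0 then 1 else Var (n + n + i))
      * shift_vars n (partial_deriv a (partial_deriv b (f i))))) =
      const_mpoly (if i = i0 then 1 else y (n + n + i)) * partial_deriv a (partial_deriv b (f i))"
    if i: "i < s" for i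
  proof -
    let ?p = "partial_deriv a (partial_deriv b (f i))"
    have f: "f i \<in> polys_in {..<n}" "homog d (f i)"
      using assms(1)[OF i] by (auto simp: is_form_def polys_on_eq homog_def)
    have p: "?p \<in> polys_in {..<n}" "homog (d - 2) ?p"
      using partial_deriv_in[OF partial_deriv_in[OF f(1)]]
        homog_partial_deriv[OF homog_partial_deriv[OF f(2)]] by (simp_all add: numeral_2_eq_2)
    have "subst (X0 y) (shift_vars n ?p) = subst (\<lambda>k. X0 y (n + k)) ?p"
      by (simp add: shift_vars_def subst_subst)
    also have "\<dots> = subst (\<lambda>k. const_mpoly (y (n + k)) + Var k) ?p"
      by (rule msubst_cong[OF p(1)]) (simp add: X0_def)
    finally have 1: "homog_comp (d - 2) (subst (X0 y) (shift_vars n ?p)) = ?p"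
      using homog_comp_translate[OF p(2)] by simp
    have 2: "subst (X0 y) (if i = i0 then 1 else Var (n + n + i))
        = const_mpoly (if i = i0 then 1 else y (n + n + i))"
      by (simp add: X0_def)
    show ?thesis unfolding subst.hom_mult 2 homog_comp_const_mult 1 ..
  qed
  then show ?thesis unfolding pencil_hessian_def subst.hom_sum homog_comp_sum by simp
qed

lemma homog_comp_mult_no_const:
  assumes "homog_comp 0 z = 0"
  shows "homog_comp e (z * q) = (\<Sum>k\<in>{1..e}. homog_comp k z * homog_comp (e - k) q)"
  unfolding homog_comp_mult
  by (rule sum.mono_neutral_right) (use assms in \<open>auto simp: not_less_eq_eq\<close>)

text \<open>
  In the application \<open>e = d - 2\<close>, \<open>H\<close> is the matrix along the arc, \<open>U\<close> and \<open>W\<close> are its rank factors, \<open>z\<close>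
  the corrections of the eliminated coordinates \<open>A\<close>, and \<open>G\<close> the Hessian. Contraction with the
  variables raises the degrees of both rank factors by one and that of the cofactor of each \<open>z\<close> by
  two; so all the factors have positive degree.
\<close>

lemma schmidt_decomp_of_truncated_hessian:
  fixes G :: "nat \<Rightarrow> nat \<Rightarrow> 'k::comm_ring_1 mpoly"
  assumes "finite A"
    and GQ: "\<And>a b. a < n \<Longrightarrow> b < n \<Longrightarrow> G a b = homog_comp e (H a b)
        - (\<Sum>l\<in>A. \<Sum>k\<in>{1..e}. homog_comp k (z l) * homog_comp (e - k) (Q a b l))"
    and HR: "\<And>a b. a < n \<Longrightarrow> b < n \<Longrightarrow> homog_comp e (H a b) = (\<Sum>t<r. homog_comp e (U t a * W t b))"
  shows "schmidt_decomp (r * Suc e + card A * e) (\<Sum>a<n. \<Sum>b<n. Var a * Var b * G a b)"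
proof -
  let ?P = "\<lambda>t k. (\<Sum>a<n. Var a * homog_comp k (U t a)) * (\<Sum>b<n. Var b * homog_comp (e - k) (W t b))"
  let ?R = "\<lambda>l k. homog_comp k (z l) * (\<Sum>a<n. \<Sum>b<n. Var a * Var b * homog_comp (e - k) (Q a b l))"
  have V: "homog (Suc k) (Var a * homog_comp k p)" for a k and p :: "'k mpoly"
    using homog_mult[OF homog_Var homog_homog_comp] by simp
  have VV: "homog (Suc (Suc k)) (Var a * Var b * homog_comp k p)" for a b k and p :: "'k mpoly"
    using homog_mult[OF homog_Var V] by (simp add: mult.assoc)
  have P: "schmidt_decomp 1 (?P t k)" for t k
    by (rule schmidt_decomp_mult[of "Suc k" _ "Suc (e - k)"]) (simp_all add: homog_sum V)
  have R: "schmidt_decomp 1 (?R l k)" if "k \<in> {1..e}" for l k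
    using that by (intro schmidt_decomp_mult[of k _ "Suc (Suc (e - k))"] homog_sum VV
        homog_homog_comp) simp_all
  have "schmidt_decomp (card {..<r} * (card {..e} * 1)) (\<Sum>t<r. \<Sum>k\<le>e. ?P t k)"
    by (intro schmidt_decomp_sum P) simp_all
  moreover have "schmidt_decomp (card A * (card {1..e} * 1)) (\<Sum>l\<in>A. \<Sum>k\<in>{1..e}. ?R l k)"
    by (intro schmidt_decomp_sum assms(1) R) simp_all
  ultimately have "schmidt_decomp (card {..<r} * (card {..e} * 1) + card A * (card {1..e} * 1))
      ((\<Sum>t<r. \<Sum>k\<le>e. ?P t k) - (\<Sum>l\<in>A. \<Sum>k\<in>{1..e}. ?R l k))"
    by (rule schmidt_decomp_diff)
  moreover have "(\<Sum>t<r. \<Sum>k\<le>e. ?P t k) = (\<Sum>a<n. \<Sum>b<n. Var a * Var b * homog_comp e (H a b))"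
  proof -
    have "(\<Sum>t<r. \<Sum>k\<le>e. ?P t k) =
        (\<Sum>t<r. \<Sum>k\<le>e. \<Sum>a<n. \<Sum>b<n. Var a * Var b
            * (homog_comp k (U t a) * homog_comp (e - k) (W t b)))"
      by (simp add: sum_product mult_ac)
    also have "\<dots> = (\<Sum>t<r. \<Sum>a<n. \<Sum>b<n. \<Sum>k\<le>e. Var a * Var b
        * (homog_comp k (U t a) * homog_comp (e - k) (W t b)))"
      by (subst sum.swap, subst (2) sum.swap) simp
    also have "\<dots> = (\<Sum>a<n. \<Sum>b<n. \<Sum>t<r. \<Sum>k\<le>e. Var a * Var b
        * (homog_comp k (U t a) * homog_comp (e - k) (W t b)))"
      by (subst sum.swap, subst (2) sum.swap) simp
    also have "\<dots> = (\<Sum>a<n. \<Sum>b<n. Var a * Var b * homog_comp e (H a b))"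
      by (intro sum.cong refl) (simp add: HR homog_comp_mult sum_distrib_left)
    finally show ?thesis .
  qed
  moreover have "(\<Sum>l\<in>A. \<Sum>k\<in>{1..e}. ?R l k) =
      (\<Sum>a<n. \<Sum>b<n. Var a * Var b * (\<Sum>l\<in>A. \<Sum>k\<in>{1..e}. homog_comp k (z l)
          * homog_comp (e - k) (Q a b l)))"
  proof -
    have "(\<Sum>l\<in>A. \<Sum>k\<in>{1..e}. ?R l k) =
        (\<Sum>l\<in>A. \<Sum>k\<in>{1..e}. \<Sum>a<n. \<Sum>b<n. Var a * Var b
            * (homog_comp k (z l) * homog_comp (e - k) (Q a b l)))"
      by (simp add: sum_distrib_left mult_ac)
    also have "\<dots> = (\<Sum>l\<in>A. \<Sum>a<n. \<Sum>b<n. \<Sum>k\<in>{1..e}. Var a * Var b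
        * (homog_comp k (z l) * homog_comp (e - k) (Q a b l)))"
      by (subst sum.swap, subst (2) sum.swap) simp
    also have "\<dots> = (\<Sum>a<n. \<Sum>b<n. \<Sum>l\<in>A. \<Sum>k\<in>{1..e}. Var a * Var b
        * (homog_comp k (z l) * homog_comp (e - k) (Q a b l)))"
      by (subst sum.swap, subst (2) sum.swap) simp
    finally show ?thesis by (simp add: sum_distrib_left)
  qed
  moreover have "(\<Sum>a<n. \<Sum>b<n. Var a * Var b * G a b) =
      (\<Sum>a<n. \<Sum>b<n. Var a * Var b * homog_comp e (H a b)) -
      (\<Sum>a<n. \<Sum>b<n. Var a * Var b * (\<Sum>l\<in>A. \<Sum>k\<in>{1..e}. homog_comp k (z l)
          * homog_comp (e - k) (Q a b l)))"
    by (simp add: GQ right_diff_distrib sum_subtractf)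
  ultimately show ?thesis by simp
qed

text \<open>
  The arc is constructed to order \<open>d - 1\<close>, which is what the comparison in degree \<open>d - 2\<close> requires.
  The base point is chosen off the denominators of the rank factorisation, the multipliers that
  bring the residual entries into the ideal of the elimination sequence, and the derivatives
  needed to solve for the eliminated coordinates.
\<close>

lemma schmidt_from_incidence:
  fixes E :: "(nat \<Rightarrow> 'k::alg_closed_field) set" and f :: "nat \<Rightarrow> 'k mpoly"
  assumes "irreducible_points E" "d \<ge> 2" "of_nat ((d - 1) * d) \<noteq> (0 :: 'k)"
    and forms: "\<And>i. i < s \<Longrightarrow> is_form n d (f i)" and "i0 < s"
    and kernel: "\<And>a. a < n \<Longrightarrow> (\<Sum>b<n. pencil_hessian n s i0 f a b * Var b) \<in> vanishing E"
    and bound: "\<And>L. elim_seq E ({..<n + n} \<union> coef_vars n s i0) L \<Longrightarrow> length L \<le> m"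
  shows "\<exists>c. (\<exists>i<s. c i \<noteq> 0) \<and> schmidt_decomp ((d - 1) * m) (\<Sum>i<s. const_mpoly (c i) * f i)"
proof -
  interpret irreducible_points E by fact
  define S where "S = {n..<n + n} \<union> coef_vars n s i0"
  define F where "F = pencil_hessian n s i0 f"
  have f: "f i \<in> polys_in {..<n}" if "i < s" for i
    using forms[OF that] by (simp add: is_form_def polys_on_eq)
  have F: "F a b \<in> polys_in S" for a b
    unfolding F_def S_def by (rule pencil_hessian_in[OF f])
  have disj: "{..<n} \<inter> S = {}" and union: "S \<union> {..<n} = {..<n + n} \<union> coef_vars n s i0"
    by (auto simp: S_def)
  have ker: "(\<Sum>b<n. F a b * Var b) \<in> vanishing E" if "a \<in> {..<n}" for a
    using kernel that by (simp add: F_def)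
  have "\<exists>r h U W Res. h \<notin> vanishing E \<and>
      (\<forall>a\<in>{..<n}. \<forall>b\<in>{..<n}. h * F a b = (\<Sum>t<r. U t a * W t b) + Res a b
          \<and> Res a b \<in> vanishing E \<inter> polys_in S) \<and>
      (\<forall>L. elim_seq E S L \<longrightarrow> (\<exists>L'. length L' = r + length L \<and> elim_seq E (S \<union> {..<n}) L'))"
    by (rule rank_factorization[OF finite_lessThan disj F ker])
  then obtain r h U W Res where RF: "h \<notin> vanishing E"
      "\<forall>a\<in>{..<n}. \<forall>b\<in>{..<n}. h * F a b = (\<Sum>t<r. U t a * W t b) + Res a b
          \<and> Res a b \<in> vanishing E \<inter> polys_in S"
      "\<forall>L. elim_seq E S L \<longrightarrow> (\<exists>L'. length L' = r + length L \<and> elim_seq E (S \<union> {..<n}) L')"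
    by (elim exE conjE) (rule that)
  note h = RF(1)
  have fact: "h * F a b = (\<Sum>t<r. U t a * W t b) + Res a b"
    and Res: "Res a b \<in> vanishing E \<inter> polys_in S" if "a < n" "b < n" for a b
    using RF(2) that by blast+
  have extend: "\<exists>L'. length L' = r + length L \<and> elim_seq E ({..<n + n} \<union> coef_vars n s i0) L'"
    if "elim_seq E S L" for L
    using RF(3) that unfolding union by blast
  have "finite S" by (simp add: S_def)
  then obtain L where L: "elim_seq E S L" "generically_generated E S (snd ` set L)"
    using elim_seq_exists[OF assms(1)] by blast
  have rL: "r + length L \<le> m" using extend[OF L(1)] bound by metis
  define h' where "h' = (\<lambda>a b. SOME q. q \<notin> vanishing E \<and> q * Res a b \<in> ideal_span (snd ` set L))"
  have h': "h' a b \<notin> vanishing E" "h' a b * Res a b \<in> ideal_span (snd ` set L)" if "a < n" "b < n"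
      for a b
  proof -
    have "\<exists>q. q \<notin> vanishing E \<and> q * Res a b \<in> ideal_span (snd ` set L)"
      using Res[OF that] L(2) unfolding generically_generated_def by blast
    then have "h' a b \<notin> vanishing E \<and> h' a b * Res a b \<in> ideal_span (snd ` set L)"
      unfolding h'_def by (rule someI_ex)
    then show "h' a b \<notin> vanishing E" "h' a b * Res a b \<in> ideal_span (snd ` set L)" by auto
  qed
  define Ps where "Ps = insert h (case_prod h' ` ({..<n} \<times> {..<n}) \<union>
      (\<lambda>x. partial_deriv (fst x) (snd x)) ` set L)"
  have "\<exists>y\<in>E. \<forall>p\<in>Ps. ev y p \<noteq> 0"
    by (rule common_point) (use h h' elim_seq_mem(4)[OF L(1)] in \<open>auto simp: Ps_def\<close>)
  then obtain y where y: "y \<in> E" "\<And>p. p \<in> Ps \<Longrightarrow> ev y p \<noteq> 0" by blast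
  define X0 where "X0 = (\<lambda>j. const_mpoly (y j) + (if n \<le> j \<and> j < n + n then Var (j - n) else 0))"
  have X0: "ev (\<lambda>_. 0) (X0 j) = y j" for j by (simp add: X0_def ev.hom_add)
  obtain X where X: "\<And>j. j \<notin> fst ` set L \<Longrightarrow> X j = X0 j" "\<And>j. ev (\<lambda>_. 0) (X j) = y j"
      "\<And>x. x \<in> set L \<Longrightarrow> order_ge (d - 1) (subst X (snd x))"
    using hensel[OF L(1) y(1) _ X0, of "d - 1"] y(2) unfolding Ps_def by blast
  have ev: "ev (\<lambda>_. 0) (subst X p) = ev y p" for p using X(2) by (simp add: ev_subst)
  have ResX: "order_ge (d - 1) (subst X (Res a b))" if ab: "a < n" "b < n" for a b
  proof -
    obtain A where "h' a b * Res a b = (\<Sum>p\<in>snd ` set L. A p * p)"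
      using h'(2)[OF ab] unfolding ideal_span_def by blast
    from arg_cong[OF this, of "subst X"]
    have "subst X (h' a b) * subst X (Res a b) = (\<Sum>p\<in>snd ` set L. subst X (A p) * subst X p)"
      by (simp only: subst.hom_mult subst.hom_sum)
    moreover have "order_ge (d - 1) (\<Sum>p\<in>snd ` set L. subst X (A p) * subst X p)"
      using X(3) by (intro order_ge_sum order_ge_mult_left) auto
    moreover have "ev (\<lambda>_. 0) (subst X (h' a b)) \<noteq> 0"
      unfolding ev by (rule y(2)) (use ab in \<open>auto simp: Ps_def\<close>)
    ultimately show ?thesis using order_ge_cancel by metis
  qed
  have "ev (\<lambda>_. 0) (subst X h) \<noteq> 0" unfolding ev by (rule y(2)) (simp add: Ps_def)
  then obtain u where u: "order_ge (d - 1) (1 - u * subst X h)" using order_ge_unit by blast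
  have d2: "d - 2 < d - 1" using assms(2) by simp
  have HR: "homog_comp (d - 2) (subst X (F a b))
      = (\<Sum>t<r. homog_comp (d - 2) ((u * subst X (U t a)) * subst X (W t b)))"
    if "a < n" "b < n" for a b
  proof -
    have "subst X h * subst X (F a b) = (\<Sum>t<r. subst X (U t a) * subst X (W t b))
        + subst X (Res a b)"
      using arg_cong[OF fact[OF that], of "subst X"]
      by (simp add: subst.hom_mult subst.hom_add subst.hom_sum)
    then have "u * (subst X h * subst X (F a b))
        = u * ((\<Sum>t<r. subst X (U t a) * subst X (W t b)) + subst X (Res a b))"
      by simp
    then have "subst X (F a b) - (\<Sum>t<r. (u * subst X (U t a)) * subst X (W t b)) =
        (1 - u * subst X h) * subst X (F a b) + u * subst X (Res a b)"
      by (simp add: sum_distrib_left algebra_simps)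
    also have "order_ge (d - 1) \<dots>"
      by (intro order_ge_add order_ge_mult_right[OF u] order_ge_mult_left ResX that)
    finally have "homog_comp (d - 2) (subst X (F a b)
        - (\<Sum>t<r. (u * subst X (U t a)) * subst X (W t b))) = 0"
      using d2 by (simp add: order_ge_def)
    then show ?thesis by (simp add: homog_comp_diff homog_comp_sum)
  qed
  define c where "c = (\<lambda>i. if i = i0 then 1 else y (n + n + i))"
  define z where "z = (\<lambda>j. X j - X0 j)"
  let ?A = "fst ` set L"
  define Q where "Q = (\<lambda>a b. SOME Q. subst X (F a b) = subst X0 (F a b) + (\<Sum>l\<in>?A. z l * Q l))"
  have Q: "subst X (F a b) = subst X0 (F a b) + (\<Sum>l\<in>?A. z l * Q a b l)" for a b
  proof -
    have "\<exists>Q. subst (\<lambda>j. X0 j + z j) (F a b) = subst X0 (F a b) + (\<Sum>l\<in>?A. z l * Q l)"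
      by (rule const.msubst_change) (use X(1) in \<open>auto simp: z_def\<close>)
    moreover have "(\<lambda>j. X0 j + z j) = X" by (simp add: z_def)
    ultimately have "\<exists>Q. subst X (F a b) = subst X0 (F a b) + (\<Sum>l\<in>?A. z l * Q l)" by simp
    then show ?thesis unfolding Q_def by (rule someI_ex)
  qed
  have z0: "homog_comp 0 (z l) = 0" for l
    by (simp add: homog_comp_zero_eq z_def ev.hom_minus X(2) X0)
  define G where "G = (\<lambda>a b. \<Sum>i<s. const_mpoly (c i) * partial_deriv a (partial_deriv b (f i)))"
  have G: "homog_comp (d - 2) (subst X0 (F a b)) = G a b" for a b
    unfolding F_def X0_def G_def c_def by (rule homog_comp_translate_pencil[OF forms])
  have GQ: "G a b = homog_comp (d - 2) (subst X (F a b)) -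
      (\<Sum>l\<in>?A. \<Sum>k\<in>{1..d - 2}. homog_comp k (z l) * homog_comp (d - 2 - k) (Q a b l))" for a b
    unfolding Q homog_comp_add homog_comp_sum homog_comp_mult_no_const[OF z0] G by simp
  have "schmidt_decomp (r * Suc (d - 2) + card ?A * (d - 2)) (\<Sum>a<n. \<Sum>b<n. Var a * Var b * G a b)"
    by (rule schmidt_decomp_of_truncated_hessian[OF _ GQ HR]) simp_all
  moreover have "r * Suc (d - 2) + card ?A * (d - 2) \<le> (d - 1) * m"
  proof -
    have "card ?A \<le> length L" using card_image_le[of "set L" fst] card_length[of L] by simp
    then have "card ?A * (d - 2) \<le> length L * (d - 1)" using d2 by (intro mult_le_mono) auto
    moreover have "Suc (d - 2) = d - 1" using assms(2) by simp
    moreover have "(d - 1) * (r + length L) = r * (d - 1) + length L * (d - 1)"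
      by (simp only: distrib_left mult.commute)
    ultimately have "r * Suc (d - 2) + card ?A * (d - 2) \<le> (d - 1) * (r + length L)" by simp
    also have "\<dots> \<le> (d - 1) * m" using rL by simp
    finally show ?thesis .
  qed
  ultimately have dec: "schmidt_decomp ((d - 1) * m) (\<Sum>a<n. \<Sum>b<n. Var a * Var b * G a b)"
    by (rule schmidt_decomp_mono)
  define K :: 'k where "K = of_nat ((d - 1) * d)"
  have "(\<Sum>a<n. \<Sum>b<n. Var a * Var b * G a b) =
      (\<Sum>i<s. \<Sum>a<n. \<Sum>b<n. const_mpoly (c i) * (Var a * Var b
          * partial_deriv a (partial_deriv b (f i))))"
    unfolding G_def sum_distrib_left by (subst sum.swap, subst (2) sum.swap) (simp add: mult_ac)
  also have "\<dots> = (\<Sum>i<s. const_mpoly (c i) * (of_nat ((d - 1) * d) * f i))"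
    by (intro sum.cong refl) (simp add: double_euler[OF forms] flip: sum_distrib_left)
  also have "\<dots> = const_mpoly K * (\<Sum>i<s. const_mpoly (c i) * f i)"
    unfolding sum_distrib_left K_def const.hom_of_nat by (intro sum.cong refl mult.left_commute)
  finally have "const_mpoly (1 / K) * (\<Sum>a<n. \<Sum>b<n. Var a * Var b * G a b) =
      const_mpoly (1 / K * K) * (\<Sum>i<s. const_mpoly (c i) * f i)"
    by (simp only: mult.assoc const.hom_mult)
  also have "const_mpoly (1 / K * K) = 1" using assms(3) by (simp add: K_def)
  finally have "schmidt_decomp ((d - 1) * m) (\<Sum>i<s. const_mpoly (c i) * f i)"
    using schmidt_decomp_const_mult[OF dec, of "1 / K"] by simp
  moreover have "c i0 \<noteq> 0" by (simp add: c_def)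
  ultimately show ?thesis using assms(5) by blast
qed

text \<open>
  The graph of the rational functions \<open>C\<^sub>i / C\<^sub>i\<^sub>0\<close> over \<open>Y\<close> is generated generically by a full
  elimination sequence of \<open>Y\<close> together with the equations \<open>D c\<^sub>i = C\<^sub>i\<close> with \<open>D = C\<^sub>i\<^sub>0\<close>, one for each of
  the \<open>s - 1\<close> new coordinates.
\<close>

lemma incidence_exists:
  fixes Y :: "'k::alg_closed_field vec set" and f :: "nat \<Rightarrow> 'k mpoly"
  assumes Y: "irreducible_closed (n + n) Y" and codim: "codim_irreducible (n + n) Y \<le> enat g"
    and f: "\<And>i. i < s \<Longrightarrow> f i \<in> polys_in {..<n}"
    and dependent: "\<And>y. y \<in> Y \<Longrightarrow> \<exists>c. (\<exists>i<s. c i \<noteq> 0) \<and> (\<forall>a<n. (\<Sum>i<s. c i *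
      (\<Sum>b<n. ev (\<lambda>k. y $ (n + k)) (partial_deriv a (partial_deriv b (f i))) * y $ b)) = 0)"
  shows "\<exists>E i0. irreducible_points E \<and> i0 < s \<and>
    (\<forall>a<n. (\<Sum>b<n. pencil_hessian n s i0 f a b * Var b) \<in> vanishing E) \<and>
    (\<forall>L. elim_seq E ({..<n + n} \<union> coef_vars n s i0) L \<longrightarrow> length L \<le> g + (s - 1))"
proof -
  let ?N = "n + n"
  define E0 where "E0 = points ?N Y"
  interpret E0: irreducible_points E0 unfolding E0_def by (rule irreducible_points_of_closed[OF Y])
  define H where "H = (\<lambda>i a b. shift_vars n (partial_deriv a (partial_deriv b (f i))))"
  define B where "B = (\<lambda>i a. \<Sum>b<n. H i a b * Var b)"
  have H: "H i a b \<in> polys_in {n..<?N}" if "i < s" for i a b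
    unfolding H_def using f[OF that] by (intro shift_vars_in partial_deriv_in)
  have B: "B i a \<in> polys_in {..<?N}" if "i < s" for i a
    unfolding B_def
    by (intro polys_in_sum polys_in_mult polys_in_Var subsetD[OF polys_in_mono H[OF that]]) auto
  have dep: "\<exists>c. (\<exists>i\<in>{..<s}. c i \<noteq> 0) \<and> (\<forall>a\<in>{..<n}. (\<Sum>i<s. c i * ev p (B i a)) = 0)"
    if p: "p \<in> E0" for p
  proof -
    obtain y where y: "y \<in> Y" "p = (\<lambda>i. if i < ?N then y $ i else 0)"
      using p by (auto simp: E0_def points_def)
    obtain c where c: "\<exists>i<s. c i \<noteq> 0" "\<forall>a<n. (\<Sum>i<s. c i *
        (\<Sum>b<n. ev (\<lambda>k. y $ (n + k)) (partial_deriv a (partial_deriv b (f i))) * y $ b)) = 0"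
      using dependent[OF y(1)] by blast
    have "ev p (B i a) = (\<Sum>b<n. ev (\<lambda>k. y $ (n + k)) (partial_deriv a (partial_deriv b (f i)))
        * y $ b)"
      if "i < s" for i a
    proof -
      have "ev (\<lambda>k. p (n + k)) (partial_deriv a (partial_deriv b (f i))) =
          ev (\<lambda>k. y $ (n + k)) (partial_deriv a (partial_deriv b (f i)))" for b
        by (rule msubst_cong[OF partial_deriv_in[OF partial_deriv_in[OF f[OF that]]]])
            (simp add: y(2))
      then show ?thesis by (simp add: B_def H_def ev.hom_sum ev.hom_mult ev_shift_vars y(2))
    qed
    then show ?thesis using c by (intro exI[of _ c]) auto
  qed
  have "\<exists>C. (\<forall>i\<in>{..<s}. C i \<in> polys_in {..<?N}) \<and> (\<exists>i\<in>{..<s}. C i \<notin> vanishing E0) \<and>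
      (\<forall>a\<in>{..<n}. (\<Sum>i<s. C i * B i a) \<in> vanishing E0)"
    by (rule E0.polynomial_dependence[OF finite_lessThan E0.one_notin_vanishing])
        (use B in simp, rule dep)
  then obtain C where C: "\<And>i. i < s \<Longrightarrow> C i \<in> polys_in {..<?N}" "\<exists>i<s. C i \<notin> vanishing E0"
      "\<And>a. a < n \<Longrightarrow> (\<Sum>i<s. C i * B i a) \<in> vanishing E0"
    by (elim exE conjE) (auto intro: that)
  obtain i0 where i0: "i0 < s" "C i0 \<notin> vanishing E0" using C(2) by blast
  define D where "D = C i0"
  define lift where "lift = (\<lambda>(p :: nat \<Rightarrow> 'k) j. if j < ?N then p j
      else if j < ?N + s then ev p (C (j - ?N)) / ev p D else 0)"
  define E where "E = lift ` {p \<in> E0. ev p D \<noteq> 0}"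
  have E: "irreducible_points E"
    unfolding E_def
  proof (rule irreducible_graph[OF E0.irreducible_points_axioms])
    show "D \<notin> vanishing E0" using i0 by (simp add: D_def)
    fix j
    consider "j < ?N" | "\<not> j < ?N" "j < ?N + s" | "\<not> j < ?N + s" "\<not> j < ?N" by linarith
    then show "\<exists>q M. \<forall>p\<in>E0. ev p D \<noteq> 0 \<longrightarrow> ev p q = ev p D ^ M * lift p j"
    proof cases
      case 1
      then show ?thesis by (intro exI[of _ "Var j"] exI[of _ 0]) (simp add: lift_def)
    next
      case 2
      then show ?thesis by (intro exI[of _ "C (j - ?N)"] exI[of _ 1]) (simp add: lift_def)
    next
      case 3
      then show ?thesis by (intro exI[of _ 0] exI[of _ 0]) (simp add: lift_def)
    qed
  qed
  interpret E: irreducible_points E by (rule E)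
  have ev_lift: "ev (lift p) q = ev p q" if "q \<in> polys_in {..<?N}" for p q
    by (rule msubst_cong[OF that]) (simp add: lift_def)
  have vanishing_eq: "q \<in> vanishing E \<longleftrightarrow> q \<in> vanishing E0" if q: "q \<in> polys_in {..<?N}" for q
  proof
    assume "q \<in> vanishing E"
    then have "ev p (D * q) = 0" if "p \<in> E0" for p
      using that ev_lift[OF q, of p] by (cases "ev p D = 0")
          (auto simp: E_def vanishing_def ev.hom_mult)
    then have "D * q \<in> vanishing E0" by (simp add: vanishing_def)
    then show "q \<in> vanishing E0" using E0.prime i0(2) by (auto simp: D_def)
  next
    assume "q \<in> vanishing E0"
    then show "q \<in> vanishing E" using ev_lift[OF q] by (auto simp: E_def vanishing_def)
  qed
  have kernel: "(\<Sum>b<n. pencil_hessian n s i0 f a b * Var b) \<in> vanishing E" if a: "a < n" for a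
  proof -
    have "ev (lift p) (\<Sum>b<n. pencil_hessian n s i0 f a b * Var b) = 0" if p: "p \<in> E0" "ev p D \<noteq> 0"
        for p
    proof -
      have coef: "ev (lift p) (if i = i0 then 1 else Var (?N + i)) = ev p (C i) / ev p D"
          if "i < s" for i
        using that p(2) by (auto simp: lift_def D_def)
      have "(\<Sum>b<n. pencil_hessian n s i0 f a b * Var b) =
          (\<Sum>i<s. (if i = i0 then 1 else Var (?N + i)) * B i a)"
        unfolding pencil_hessian_def B_def H_def sum_distrib_right sum_distrib_left
        by (subst sum.swap) (simp add: mult.assoc)
      then have "ev (lift p) (\<Sum>b<n. pencil_hessian n s i0 f a b * Var b) =
          (\<Sum>i<s. ev p (C i) / ev p D * ev p (B i a))"
        using coef ev_lift[OF B] by (simp add: ev.hom_sum ev.hom_mult)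
      also have "\<dots> = ev p (\<Sum>i<s. C i * B i a) / ev p D"
        by (simp add: ev.hom_sum ev.hom_mult sum_divide_distrib)
      also have "\<dots> = 0" using vanishingD[OF C(3)[OF a] p(1)] by simp
      finally show ?thesis .
    qed
    then show ?thesis by (auto simp: E_def vanishing_def)
  qed
  obtain L where L: "elim_seq E {..<?N} L" "generically_generated E {..<?N} (snd ` set L)"
    using elim_seq_exists[OF E, of "{..<?N}"] by auto
  have "elim_seq E0 {..<?N} L" using elim_seq_cong[OF vanishing_eq order_refl] L(1) by blast
  then have "enat (length L) \<le> enat g"
    using elim_seq_le_codim[OF Y] codim unfolding E0_def by (metis order_trans)
  then have Lg: "length L \<le> g" by simp
  have "\<exists>Bs. generically_generated E ({..<?N} \<union> (\<lambda>i. ?N + i) ` I) Bs \<and> finite Bs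
      \<and> Bs \<subseteq> vanishing E \<and> card Bs \<le> g + card I"
    if "finite I" "I \<subseteq> {..<s}" for I
    using that
  proof (induction I rule: finite_induct)
    case empty
    have "card (snd ` set L) \<le> g"
      using card_image_le[of "set L" snd] card_length[of L] Lg by simp
    moreover have "snd ` set L \<subseteq> vanishing E" using elim_seq_mem(2)[OF L(1)] by auto
    ultimately show ?case using L(2) by (intro exI[of _ "snd ` set L"]) simp
  next
    case (insert i I)
    let ?S = "{..<?N} \<union> (\<lambda>i. ?N + i) ` I"
    obtain Bs where Bs: "generically_generated E ?S Bs" "finite Bs" "Bs \<subseteq> vanishing E" "card Bs
        \<le> g + card I"
      using insert by auto
    define P where "P = [:- C i, D:]"
    have D: "D \<notin> vanishing E" using vanishing_eq[of D] C(1)[OF i0(1)] i0(2) by (simp add: D_def)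
    then have D0: "D \<noteq> 0" by auto
    have mono: "polys_in {..<?N} \<subseteq> polys_in ?S" by (rule polys_in_mono) auto
    have "P \<in> polys_over ?S"
      unfolding P_def using mono C(1)[of i] C(1)[OF i0(1)] insert.prems
      by (intro polys_over_pCons polys_in_uminus polys_over_0) (auto simp: D_def)
    moreover have PE: "poly P (Var (?N + i)) \<in> vanishing E"
    proof -
      have "ev (lift p) (poly P (Var (?N + i))) = 0" if "p \<in> E0" "ev p D \<noteq> 0" for p
      proof -
        have "lift p (?N + i) = ev p (C i) / ev p D" using insert.prems by (simp add: lift_def)
        moreover have "ev (lift p) (C i) = ev p (C i)" "ev (lift p) D = ev p D"
          using C(1) i0(1) insert.prems by (auto intro!: ev_lift simp: D_def)
        moreover have "poly P (Var (?N + i)) = Var (?N + i) * D - C i" by (simp add: P_def)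
        ultimately show ?thesis using that(2) by (simp add: ev.hom_minus ev.hom_mult)
      qed
      then show ?thesis by (auto simp: E_def vanishing_def)
    qed
    moreover have "lead_coeff P \<notin> vanishing E" "degree P = 1" using D D0 by (simp_all add: P_def)
    moreover have "\<forall>a. coeff R a \<in> vanishing E"
      if "poly R (Var (?N + i)) \<in> vanishing E" "\<forall>a\<ge>degree P. coeff R a = 0" for R
    proof -
      have R: "R = [:coeff R 0:]"
        using that(2) \<open>degree P = 1\<close> by (intro poly_eqI) (auto simp: coeff_pCons split: nat.split)
      have "poly R (Var (?N + i)) = coeff R 0"
        using arg_cong[OF R, of "\<lambda>p. poly p (Var (?N + i))"] by simp
      then show ?thesis using that \<open>degree P = 1\<close>
          by (metis not_less_eq_eq One_nat_def bot_nat_0.extremum_unique vanishing_0)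
    qed
    moreover have "?N + i \<notin> ?S" using insert.hyps by auto
    ultimately have "generically_generated E (insert (?N + i) ?S)
        (insert (poly P (Var (?N + i))) Bs)"
      using Bs(1,2) by (intro E.generically_generated_insert) auto
    also have "insert (?N + i) ?S = {..<?N} \<union> (\<lambda>i. ?N + i) ` insert i I" by auto
    finally have "generically_generated E ({..<?N} \<union> (\<lambda>i. ?N + i) ` insert i I)
        (insert (poly P (Var (?N + i))) Bs)" .
    moreover have "card (insert (poly P (Var (?N + i))) Bs) \<le> g + card (insert i I)"
      using Bs(2,4) insert.hyps by (simp add: card_insert_if)
    moreover have "finite (insert (poly P (Var (?N + i))) Bs)"
        "insert (poly P (Var (?N + i))) Bs \<subseteq> vanishing E"
      using Bs(2,3) PE by auto
    ultimately show ?case by blast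
  qed
  from this[of "{..<s} - {i0}"] obtain Bs where Bs:
      "generically_generated E ({..<?N} \<union> coef_vars n s i0) Bs"
      "finite Bs" "Bs \<subseteq> vanishing E" "card Bs \<le> g + (s - 1)"
    using i0(1) by auto
  have "length L' \<le> g + (s - 1)" if "elim_seq E ({..<?N} \<union> coef_vars n s i0) L'" for L'
    using E.elim_seq_length_le[OF that Bs(1-3)] Bs(4) by simp
  then show ?thesis using E i0(1) kernel by blast
qed

section \<open>Bounds for the Schmidt rank\<close>

text \<open>
  A maximal independent set of columns has fewer than \<open>n\<close> elements, so some non-zero functional
  kills it, and with it the span of all the columns.
\<close>

lemma (in vec_space) rank_less_left_kernel:
  assumes A: "A \<in> carrier_mat n nc" and "rank A < n"
  shows "\<exists>c. (\<exists>i<n. c i \<noteq> 0) \<and> (\<forall>j<nc. (\<Sum>i<n. c i * A $$ (i, j)) = 0)"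
proof -
  have "lin_indpt {}" using finite_lin_indpt2[of "{}"] by auto
  then obtain S where S: "finite S" "maximal S (\<lambda>T. T \<subseteq> set (cols A) \<and> lin_indpt T)"
    using maximal_exists_superset[of "set (cols A)" "\<lambda>T. T \<subseteq> set (cols A) \<and> lin_indpt T" "{}"]
        by auto
  then have S': "S \<subseteq> set (cols A)" "lin_indpt S" by (auto simp: maximal_def)
  have carrier: "set (cols A) \<subseteq> carrier_vec n" using A cols_dim[of A] by simp
  have "card S < card {..<n}" using rank_card_indpt[OF A S(2)] assms(2) by simp
  then obtain c where c: "\<exists>i\<in>{..<n}. c i \<noteq> 0" "\<forall>v\<in>S. (\<Sum>i<n. c i * v $ i) = 0"
    using nonzero_solution[OF S(1) finite_lessThan, of n "\<lambda>i v. v $ i"] by blast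
  have zero: "(\<Sum>i<n. c i * v $ i) = 0" if v: "v \<in> set (cols A)" for v
  proof (cases "v \<in> S")
    case False
    have "v \<in> span S"
    proof (rule ccontr)
      assume "v \<notin> span S"
      then have "lin_indpt (S \<union> {v})"
        using lin_dep_iff_in_span[of S v] S' carrier v False by auto
      then have "S \<union> {v} = S" using S(2) S'(1) v unfolding maximal_def by blast
      then show False using False by blast
    qed
    then obtain a where a: "lincomb a S = v"
      using finite_in_span[OF S(1)] S'(1) carrier by fastforce
    have "(\<Sum>i<n. c i * v $ i) = (\<Sum>i<n. c i * (\<Sum>w\<in>S. a w * w $ i))"
      using S'(1) carrier by (intro sum.cong) (auto simp: a[symmetric] lincomb_index)
    also have "\<dots> = (\<Sum>w\<in>S. a w * (\<Sum>i<n. c i * w $ i))"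
      unfolding sum_distrib_left by (subst sum.swap) (simp add: mult.left_commute)
    also have "\<dots> = 0" using c(2) by simp
    finally show ?thesis .
  qed (use c(2) in blast)
  have "(\<Sum>i<n. c i * A $$ (i, j)) = 0" if "j < nc" for j
  proof -
    have "col A j \<in> set (cols A)" using A that by (auto simp: cols_def)
    moreover have "(\<Sum>i<n. c i * A $$ (i, j)) = (\<Sum>i<n. c i * col A j $ i)"
      using A that by (intro sum.cong) auto
    ultimately show ?thesis using zero by simp
  qed
  then show ?thesis using c(1) by blast
qed

lemma hessian_index:
  "x \<in> carrier_vec n \<Longrightarrow> v \<in> carrier_vec n \<Longrightarrow> a < n \<Longrightarrow>
    hessian_form n f x (unit_vec n a) v =
    (\<Sum>b<n. ev (\<lambda>k. x $ k) (partial_deriv a (partial_deriv b f)) * v $ b)"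
proof -
  assume *: "x \<in> carrier_vec n" "v \<in> carrier_vec n" "a < n"
  have "hessian n f x *\<^sub>v v \<in> carrier_vec n" using *
      by (intro mult_mat_vec_carrier[of _ n n]) (auto simp: hessian_def)
  then have "hessian_form n f x (unit_vec n a) v = (hessian n f x *\<^sub>v v) $ a"
    unfolding hessian_form_def using *(3) by (rule scalar_prod_left_unit)
  also have "\<dots> = (\<Sum>b<n. ev (\<lambda>k. x $ k) (partial_deriv a (partial_deriv b f)) * v $ b)"
    using * by (simp add: hessian_def scalar_prod_def mpoly_eval_eq_ev atLeast0LessThan)
  finally show ?thesis .
qed

lemma hessian_form_sym:
  fixes f :: "'k::comm_ring_1 mpoly"
  assumes "v \<in> carrier_vec n" "w \<in> carrier_vec n"
  shows "hessian_form n f x v w = hessian_form n f x w v"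
proof -
  have "hessian_form n f x v w = (\<Sum>a<n. v $ a *
      (\<Sum>b<n. mpoly_eval (partial_deriv a (partial_deriv b f)) x * w $ b))"
    if "v \<in> carrier_vec n" "w \<in> carrier_vec n" for v w
    using that by (simp add: hessian_form_def hessian_def scalar_prod_def atLeast0LessThan)
  then show ?thesis using assms
    by (simp add: sum_distrib_left) (subst sum.swap, simp add: partial_deriv_commute mult_ac)
qed

lemma codim_attained:
  assumes "codim N Z = enat g"
  shows "\<exists>Y. irreducible_closed N Y \<and> Y \<subseteq> Z \<and> codim_irreducible N Y = enat g"
proof -
  let ?S = "{codim_irreducible N Y | Y. irreducible_closed N Y \<and> Y \<subseteq> Z}"
  have "?S \<noteq> {}"
  proof
    assume "?S = {}"
    then show False using assms unfolding codim_def by (simp add: Inf_enat_def)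
  qed
  then have "Inf ?S \<in> ?S" unfolding Inf_enat_def by (auto intro: LeastI)
  then show ?thesis using assms unfolding codim_def by auto
qed

text \<open>
  Both loci of the theorem are instances of \<open>Z\<close>: the one of a single form with \<open>s = 1\<close> and \<open>c = 1\<close>,
  the one of a collection because a matrix of rank less than \<open>s\<close> has a non-trivial relation
  between its rows.
\<close>

lemma pencil_bound:
  fixes f :: "nat \<Rightarrow> 'k::alg_closed_field mpoly"
  assumes "d \<ge> 2" "\<not> CHAR('k) dvd (d - 1) * d"
    and forms: "\<And>i. i < s \<Longrightarrow> is_form n d (f i)"
    and codim: "codim (n + n) Z = enat g"
    and dependent: "\<And>y. y \<in> Z \<Longrightarrow> \<exists>v x c. y = v @\<^sub>v x \<and> v \<in> carrier_vec n \<and> x \<in> carrier_vec n \<and>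
      (\<exists>i<s. c i \<noteq> 0) \<and> (\<forall>a<n. (\<Sum>i<s. c i * hessian_form n (f i) x (unit_vec n a) v) = 0)"
  shows "\<exists>c. (\<exists>i<s. c i \<noteq> 0) \<and>
    schmidt_decomp ((d - 1) * (g + (s - 1))) (\<Sum>i<s. const_mpoly (c i) * f i)"
proof -
  obtain Y where Y: "irreducible_closed (n + n) Y" "Y \<subseteq> Z" "codim_irreducible (n + n) Y = enat g"
    using codim_attained[OF codim] by blast
  have f: "f i \<in> polys_in {..<n}" if "i < s" for i
    using forms[OF that] by (simp add: is_form_def polys_on_eq)
  have "\<exists>c. (\<exists>i<s. c i \<noteq> 0) \<and> (\<forall>a<n. (\<Sum>i<s. c i *
      (\<Sum>b<n. ev (\<lambda>k. y $ (n + k)) (partial_deriv a (partial_deriv b (f i))) * y $ b)) = 0)"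
    if y: "y \<in> Y" for y
  proof -
    obtain v x c where vx: "y = v @\<^sub>v x" "v \<in> carrier_vec n" "x \<in> carrier_vec n"
      and c: "\<exists>i<s. c i \<noteq> 0" "\<forall>a<n. (\<Sum>i<s. c i * hessian_form n (f i) x (unit_vec n a) v) = 0"
      using dependent y Y(2) by blast
    have "(\<Sum>b<n. ev (\<lambda>k. y $ (n + k)) (partial_deriv a (partial_deriv b (f i))) * y $ b) =
        hessian_form n (f i) x (unit_vec n a) v" if "a < n" "i < s" for a i
    proof -
      have "ev (\<lambda>k. y $ (n + k)) (partial_deriv a (partial_deriv b (f i))) =
          ev (\<lambda>k. x $ k) (partial_deriv a (partial_deriv b (f i)))" for b
        by (rule msubst_cong[OF partial_deriv_in[OF partial_deriv_in[OF f[OF that(2)]]]])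
          (use vx in simp)
      then show ?thesis using vx by (simp add: hessian_index[OF vx(3,2) that(1)])
    qed
    then show ?thesis using c by (intro exI[of _ c]) auto
  qed
  then obtain E i0 where E: "irreducible_points E" "i0 < s"
      "\<And>a. a < n \<Longrightarrow> (\<Sum>b<n. pencil_hessian n s i0 f a b * Var b) \<in> vanishing E"
      "\<And>L. elim_seq E ({..<n + n} \<union> coef_vars n s i0) L \<Longrightarrow> length L \<le> g + (s - 1)"
    using incidence_exists[of n Y g s f] Y(1,3) f by auto
  have "of_nat ((d - 1) * d) \<noteq> (0 :: 'k)"
    using assms(2) by (simp only: of_nat_eq_0_iff_char_dvd not_False_eq_True)
  from schmidt_from_incidence[OF E(1) assms(1) this forms E(2,3,4)] show ?thesis .
qed

theorem theoremA2:
  fixes d n :: nat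
  assumes "d \<ge> 2"
    and "\<not> CHAR('k::alg_closed_field) dvd (d - 1) * d"
  shows "(\<forall>f :: 'k mpoly. is_form n d f \<longrightarrow>
            schmidt_rank n f \<le> enat (d - 1) * g_sym n f) \<and>
         (\<forall>(s::nat) (f :: nat \<Rightarrow> 'k mpoly).
            s \<ge> 1 \<and> (\<forall>i<s. is_form n d (f i)) \<and> complete_intersection n s f \<longrightarrow>
            schmidt_rank_coll n s f \<le> enat (d - 1) * (g_sym_coll n s f + enat (s - 1)))"
proof (intro conjI allI impI)
  have inf: "enat (d - 1) * \<infinity> = \<infinity>" using assms(1) by (simp add: imult_is_infinity zero_enat_def)
  fix f :: "'k mpoly" assume f: "is_form n d f"
  show "schmidt_rank n f \<le> enat (d - 1) * g_sym n f"
  proof (cases "g_sym n f")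
    case infinity
    then show ?thesis using inf by simp
  next
    case (enat g)
    have "\<exists>c :: nat \<Rightarrow> 'k. (\<exists>i<1. c i \<noteq> 0) \<and> schmidt_decomp ((d - 1) * (g + (1 - 1)))
        (\<Sum>i<1. const_mpoly (c i) * f)"
    proof (rule pencil_bound[where f = "\<lambda>_. f" and s = 1 and Z = "Z_sym n f", OF assms f])
      show "codim (n + n) (Z_sym n f) = enat g" using enat by (simp add: g_sym_def)
      fix y assume "y \<in> Z_sym n f"
      then obtain v x where vx: "y = v @\<^sub>v x" "v \<in> carrier_vec n" "x \<in> carrier_vec n"
          "\<forall>w\<in>carrier_vec n. hessian_form n f x v w = 0"
        unfolding Z_sym_def by blast
      then have "hessian_form n f x (unit_vec n a) v = 0" for a
        using hessian_form_sym[of "unit_vec n a" n v f x] by simp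
      then show "\<exists>v x (c :: nat \<Rightarrow> 'k). y = v @\<^sub>v x \<and> v \<in> carrier_vec n \<and> x \<in> carrier_vec n \<and>
          (\<exists>i<1. c i \<noteq> 0) \<and> (\<forall>a<n. (\<Sum>i<1. c i * hessian_form n f x (unit_vec n a) v) = 0)"
        using vx(1-3) by (intro exI[of _ v] exI[of _ x] exI[of _ "\<lambda>_. 1"]) auto
    qed
    then obtain c :: 'k where c: "c \<noteq> 0" "schmidt_decomp ((d - 1) * g) (const_mpoly c * f)" by auto
    have "const_mpoly (1 / c) * const_mpoly c = 1"
      unfolding const.hom_mult[symmetric] using c(1) by simp
    then have "const_mpoly (1 / c) * (const_mpoly c * f) = f" by (simp flip: mult.assoc)
    with schmidt_decomp_const_mult[OF c(2), of "1 / c"] have "schmidt_decomp ((d - 1) * g) f"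
        by metis
    moreover have "f \<in> polys_on n" using f by (simp add: is_form_def)
    ultimately have "schmidt_rank n f \<le> enat ((d - 1) * g)" by (rule schmidt_rank_le)
    then show ?thesis using enat by simp
  qed
next
  have inf: "enat (d - 1) * \<infinity> = \<infinity>" using assms(1) by (simp add: imult_is_infinity zero_enat_def)
  fix s and f :: "nat \<Rightarrow> 'k mpoly"
  assume f: "s \<ge> 1 \<and> (\<forall>i<s. is_form n d (f i)) \<and> complete_intersection n s f"
  show "schmidt_rank_coll n s f \<le> enat (d - 1) * (g_sym_coll n s f + enat (s - 1))"
  proof (cases "g_sym_coll n s f")
    case infinity
    then show ?thesis using inf by simp
  next
    case (enat g)
    have "\<exists>c. (\<exists>i<s. c i \<noteq> 0) \<and> schmidt_decomp ((d - 1) * (g + (s - 1)))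
        (\<Sum>i<s. const_mpoly (c i) * f i)"
    proof (rule pencil_bound[OF assms])
      show "codim (n + n) (Z_sym_coll n s f) = enat g" using enat by (simp add: g_sym_coll_def)
      fix y assume "y \<in> Z_sym_coll n s f"
      then obtain v x where vx: "y = v @\<^sub>v x" "v \<in> carrier_vec n" "x \<in> carrier_vec n"
          "vec_space.rank s (hessian_map n s f v x) < s"
        unfolding Z_sym_coll_def by blast
      have "hessian_map n s f v x \<in> carrier_mat s n" by (simp add: hessian_map_def)
      from vec_space.rank_less_left_kernel[OF this vx(4)]
      obtain c where "\<exists>i<s. c i \<noteq> 0" "\<forall>a<n. (\<Sum>i<s. c i * hessian_map n s f v x $$ (i, a)) = 0"
          by blast
      moreover have "(\<Sum>i<s. c i * hessian_map n s f v x $$ (i, a)) =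
          (\<Sum>i<s. c i * hessian_form n (f i) x (unit_vec n a) v)" if "a < n" for a
        using that by (intro sum.cong) (simp_all add: hessian_map_def)
      ultimately show "\<exists>v x c. y = v @\<^sub>v x \<and> v \<in> carrier_vec n \<and> x \<in> carrier_vec n \<and>
          (\<exists>i<s. c i \<noteq> 0) \<and> (\<forall>a<n. (\<Sum>i<s. c i * hessian_form n (f i) x (unit_vec n a) v) = 0)"
        using vx(1-3) by (intro exI[of _ v] exI[of _ x] exI[of _ c]) auto
    qed (use f in blast)
    then obtain c where c: "\<exists>i<s. c i \<noteq> 0"
        "schmidt_decomp ((d - 1) * (g + (s - 1))) (\<Sum>i<s. const_mpoly (c i) * f i)" by blast
    have sum: "(\<Sum>i<s. const_mpoly (vec s c $ i) * f i) = (\<Sum>i<s. const_mpoly (c i) * f i)"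
      by (intro sum.cong) simp_all
    have "(\<Sum>i<s. const_mpoly (c i) * f i) \<in> polys_on n"
      unfolding polys_on_eq using f
      by (intro polys_in_sum polys_in_mult polys_in_const) (auto simp: is_form_def polys_on_eq)
    then have le: "schmidt_rank n (\<Sum>i<s. const_mpoly (vec s c $ i) * f i)
        \<le> enat ((d - 1) * (g + (s - 1)))"
      unfolding sum by (rule schmidt_rank_le[OF c(2)])
    have "vec s c \<noteq> 0\<^sub>v s" using c(1) by (auto simp: vec_eq_iff)
    then have "schmidt_rank_coll n s f \<le> schmidt_rank n (\<Sum>i<s. const_mpoly (vec s c $ i) * f i)"
      unfolding schmidt_rank_coll_def by (intro Inf_lower CollectI exI[of _ "vec s c"]) auto
    then have "schmidt_rank_coll n s f \<le> enat ((d - 1) * (g + (s - 1)))" using le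
        by (rule order_trans)
    then show ?thesis using enat by simp
  qed
qed

end
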